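(* Consider the sequential stopping procedure with online subsampling described in the context, with input $\delta\in(0,1)$, exponents $r,\nu$, and lower bound $\underline c>0$, where $0<\nu<\frac1{1-h}$. Let $F$ be the distribution function of $W_1:=Y_1(\Phi_1(1))/\sqrt{Y_2(\Phi_1(1))}$, where $\Phi_1(u):=\inf\{s>0:\sqrt{Y_2(s)}/s<u\}$ for $u>0$. Let $c_l=F^{\leftarrow}(\delta/2)$, $c_u=F^{\leftarrow}(1-\delta/2)$ and $c^*=c_u-c_l$. Suppose that: (a) the global pair $(Z_1,Z_2)$ and the local pairs $(Z_1^{(j)},Z_2^{(j)})$ satisfy the functional limit condition with parameters $(\mu,h,\ell,Y_1,Y_2)$ and the no-early-stopping condition with exponent $\nu$ (defined in the context); (b) the local simulation streams are independent copies (of the global stream and of each other) and are independent of the global stream; (c) $F$ is continuous and its quantiles $c_l,c_u$ are uniquely identified: for every $\xi>0$, $$F(c_l-\xi)<\tfrac{\delta}{2}<F(c_l+\xi),\qquad F(c_u-\xi)<1-\tfrac{\delta}{2}<F(c_u+\xi);$$ (d) $r\in(0,1)$; (e) $0<\underline c<c_u-c_l$. Assume also that $\Phi_1(1)>0$ almost surely and that $\Phi_1(\cdot)$ is almost surely continuous at $1$ and at $(c^* )^{-1}$. Then, as $\varepsilon\to0^+$, $$\big(c_{l,T(\varepsilon)}(\varepsilon),\,c_{u,T(\varepsilon)}(\varepsilon)\big)\to(c_l,c_u)\quad\text{in probability.}$$ Moreover, writing $T=T(\varepsilon)$, the feasible confidence interval $$\widehat{\mathrm{CI}}(\varepsilon):=\Big[\frac{Z_1(T)}{T}-c_{u,T}(\varepsilon)\sqrt{\frac{Z_2(T)}{T^2}},\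 \frac{Z_1(T)}{T}-c_{l,T}(\varepsilon)\sqrt{\frac{Z_2(T)}{T^2}}\Big]$$ satisfies $\mathbb P(\mu\in\widehat{\mathrm{CI}}(\varepsilon))\to1-\delta$ as $\varepsilon\to0^+$.
   Context: Conventions. $\inf\varnothing=+\infty$; $F^{\leftarrow}(p)=\inf\{x:F(x)\ge p\}$. Whenever a terminal self-normalized statistic has a zero denominator, it is defined to be zero. Procedure. There is a global pair of processes $(Z_1,Z_2)$ and a sequence of local pairs $(Z_1^{(j)},Z_2^{(j)})$, $j\ge1$. Given accuracy $\varepsilon>0$, the local procedures are run one after another, one time unit per global time unit, the $j$-th local procedure having length $$T^{(j)}(\varepsilon^r)=\inf\Big\{m\in\mathbb N:\ m>\varepsilon^{-r\nu},\ \sqrt{Z_2^{(j)}(m)/m^2}<\varepsilon^r\Big\}.$$ Let $B_n(\varepsilon)=\max\{b\in\{0,1,2,\dots\}:\sum_{j=1}^bT^{(j)}(\varepsilon^r)\le n\}$ be the number of local procedures completed by global time $n$. At each global time $n$ with $B_n(\varepsilon)\ge1$, compute for $1\le j\le B_n(\varepsilon)$ $$\omega_{j,n}(\varepsilon)=\frac{Z_1^{(j)}(T^{(j)}(\varepsilon^r))-\frac{T^{(j)}(\varepsilon^r)}{n}Z_1(n)}{\sqrt{Z_2^{(j)}(T^{(j)}(\varepsilon^r))}},\qquad \widehat F_n(x;\varepsilon)=\frac1{B_n(\varepsilon)}\sum_{j=1}^{B_n(\varepsilon)}\mathbf 1\{\omega_{j,n}(\varepsilon)\le x\},$$ $c_{l,n}(\varepsilon)=\inf\{x:\widehat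 F_n(x;\varepsilon)\ge\delta/2\}$, $c_{u,n}(\varepsilon)=\inf\{x:\widehat F_n(x;\varepsilon)\ge1-\delta/2\}$, and $c_n(\varepsilon)=\max\{\underline c,\,c_{u,n}(\varepsilon)-c_{l,n}(\varepsilon)\}$. The procedure terminates at $$T(\varepsilon)=\inf\Big\{n\in\mathbb N:\ n>\varepsilon^{-\nu},\ B_n(\varepsilon)\ge1,\ \sqrt{Z_2(n)/n^2}<\varepsilon/c_n(\varepsilon)\Big\}.$$ On the event of nontermination, the stopping time and terminal quantities are assigned fixed finite values. Topologies. Write $\mathbb D=D([0,\infty),\mathbb R)$ and $\mathbb D_+=D([0,\infty),\mathbb R_+)$ for càdlàg paths. For a càdlàg $x$ on $[0,T]$, its completed graph is $\Gamma_x=\{(t,z): t\in[0,T],\ z$ between $x(t-)$ and $x(t)$ inclusive$\}$, with $x(0-):=x(0)$. The $M_2$ topology on $D([0,T],\mathbb R)$ is induced by the Hausdorff distance between completed graphs. Convergence on $[0,\infty)$ means convergence of the restrictions to $[0,T]$ for every continuity point $T$ of the limit. $\mathrm{WM}_2$ denotes the product of the univariate $M_2$ topologies over the two coordinates. Functional limit condition with parameters $(\mu,h,\ell,Y_1,Y_2)$. $Z_1,Z_2$ are processes with sample paths in $\mathbb D$ and $\mathbb D_+$, $Z_1(0)=0$ a.s.; $\mu,h\in\mathbb R$; $\ell$ is an eventually positive function slowly varying at infinity; $Y_1\in\mathbb D$, $Y_2\in\mathbb D_+$ are processes such that, as $\varepsilon\to0^+$, $$\Big(\varepsilon^h\ell(\varepsilon^{-1})\big(Z_1(\tfrac{\cdot}{\varepsilon})-\tfrac{\cdot}{\varepsilon}\mu\big),\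 \varepsilon^h\ell(\varepsilon^{-1})\sqrt{Z_2(\tfrac{\cdot}{\varepsilon})}\Big)\Rightarrow\big(Y_1(\cdot),\sqrt{Y_2(\cdot)}\big)\quad\text{weakly in }\mathrm{WM}_2.$$ Let $\mathbb F^Y$ be the usual augmentation of the natural filtration of $(Y_1,Y_2)$. Moreover: (a) $0<h<1$; (b) as $t\to\infty$, $(Z_1(t)-\mu t)/t\to0$ and $Z_2(t)/t^2\to0$ a.s.; (c) for every $a>0$, $(Y_1(a\,\cdot),Y_2(a\,\cdot))\overset d=(a^hY_1(\cdot),a^{2h}Y_2(\cdot))$; (d) $Y_1$ is quasi-left-continuous with respect to $\mathbb F^Y$: for every finite $\mathbb F^Y$-predictable stopping time $\tau$, $\mathbb P(\Delta Y_1(\tau)=0)=1$; (e) almost surely $Y_2(t)>0$ for every $t>0$, and $Y_2$ has no negative jumps. Time scale. $A(x):=x^{1-h}\ell(x)$ and $a_\varepsilon:=A^{\leftarrow}(\varepsilon^{-1})$, where $A^{\leftarrow}$ is an asymptotic inverse of $A$ (so $A(A^\leftarrow(x))\sim x$ as $x\to\infty$). No-early-stopping condition for $Z_2$ with exponent $\nu$: for every $K>0$, $$\lim_{\eta\downarrow0}\limsup_{\varepsilon\downarrow0}\mathbb P\Big(\inf_{n\in\mathbb N:\ \varepsilon^{-\nu}\le n\le\eta a_\varepsilon}\frac{\sqrt{Z_2(n)}}{n}\le K\varepsilon\Big)=0.$$ *)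

theory Defs
  imports "HOL-Probability.Probability" "HOL-Library.Landau_Symbols"
begin

text \<open>A path is a function on the reals of which only the values at times \<open>t \<ge> 0\<close> matter;
  a process maps an outcome to its sample path.\<close>

type_synonym path = "real \<Rightarrow> real"
type_synonym 'a process = "'a \<Rightarrow> path"

definition cadlag :: "path \<Rightarrow> bool" where
  "cadlag x \<longleftrightarrow>
     (\<forall>t\<ge>0. (x \<longlongrightarrow> x t) (at_right t)) \<and>
     (\<forall>t>0. \<exists>l. (x \<longlongrightarrow> l) (at_left t))"

definition left_limit :: "path \<Rightarrow> real \<Rightarrow> real" where
  "left_limit x t = (if t \<le> 0 then x 0 else Lim (at_left t) x)"

definition completed_graph :: "real \<Rightarrow> path \<Rightarrow> (real \<times> real) set" where
  "completed_graph T x = {(t, z). 0 \<le> t \<and> t \<le> T \<and> z \<in> closed_segment (left_limit x t) (x t)}"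

text \<open>Only used for nonempty bounded sets, where the two suprema are genuine.\<close>

definition hausdorff_distance :: "'m::metric_space set \<Rightarrow> 'm set \<Rightarrow> real" where
  "hausdorff_distance A B = max (SUP a\<in>A. infdist a B) (SUP b\<in>B. infdist b A)"

definition M2_tendsto :: "(nat \<Rightarrow> path) \<Rightarrow> path \<Rightarrow> bool" where
  "M2_tendsto X x \<longleftrightarrow>
     (\<forall>T>0. isCont x T \<longrightarrow>
        (\<lambda>n. hausdorff_distance (completed_graph T (X n)) (completed_graph T x)) \<longlonglongrightarrow> 0)"

text \<open>Continuity for the product topology $\mathrm{WM}_2$ on pairs of cadlag paths. The topology
  is metrizable, so continuity is sequential continuity. In particular a continuous functional
  does not depend on the values of the paths at negative times.\<close>

definition WM2_continuous :: "(path \<times> path \<Rightarrow> real) \<Rightarrow> bool" where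
  "WM2_continuous f \<longleftrightarrow>
     (\<forall>X1 X2 x1 x2.
        (\<forall>n. cadlag (X1 n) \<and> cadlag (X2 n)) \<and> cadlag x1 \<and> cadlag x2 \<and>
        M2_tendsto X1 x1 \<and> M2_tendsto X2 x2 \<longrightarrow>
        (\<lambda>n. f (X1 n, X2 n)) \<longlonglongrightarrow> f (x1, x2))"

definition WM2_bounded :: "(path \<times> path \<Rightarrow> real) \<Rightarrow> bool" where
  "WM2_bounded f \<longleftrightarrow> (\<exists>C. \<forall>x1 x2. cadlag x1 \<and> cadlag x2 \<longrightarrow> \<bar>f (x1, x2)\<bar> \<le> C)"

definition WM2_weak_tendsto ::
    "'a measure \<Rightarrow> ('i \<Rightarrow> 'a \<Rightarrow> path \<times> path) \<Rightarrow> 'b measure \<Rightarrow> ('b \<Rightarrow> path \<times> path) \<Rightarrow> 'i filter \<Rightarrow> bool"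
  where
  "WM2_weak_tendsto M X N Y G \<longleftrightarrow>
     (\<forall>f. WM2_continuous f \<and> WM2_bounded f \<longrightarrow>
        ((\<lambda>i. \<integral>\<omega>. f (X i \<omega>) \<partial>M) \<longlongrightarrow> (\<integral>\<omega>. f (Y \<omega>) \<partial>N)) G)"

definition cadlag_process :: "'a measure \<Rightarrow> 'a process \<Rightarrow> bool" where
  "cadlag_process M X \<longleftrightarrow>
     (\<forall>t\<ge>0. (\<lambda>\<omega>. X \<omega> t) \<in> borel_measurable M) \<and> (\<forall>\<omega>\<in>space M. cadlag (X \<omega>))"

definition nonneg_process :: "'a measure \<Rightarrow> 'a process \<Rightarrow> bool" where
  "nonneg_process M X \<longleftrightarrow> (\<forall>\<omega>\<in>space M. \<forall>t\<ge>0. 0 \<le> X \<omega> t)"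

text \<open>A pair of processes as one random element of the product space over the times
  \<open>t \<ge> 0\<close>, whose sigma-algebra is generated by the coordinates.\<close>

definition path_space :: "(real \<Rightarrow> real \<times> real) measure" where
  "path_space = (\<Pi>\<^sub>M t\<in>{0..}. borel)"

definition joint_path :: "'a process \<Rightarrow> 'a process \<Rightarrow> 'a \<Rightarrow> (real \<Rightarrow> real \<times> real)" where
  "joint_path X1 X2 \<omega> = (\<lambda>t\<in>{0..}. (X1 \<omega> t, X2 \<omega> t))"

definition joint_law :: "'a measure \<Rightarrow> 'a process \<Rightarrow> 'a process \<Rightarrow> (real \<Rightarrow> real \<times> real) measure" where
  "joint_law M X1 X2 = distr M path_space (joint_path X1 X2)"

definition natural_generators :: "'b measure \<Rightarrow> 'b process \<Rightarrow> 'b process \<Rightarrow> real \<Rightarrow> 'b set set" where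
  "natural_generators N Y1 Y2 t =
     (\<Union>s\<in>{0..t}. {(\<lambda>\<omega>. Y1 \<omega> s) -` B \<inter> space N | B. B \<in> sets borel} \<union>
                  {(\<lambda>\<omega>. Y2 \<omega> s) -` B \<inter> space N | B. B \<in> sets borel})"

text \<open>The library's \<open>stopping_time\<close> quantifies over all real times; at negative times the filtration
  below is the trivial sigma-algebra with the null sets adjoined, so this is harmless for
  nonnegative times.\<close>

definition usual_augmentation :: "'b measure \<Rightarrow> 'b process \<Rightarrow> 'b process \<Rightarrow> real \<Rightarrow> 'b measure" where
  "usual_augmentation N Y1 Y2 t =
     sigma (space N)
       (\<Inter>s\<in>{t<..}. sigma_sets (space N)
          (natural_generators N Y1 Y2 s \<union> null_sets (completion N)))"

definition finite_predictable_time ::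
    "'b measure \<Rightarrow> (real \<Rightarrow> 'b measure) \<Rightarrow> ('b \<Rightarrow> real) \<Rightarrow> bool" where
  "finite_predictable_time N \<F> \<tau> \<longleftrightarrow>
     stopping_time \<F> \<tau> \<and> (\<forall>\<omega>\<in>space N. 0 \<le> \<tau> \<omega>) \<and>
     (\<exists>\<sigma> :: nat \<Rightarrow> 'b \<Rightarrow> real.
        (\<forall>k. stopping_time \<F> (\<sigma> k) \<and> (\<forall>\<omega>\<in>space N. 0 \<le> \<sigma> k \<omega>)) \<and>
        (AE \<omega> in N. incseq (\<lambda>k. \<sigma> k \<omega>) \<and> (\<lambda>k. \<sigma> k \<omega>) \<longlonglongrightarrow> \<tau> \<omega> \<and>
           (0 < \<tau> \<omega> \<longrightarrow> (\<forall>k. \<sigma> k \<omega> < \<tau> \<omega>))))"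

definition quasi_left_continuous ::
    "'b measure \<Rightarrow> (real \<Rightarrow> 'b measure) \<Rightarrow> 'b process \<Rightarrow> bool" where
  "quasi_left_continuous N \<F> Y \<longleftrightarrow>
     (\<forall>\<tau>. finite_predictable_time N \<F> \<tau> \<longrightarrow>
        (AE \<omega> in N. Y \<omega> (\<tau> \<omega>) - left_limit (Y \<omega>) (\<tau> \<omega>) = 0))"

definition slowly_varying :: "(real \<Rightarrow> real) \<Rightarrow> bool" where
  "slowly_varying l \<longleftrightarrow>
     (\<exists>x0. l \<in> borel_measurable (restrict_space borel {x0..})) \<and>
     (\<forall>\<^sub>F x in at_top. 0 < l x) \<and>
     (\<forall>a>0. ((\<lambda>x. l (a * x) / l x) \<longlongrightarrow> 1) at_top)"

definition functional_limit_condition ::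
    "'a measure \<Rightarrow> 'a process \<Rightarrow> 'a process \<Rightarrow> real \<Rightarrow> real \<Rightarrow> (real \<Rightarrow> real) \<Rightarrow>
     'b measure \<Rightarrow> 'b process \<Rightarrow> 'b process \<Rightarrow> bool" where
  "functional_limit_condition M Z1 Z2 \<mu> h l N Y1 Y2 \<longleftrightarrow>
     cadlag_process M Z1 \<and> cadlag_process M Z2 \<and> nonneg_process M Z2 \<and>
     (AE \<omega> in M. Z1 \<omega> 0 = 0) \<and>
     slowly_varying l \<and>
     cadlag_process N Y1 \<and> cadlag_process N Y2 \<and> nonneg_process N Y2 \<and>
     WM2_weak_tendsto
       M (\<lambda>\<epsilon> \<omega>. (\<lambda>t. \<epsilon> powr h * l (1 / \<epsilon>) * (Z1 \<omega> (t / \<epsilon>) - t / \<epsilon> * \<mu>),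
                  \<lambda>t. \<epsilon> powr h * l (1 / \<epsilon>) * sqrt (Z2 \<omega> (t / \<epsilon>))))
       N (\<lambda>\<omega>. (Y1 \<omega>, \<lambda>t. sqrt (Y2 \<omega> t)))
       (at_right 0) \<and>
     0 < h \<and> h < 1 \<and>
     (AE \<omega> in M. ((\<lambda>t. (Z1 \<omega> t - \<mu> * t) / t) \<longlongrightarrow> 0) at_top \<and>
                  ((\<lambda>t. Z2 \<omega> t / t\<^sup>2) \<longlongrightarrow> 0) at_top) \<and>
     (\<forall>a>0. joint_law N (\<lambda>\<omega> t. Y1 \<omega> (a * t)) (\<lambda>\<omega> t. Y2 \<omega> (a * t)) =
             joint_law N (\<lambda>\<omega> t. a powr h * Y1 \<omega> t) (\<lambda>\<omega> t. a powr (2 * h) * Y2 \<omega> t)) \<and>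
     quasi_left_continuous N (usual_augmentation N Y1 Y2) Y1 \<and>
     (AE \<omega> in N. \<forall>t>0. 0 < Y2 \<omega> t \<and> left_limit (Y2 \<omega>) t \<le> Y2 \<omega> t)"

definition asymptotic_inverse :: "(real \<Rightarrow> real) \<Rightarrow> (real \<Rightarrow> real) \<Rightarrow> bool" where
  "asymptotic_inverse A g \<longleftrightarrow>
     filterlim g at_top at_top \<and>
     (\<lambda>x. A (g x)) \<sim>[at_top] (\<lambda>x. x) \<and> (\<lambda>x. g (A x)) \<sim>[at_top] (\<lambda>x. x)"

text \<open>The infimum is taken in the extended reals, so that it is infinite over the empty set.\<close>

definition no_early_stopping ::
    "'a measure \<Rightarrow> 'a process \<Rightarrow> real \<Rightarrow> (real \<Rightarrow> real) \<Rightarrow> bool" where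
  "no_early_stopping M Z2 \<nu> a \<longleftrightarrow>
     (\<forall>K>0. ((\<lambda>\<eta>. Limsup (at_right 0) (\<lambda>\<epsilon>. ereal (measure M {\<omega> \<in> space M.
         (INF n\<in>{n::nat. \<epsilon> powr (- \<nu>) \<le> real n \<and> real n \<le> \<eta> * a \<epsilon>}.
            ereal (sqrt (Z2 \<omega> (real n)) / real n)) \<le> ereal (K * \<epsilon>)})))
       \<longlongrightarrow> 0) (at_right 0))"

definition quantile :: "(real \<Rightarrow> real) \<Rightarrow> real \<Rightarrow> real" where
  "quantile F p = Inf {x. p \<le> F x}"

definition first_passage :: "path \<Rightarrow> real \<Rightarrow> ereal" where
  "first_passage y u = (INF s\<in>{s. 0 < s \<and> sqrt (y s) / s < u}. ereal s)"

text \<open>The value on the event where the first passage time is infinite (a null event under the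
  functional limit condition) is immaterial.\<close>

definition limit_statistic :: "'b process \<Rightarrow> 'b process \<Rightarrow> 'b \<Rightarrow> real" where
  "limit_statistic Y1 Y2 \<omega> =
     (let s = real_of_ereal (first_passage (Y2 \<omega>) 1) in Y1 \<omega> s / sqrt (Y2 \<omega> s))"

text \<open>The procedure is a function of one realization: the global paths \<open>z1\<close>, \<open>z2\<close> and the local
  paths \<open>w1 j\<close>, \<open>w2 j\<close>, where only \<open>j \<ge> 1\<close> is used. Times live in \<open>enat\<close>, where
  the infimum of the empty set is \<open>\<infinity>\<close>. Division by zero gives zero, which is the convention for
  self-normalized statistics with zero denominator.\<close>

definition local_length :: "real \<Rightarrow> path \<Rightarrow> real \<Rightarrow> enat" where
  "local_length \<nu> z2 e =
     (INF m\<in>{m::nat. e powr (- \<nu>) < real m \<and> sqrt (z2 (real m) / (real m)\<^sup>2) < e}. enat m)"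

text \<open>A local procedure takes at least one time unit, so the maximum is over a finite set.\<close>

definition completed :: "real \<Rightarrow> real \<Rightarrow> (nat \<Rightarrow> path) \<Rightarrow> real \<Rightarrow> nat \<Rightarrow> nat" where
  "completed \<nu> r w2 \<epsilon> n =
     Max {b. (\<Sum>j=1..b. local_length \<nu> (w2 j) (\<epsilon> powr r)) \<le> enat n}"

definition local_statistic ::
    "real \<Rightarrow> real \<Rightarrow> path \<Rightarrow> (nat \<Rightarrow> path) \<Rightarrow> (nat \<Rightarrow> path) \<Rightarrow> real \<Rightarrow> nat \<Rightarrow> nat \<Rightarrow> real" where
  "local_statistic \<nu> r z1 w1 w2 \<epsilon> n j =
     (let t = real (the_enat (local_length \<nu> (w2 j) (\<epsilon> powr r)))
      in (w1 j t - t / real n * z1 (real n)) / sqrt (w2 j t))"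

definition empirical_cdf ::
    "real \<Rightarrow> real \<Rightarrow> path \<Rightarrow> (nat \<Rightarrow> path) \<Rightarrow> (nat \<Rightarrow> path) \<Rightarrow> real \<Rightarrow> nat \<Rightarrow> real \<Rightarrow> real" where
  "empirical_cdf \<nu> r z1 w1 w2 \<epsilon> n x =
     (\<Sum>j=1..completed \<nu> r w2 \<epsilon> n. of_bool (local_statistic \<nu> r z1 w1 w2 \<epsilon> n j \<le> x))
       / real (completed \<nu> r w2 \<epsilon> n)"

definition lower_quantile ::
    "real \<Rightarrow> real \<Rightarrow> real \<Rightarrow> path \<Rightarrow> (nat \<Rightarrow> path) \<Rightarrow> (nat \<Rightarrow> path) \<Rightarrow> real \<Rightarrow> nat \<Rightarrow> real" where
  "lower_quantile \<delta> \<nu> r z1 w1 w2 \<epsilon> n = quantile (empirical_cdf \<nu> r z1 w1 w2 \<epsilon> n) (\<delta> / 2)"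

definition upper_quantile ::
    "real \<Rightarrow> real \<Rightarrow> real \<Rightarrow> path \<Rightarrow> (nat \<Rightarrow> path) \<Rightarrow> (nat \<Rightarrow> path) \<Rightarrow> real \<Rightarrow> nat \<Rightarrow> real" where
  "upper_quantile \<delta> \<nu> r z1 w1 w2 \<epsilon> n = quantile (empirical_cdf \<nu> r z1 w1 w2 \<epsilon> n) (1 - \<delta> / 2)"

definition quantile_width ::
    "real \<Rightarrow> real \<Rightarrow> real \<Rightarrow> real \<Rightarrow> path \<Rightarrow> (nat \<Rightarrow> path) \<Rightarrow> (nat \<Rightarrow> path) \<Rightarrow> real \<Rightarrow> nat \<Rightarrow> real" where
  "quantile_width \<delta> c_min \<nu> r z1 w1 w2 \<epsilon> n =
     max c_min (upper_quantile \<delta> \<nu> r z1 w1 w2 \<epsilon> n - lower_quantile \<delta> \<nu> r z1 w1 w2 \<epsilon> n)"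

definition stop_time ::
    "real \<Rightarrow> real \<Rightarrow> real \<Rightarrow> real \<Rightarrow> path \<Rightarrow> path \<Rightarrow> (nat \<Rightarrow> path) \<Rightarrow> (nat \<Rightarrow> path) \<Rightarrow> real \<Rightarrow> enat" where
  "stop_time \<delta> c_min \<nu> r z1 z2 w1 w2 \<epsilon> =
     (INF n\<in>{n::nat. \<epsilon> powr (- \<nu>) < real n \<and> 1 \<le> completed \<nu> r w2 \<epsilon> n \<and>
                sqrt (z2 (real n) / (real n)\<^sup>2) < \<epsilon> / quantile_width \<delta> c_min \<nu> r z1 w1 w2 \<epsilon> n}.
        enat n)"

text \<open>The terminal values of the time, of the two global paths and of the two quantiles;
  \<open>d\<close> lists the values assigned to them if the procedure does not terminate.\<close>

definition terminal_values ::
    "real \<Rightarrow> real \<Rightarrow> real \<Rightarrow> real \<Rightarrow> nat \<times> real \<times> real \<times> real \<times> real \<Rightarrow>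
     path \<Rightarrow> path \<Rightarrow> (nat \<Rightarrow> path) \<Rightarrow> (nat \<Rightarrow> path) \<Rightarrow> real \<Rightarrow> nat \<times> real \<times> real \<times> real \<times> real" where
  "terminal_values \<delta> c_min \<nu> r d z1 z2 w1 w2 \<epsilon> =
     (case stop_time \<delta> c_min \<nu> r z1 z2 w1 w2 \<epsilon> of
        enat n \<Rightarrow> (n, z1 (real n), z2 (real n),
                    lower_quantile \<delta> \<nu> r z1 w1 w2 \<epsilon> n, upper_quantile \<delta> \<nu> r z1 w1 w2 \<epsilon> n)
      | \<infinity> \<Rightarrow> d)"

definition terminal_quantiles ::
    "nat \<times> real \<times> real \<times> real \<times> real \<Rightarrow> real \<times> real" where
  "terminal_quantiles = (\<lambda>(T, x1, x2, cl, cu). (cl, cu))"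

definition confidence_interval ::
    "nat \<times> real \<times> real \<times> real \<times> real \<Rightarrow> real set" where
  "confidence_interval = (\<lambda>(T, x1, x2, cl, cu).
     {x1 / real T - cu * sqrt (x2 / (real T)\<^sup>2) .. x1 / real T - cl * sqrt (x2 / (real T)\<^sup>2)})"

definition tendsto_in_probability ::
    "'a measure \<Rightarrow> ('i \<Rightarrow> 'a \<Rightarrow> 'm::metric_space) \<Rightarrow> 'm \<Rightarrow> 'i filter \<Rightarrow> bool" where
  "tendsto_in_probability M X x G \<longleftrightarrow>
     (\<forall>\<xi>>0. ((\<lambda>i. measure M {\<omega> \<in> space M. \<xi> < dist (X i \<omega>) x}) \<longlongrightarrow> 0) G)"

text \<open>Mutual independence of the whole family consisting of the global stream (index 0) and
  the local streams (indices \<open>j \<ge> 1\<close>), with a common law.\<close>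

definition independent_copies ::
    "'a measure \<Rightarrow> 'a process \<Rightarrow> 'a process \<Rightarrow> (nat \<Rightarrow> 'a process) \<Rightarrow> (nat \<Rightarrow> 'a process) \<Rightarrow> bool" where
  "independent_copies M Z1 Z2 L1 L2 \<longleftrightarrow>
     prob_space.indep_vars M (\<lambda>_. path_space)
       (\<lambda>j. if j = 0 then joint_path Z1 Z2 else joint_path (L1 j) (L2 j)) (UNIV :: nat set) \<and>
     (\<forall>j\<ge>1. joint_law M (L1 j) (L2 j) = joint_law M Z1 Z2)"

end

theory Submission
  imports Defs "HOL-Real_Asymp.Real_Asymp"
begin

text \<open>
  Weak convergence in \<open>WM\<^sub>2\<close> is only used through functionals of the form ``infimum of
  \<open>max (a z + b t + c) (\<bar>t - q\<bar> - w)\<close> over the completed graph'', which are Lipschitz for the Hausdorff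
  distance of the graphs. A finite Boolean combination of conditions that such functionals are
  \<open>\<le> 0\<close> satisfies the portmanteau inequality. The event that a statistic, evaluated at the first
  crossing of a moving boundary, exceeds a level is covered by such a combination with mesh \<open>1/m\<close>;
  along the limit process these combinations shrink, as \<open>m\<close> grows, to the corresponding event at
  \<open>\<Phi>\<^sub>1(1)\<close>. Since \<open>Y\<^sub>2\<close> has no negative jumps, \<open>\<Phi>\<^sub>1(1)\<close> is announced by \<open>\<Phi>\<^sub>1(1 + 1/k)\<close> and hence
  predictable, so \<open>Y\<^sub>1\<close> does not jump there.

  Applied at accuracy \<open>\<epsilon>\<^sup>r\<close> this gives the limit law of the local statistics centred at \<open>\<mu>\<close>. Up to time
  \<open>K a\<^sub>\<epsilon>\<close> the error of the global average is of order \<open>\<epsilon>\<close>, so recentring at it moves a local statistic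
  by \<open>O(\<epsilon>\<^bsup>1-r\<^esup>)\<close>. Hoeffding's inequality, summed over the number of completed procedures, then makes the
  empirical quantiles close to \<open>c\<^sub>l\<close> and \<open>c\<^sub>u\<close> simultaneously at all times in \<open>[\<kappa> a\<^sub>\<epsilon>, K a\<^sub>\<epsilon>]\<close>. The global
  procedure therefore stops like a crossing of the nearly constant boundary \<open>\<epsilon> / (c\<^sub>u - c\<^sub>l)\<close>, and the
  first part applies again, after a rescaling of time that turns this boundary into level 1.
\<close>

section \<open>Cadlag paths and functionals of the completed graph\<close>

text \<open>The product topology controls the two coordinates only separately, and M2 convergence
  only through graphs, so there is no common time at which the limit of the ratio could be read off.
  Numerator and denominator are therefore each compared with the time: at the crossing of level 1
  the limiting denominator equals the time, and a condition on the ratio becomes one on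
  \<open>x1\<close> alone in the same cell. Only upper bounds for closed conditions are available;
  the signs \<open>\<sigma> = 1\<close> and \<open>\<sigma> = -1\<close> supply the two tails. The
  mesh \<open>1/m\<close> is fixed while \<epsilon> tends to 0, and refined only afterwards. The
  global stopping time depends on the local streams and on the global average, so time and
  statistics cannot be decoupled by independence. The estimates for quantiles and average hold for
  all \<open>n\<close> of a window at once, and the random time is inserted afterwards. Weak
  convergence says nothing near time 0; that part is removed by the no-early-stopping condition, and
  the constants 3 and 5 of the discretization leave the margin for it.\<close>

lemma cadlag_tendsto_left_limit:
  assumes "cadlag x" "0 < t"
  shows "(x \<longlongrightarrow> left_limit x t) (at_left t)"
  using assms by (auto simp: cadlag_def left_limit_def tendsto_Lim)

lemma cadlag_tendsto_right:
  assumes "cadlag x" "0 \<le> t"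
  shows "(x \<longlongrightarrow> x t) (at_right t)"
  using assms by (auto simp: cadlag_def)

lemma eventually_at_left_Ioo:
  fixes t :: real
  assumes "eventually P (at_left t)"
  shows "\<exists>d>0. \<forall>s. t - d < s \<longrightarrow> s < t \<longrightarrow> P s"
proof -
  obtain b where "b < t" "\<And>s. s > b \<Longrightarrow> s < t \<Longrightarrow> P s"
    using assms by (auto simp: eventually_at_left_field)
  then show ?thesis by (intro exI[of _ "t - b"]) auto
qed

lemma eventually_at_right_Ioo:
  fixes t :: real
  assumes "eventually P (at_right t)"
  shows "\<exists>d>0. \<forall>s. t < s \<longrightarrow> s < t + d \<longrightarrow> P s"
proof -
  obtain b where "b > t" "\<And>s. s > t \<Longrightarrow> s < b \<Longrightarrow> P s"
    using assms by (auto simp: eventually_at_right_field)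
  then show ?thesis by (intro exI[of _ "b - t"]) auto
qed

lemma cadlag_locally_bounded:
  assumes x: "cadlag x" and "0 \<le> t"
  obtains d B where "d > 0" "\<And>s. 0 \<le> s \<Longrightarrow> \<bar>s - t\<bar> < d \<Longrightarrow> \<bar>x s\<bar> \<le> B"
proof -
  have "eventually (\<lambda>s. dist (x s) (x t) < 1) (at_right t)"
    by (rule tendstoD[OF cadlag_tendsto_right[OF assms]]) simp
  then obtain d1 where d1: "d1 > 0" "\<And>s. t < s \<Longrightarrow> s < t + d1 \<Longrightarrow> dist (x s) (x t) < 1"
    using eventually_at_right_Ioo by blast
  obtain d2 l where d2: "d2 > 0" "\<And>s. 0 \<le> s \<Longrightarrow> t - d2 < s \<Longrightarrow> s < t \<Longrightarrow> dist (x s) l < 1"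
  proof (cases "t = 0")
    case True
    then show ?thesis using that[of 1 0] by auto
  next
    case False
    then have "eventually (\<lambda>s. dist (x s) (left_limit x t) < 1) (at_left t)"
      using assms by (intro tendstoD[OF cadlag_tendsto_left_limit]) auto
    then show ?thesis using that eventually_at_left_Ioo by blast
  qed
  define B where "B = max (\<bar>x t\<bar>) \<bar>l\<bar> + 1"
  show ?thesis
  proof (rule that[of "min d1 d2" B])
    fix s assume s: "0 \<le> s" "\<bar>s - t\<bar> < min d1 d2"
    consider "s = t" | "t < s" | "s < t" by linarith
    then show "\<bar>x s\<bar> \<le> B"
    proof cases
      case 2
      then show ?thesis using d1(2)[of s] s unfolding B_def dist_real_def by auto
    next
      case 3
      then show ?thesis using d2(2)[of s] s unfolding B_def dist_real_def by auto
    qed (simp add: B_def)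
  qed (use d1 d2 in auto)
qed

lemma cadlag_bounded:
  assumes x: "cadlag x"
  obtains B where "B \<ge> 0" "\<And>t. 0 \<le> t \<Longrightarrow> t \<le> T \<Longrightarrow> \<bar>x t\<bar> \<le> B"
proof (cases "0 \<le> T")
  case True
  \<comment> \<open>Local boundedness is patched by bisection: \<open>P\<close> survives
    concatenation of intervals and holds on all short intervals around a point.\<close>
  define P where "P a b \<longleftrightarrow> (\<exists>B. \<forall>s\<in>{a..b} \<inter> {0..}. \<bar>x s\<bar> \<le> B)" for a b
  have "P 0 T"
    using True
  proof (rule Bolzano)
    fix a b c assume "P a b" "P b c"
    then obtain B1 B2 where "\<forall>s\<in>{a..b} \<inter> {0..}. \<bar>x s\<bar> \<le> B1" "\<forall>s\<in>{b..c} \<inter> {0..}. \<bar>x s\<bar> \<le> B2"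
      unfolding P_def by blast
    then show "P a c"
      unfolding P_def by (intro exI[of _ "max B1 B2"]) (auto simp: le_max_iff_disj)
  next
    fix t :: real assume "0 \<le> t"
    then obtain d B where "d > 0" "\<And>s. 0 \<le> s \<Longrightarrow> \<bar>s - t\<bar> < d \<Longrightarrow> \<bar>x s\<bar> \<le> B"
      using cadlag_locally_bounded[OF x] by blast
    then show "\<exists>d>0. \<forall>a b. a \<le> t \<and> t \<le> b \<and> b - a < d \<longrightarrow> P a b"
      unfolding P_def by (intro exI[of _ d] conjI allI impI exI[of _ B]) auto
  qed
  then obtain B where "\<forall>s\<in>{0..T}. \<bar>x s\<bar> \<le> B" by (auto simp: P_def)
  then show ?thesis by (intro that[of "max 0 B"]) (auto simp: le_max_iff_disj)
next
  case False
  then show ?thesis by (intro that[of 0]) auto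
qed

lemma left_limit_bounded:
  assumes x: "cadlag x" and B: "\<And>t. 0 \<le> t \<Longrightarrow> t \<le> T \<Longrightarrow> \<bar>x t\<bar> \<le> B" and t: "0 \<le> t" "t \<le> T"
  shows "\<bar>left_limit x t\<bar> \<le> B"
proof (cases "t = 0")
  case True
  then show ?thesis using B[of 0] t by (simp add: left_limit_def)
next
  case False
  then have "0 < t" using t by simp
  show ?thesis
  proof (rule tendsto_upperbound)
    show "((\<lambda>s. \<bar>x s\<bar>) \<longlongrightarrow> \<bar>left_limit x t\<bar>) (at_left t)"
      by (intro tendsto_rabs cadlag_tendsto_left_limit x \<open>0 < t\<close>)
    show "\<forall>\<^sub>F s in at_left t. \<bar>x s\<bar> \<le> B"
      using eventually_at_left_real[OF \<open>0 < t\<close>] by eventually_elim (use t in \<open>auto intro!: B\<close>)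
  qed simp
qed

lemma completed_graph_bounded:
  assumes x: "cadlag x"
  shows "bounded (completed_graph T x)"
proof -
  obtain B where B: "B \<ge> 0" "\<And>t. 0 \<le> t \<Longrightarrow> t \<le> T \<Longrightarrow> \<bar>x t\<bar> \<le> B"
    using cadlag_bounded[OF x] by blast
  have "completed_graph T x \<subseteq> {0..T} \<times> {-B..B}"
  proof (clarsimp simp: completed_graph_def)
    fix t z assume t: "0 \<le> t" "t \<le> T" and z: "z \<in> closed_segment (left_limit x t) (x t)"
    have "left_limit x t \<in> {-B..B}" "x t \<in> {-B..B}"
      using left_limit_bounded[OF x B(2) t] B(2)[OF t] by auto
    then have "closed_segment (left_limit x t) (x t) \<subseteq> {-B..B}"
      by (intro closed_segment_subset) auto
    then show "- B \<le> z \<and> z \<le> B" using z by auto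
  qed
  then show ?thesis
    by (rule bounded_subset[rotated]) (auto intro!: bounded_Times)
qed

lemma completed_graph_point:
  "0 \<le> t \<Longrightarrow> t \<le> T \<Longrightarrow> (t, x t) \<in> completed_graph T x"
  by (auto simp: completed_graph_def)

text \<open>One-sided limits at \<open>t\<close> keep the oscillation below \<open>e\<close> on both
  punctured sides of \<open>t\<close>, so bad points cannot accumulate at \<open>t\<close>; a set of
  reals without limit points is countable. The bound \<open>T \<le> s\<close> with
  \<open>T > 0\<close> keeps limit points at positive times, where left limits exist.\<close>

lemma countable_oscillation:
  assumes x: "cadlag x" and "0 < T" "0 < e"
  shows "countable {s. T \<le> s \<and> \<not> (\<exists>d>0. \<forall>u v. \<bar>u - s\<bar> < d \<longrightarrow> \<bar>v - s\<bar> < d \<longrightarrow> \<bar>x u - x v\<bar> < e)}"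
    (is "countable ?D")
proof (rule no_limpt_imp_countable)
  fix t
  show "\<not> t islimpt ?D"
  proof
    assume lim: "t islimpt ?D"
    have "t \<ge> T"
    proof (rule ccontr)
      assume "\<not> t \<ge> T"
      then have "\<exists>s\<in>?D. s \<noteq> t \<and> dist s t < T - t"
        using lim unfolding islimpt_approachable by auto
      then show False by (auto simp: dist_real_def)
    qed
    then have t: "0 < t" using \<open>0 < T\<close> by simp
    have "eventually (\<lambda>s. dist (x s) (x t) < e / 2) (at_right t)"
      by (rule tendstoD[OF cadlag_tendsto_right[OF x]]) (use t \<open>0 < e\<close> in auto)
    then obtain d1 where d1: "d1 > 0" "\<And>s. t < s \<Longrightarrow> s < t + d1 \<Longrightarrow> dist (x s) (x t) < e / 2"
      using eventually_at_right_Ioo by blast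
    have "eventually (\<lambda>s. dist (x s) (left_limit x t) < e / 2) (at_left t)"
      by (rule tendstoD[OF cadlag_tendsto_left_limit[OF x]]) (use t \<open>0 < e\<close> in auto)
    then obtain d2 where d2: "d2 > 0" "\<And>s. t - d2 < s \<Longrightarrow> s < t \<Longrightarrow> dist (x s) (left_limit x t) < e / 2"
      using eventually_at_left_Ioo by blast
    obtain s where s: "s \<in> ?D" "s \<noteq> t" "dist s t < min d1 d2"
      using lim d1(1) d2(1) unfolding islimpt_approachable by (metis (lifting) min_less_iff_conj)
    \<comment> \<open>This radius keeps a neighbourhood of \<open>s\<close> on one side of
      \<open>t\<close> and inside the range where the one-sided limit applies.\<close>
    define d where "d = min \<bar>s - t\<bar> (min d1 d2 - \<bar>s - t\<bar>)"
    have "d > 0" using s by (auto simp: d_def dist_real_def)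
    moreover have "\<bar>x u - x v\<bar> < e" if uv: "\<bar>u - s\<bar> < d" "\<bar>v - s\<bar> < d" for u v
    proof (cases "s < t")
      case True
      then have "dist (x u) (left_limit x t) < e / 2" "dist (x v) (left_limit x t) < e / 2"
        using uv True by (auto intro!: d2(2) simp del: less_divide_eq_numeral1 simp: d_def)
      then show ?thesis by (metis dist_commute dist_real_def dist_triangle_half_l)
    next
      case False
      then have "dist (x u) (x t) < e / 2" "dist (x v) (x t) < e / 2"
        using uv s False by (auto intro!: d1(2) simp del: less_divide_eq_numeral1 simp: d_def)
      then show ?thesis by (metis dist_commute dist_real_def dist_triangle_half_l)
    qed
    ultimately show False using s(1) by blast
  qed
qed

text \<open>\<open>M2_tendsto\<close> speaks only about horizons at which the limit is continuous;
  this provides such horizons arbitrarily late. The discontinuities after a positive time form a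
  countable union over the size of the oscillation, while an interval is uncountable.\<close>

lemma cadlag_continuity_point:
  assumes x: "cadlag x"
  obtains t where "t > T" "t > 0" "isCont x t"
proof -
  define S where "S = max T 0 + 1"
  define D where "D n = {s. S \<le> s \<and> \<not> (\<exists>d>0. \<forall>u v. \<bar>u - s\<bar> < d \<longrightarrow> \<bar>v - s\<bar> < d \<longrightarrow> \<bar>x u - x v\<bar> < 1 / real (Suc n))}" for n
  have "countable (\<Union>n. D n)"
    unfolding D_def by (intro countable_UN countable_oscillation x) (auto simp: S_def)
  moreover have "uncountable {S..S+1}" by (simp add: uncountable_closed_interval)
  ultimately have "\<not> {S..S+1} \<subseteq> (\<Union>n. D n)" using countable_subset by blast
  then obtain t where t: "t \<ge> S" "\<And>n. t \<notin> D n" by (auto simp: subset_iff)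
  have "isCont x t"
    unfolding continuous_at_eps_delta
  proof safe
    fix e :: real assume "e > 0"
    then obtain n where n: "1 / real (Suc n) < e" using nat_approx_posE by blast
    obtain d where "d > 0" "\<And>u v. \<bar>u - t\<bar> < d \<Longrightarrow> \<bar>v - t\<bar> < d \<Longrightarrow> \<bar>x u - x v\<bar> < 1 / real (Suc n)"
      using t(2)[of n] t(1) unfolding D_def by auto
    then show "\<exists>d>0. \<forall>x'. dist x' t < d \<longrightarrow> dist (x x') (x t) < e"
      using n unfolding dist_real_def by (metis abs_zero diff_self order.strict_trans)
  qed
  then show ?thesis using t by (intro that[of t]) (auto simp: S_def)
qed

text \<open>A point of one set has a point of the other within nearly the Hausdorff distance, and
  the Lipschitz bound compares the two values. Boundedness of both sets makes the suprema in
  \<open>hausdorff_distance\<close> genuine.\<close>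

lemma INF_Lipschitz_hausdorff:
  fixes A B :: "'m::metric_space set" and \<phi> :: "'m \<Rightarrow> real"
  assumes bdd: "bounded A" "bounded B" and ne: "A \<noteq> {}" "B \<noteq> {}"
    and L: "L \<ge> 0" "\<And>p q. \<bar>\<phi> p - \<phi> q\<bar> \<le> L * dist p q"
    and bb: "\<And>p. m \<le> \<phi> p"
  shows "\<bar>(INF p\<in>A. \<phi> p) - (INF p\<in>B. \<phi> p)\<bar> \<le> L * hausdorff_distance A B"
proof -
  have bd: "bdd_below (\<phi> ` S)" for S using bb by (auto intro!: bdd_belowI[of _ m])
  have key: "(INF p\<in>B. \<phi> p) \<le> (INF p\<in>A. \<phi> p) + L * H"
    if ne: "A \<noteq> {}" "B \<noteq> {}" and H: "\<And>a. a \<in> A \<Longrightarrow> infdist a B \<le> H" for A B :: "'m set" and H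
  proof -
    have "(INF p\<in>B. \<phi> p) - L * H \<le> \<phi> a" if a: "a \<in> A" for a
    proof (rule field_le_epsilon)
      fix e :: real assume "e > 0"
      \<comment> \<open>Dividing by \<open>L + 1\<close> instead of \<open>L\<close> covers
        \<open>L = 0\<close>.\<close>
      define e' where "e' = e / (L + 1)"
      have e': "e' > 0" "L * e' \<le> e" using L \<open>e > 0\<close> by (auto simp: e'_def field_simps)
      have "(INF b\<in>B. dist a b) < H + e'"
        using H[OF a] e'(1) ne by (simp add: infdist_def)
      then obtain b where b: "b \<in> B" "dist a b < H + e'"
        using ne by (auto simp: cINF_less_iff bdd_below_image_dist)
      have "(INF p\<in>B. \<phi> p) \<le> \<phi> b" by (intro cINF_lower bd b)
      also have "\<dots> \<le> \<phi> a + L * dist a b" using L(2)[of b a] by (simp add: dist_commute)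
      also have "\<dots> \<le> \<phi> a + L * (H + e')" using b L by (intro add_left_mono mult_left_mono) auto
      finally show "(INF p\<in>B. \<phi> p) - L * H \<le> \<phi> a + e" using e' by (simp add: algebra_simps)
    qed
    then have "(INF p\<in>B. \<phi> p) - L * H \<le> (INF p\<in>A. \<phi> p)"
      by (intro cINF_greatest ne)
    then show ?thesis by simp
  qed
  have bdi: "bdd_above ((\<lambda>a. infdist a T) ` S)" if "bounded S" "bounded T" "T \<noteq> {}" for S T :: "'m set"
  proof -
    note ne = \<open>T \<noteq> {}\<close>
    then obtain t where t: "t \<in> T" by blast
    obtain r where "\<And>s. s \<in> S \<Longrightarrow> dist t s \<le> r" using \<open>bounded S\<close> by (metis bounded_any_center)
    then have "infdist s T \<le> r" if "s \<in> S" for s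
      using infdist_le[OF t, of s] that by (metis dist_commute order_trans)
    then show ?thesis by (intro bdd_aboveI2[of _ _ r]) auto
  qed
  have "infdist a B \<le> hausdorff_distance A B" if "a \<in> A" for a
    using cSUP_upper[OF that bdi[OF bdd ne(2)]] by (simp add: hausdorff_distance_def le_max_iff_disj)
  moreover have "infdist b A \<le> hausdorff_distance A B" if "b \<in> B" for b
    using cSUP_upper[OF that bdi[OF bdd(2,1) ne(1)]] by (simp add: hausdorff_distance_def le_max_iff_disj)
  ultimately have "(INF p\<in>B. \<phi> p) \<le> (INF p\<in>A. \<phi> p) + L * hausdorff_distance A B"
      "(INF p\<in>A. \<phi> p) \<le> (INF p\<in>B. \<phi> p) + L * hausdorff_distance A B"
    using ne by (auto intro!: key)
  then show ?thesis by linarith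
qed

text \<open>The value is at most 0 iff the graph of \<open>x\<close> comes arbitrarily close to the half plane
  \<open>a z + b t + c \<le> 0\<close> over the window \<open>\<bar>t - q\<bar> \<le> w\<close>; the cutoff by 1 makes it independent of late times.\<close>

definition window_inf :: "real \<Rightarrow> real \<Rightarrow> real \<Rightarrow> real \<Rightarrow> real \<Rightarrow> path \<Rightarrow> real" where
  "window_inf a b c q w x = (INF t\<in>{0..}. min 1 (max (a * x t + b * t + c) (\<bar>t - q\<bar> - w)))"

lemma window_inf_bdd_below:
  "bdd_below ((\<lambda>t. min 1 (max (a * x t + b * t + c) (\<bar>t - q\<bar> - w))) ` S)" for x :: "real \<Rightarrow> real"
  by (rule bdd_belowI[of _ "min 1 (- w)"]) (auto simp: min_le_iff_disj le_max_iff_disj)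

lemma window_inf_lower:
  "0 \<le> t \<Longrightarrow> window_inf a b c q w x \<le> min 1 (max (a * x t + b * t + c) (\<bar>t - q\<bar> - w))"
  unfolding window_inf_def by (intro cINF_lower window_inf_bdd_below) auto

lemma window_inf_le_0I:
  assumes "0 \<le> t" "\<bar>t - q\<bar> \<le> w" "a * x t + b * t + c \<le> 0"
  shows "window_inf a b c q w x \<le> 0"
  using window_inf_lower[OF assms(1), of a b c q w x] assms by (auto simp: min_def max_def split: if_splits)

lemma window_inf_le_0D:
  assumes "window_inf a b c q w x \<le> 0" "e > 0"
  obtains t where "0 \<le> t" "\<bar>t - q\<bar> < w + e" "a * x t + b * t + c < e"
proof -
  have "window_inf a b c q w x < min 1 e" using assms by simp
  then obtain t where "0 \<le> t" "min 1 (max (a * x t + b * t + c) (\<bar>t - q\<bar> - w)) < min 1 e"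
    unfolding window_inf_def by (subst (asm) cINF_less_iff) (auto simp: window_inf_bdd_below)
  then show ?thesis by (intro that[of t]) (auto simp: min_def max_def split: if_splits)
qed

text \<open>Passing from path values to the completed graph does not change the infimum: on a
  vertical segment the affine term is smallest at an endpoint, and the left limit is approached by
  path values. Times beyond \<open>q + w + 1\<close> contribute only the cutoff value 1, so every
  horizon past that point gives the same number.\<close>

lemma window_inf_eq_graph:
  assumes x: "cadlag x" and T: "0 \<le> T" "q + w + 1 \<le> T"
  shows "window_inf a b c q w x =
    (INF p\<in>completed_graph T x. min 1 (max (a * snd p + b * fst p + c) (\<bar>fst p - q\<bar> - w)))"
    (is "_ = (INF p\<in>?G. ?f p)")
proof (rule antisym)
  have ne: "?G \<noteq> {}" using completed_graph_point[of 0 T x] T by auto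
  have bd: "bdd_below (?f ` S)" for S
    by (rule bdd_belowI[of _ "min 1 (- w)"]) (auto simp: min_le_iff_disj le_max_iff_disj)
  show "window_inf a b c q w x \<le> (INF p\<in>?G. ?f p)"
  proof (rule cINF_greatest[OF ne])
    fix p assume p: "p \<in> ?G"
    obtain t z where [simp]: "p = (t, z)" by fastforce
    have t: "0 \<le> t" "t \<le> T" and z: "z \<in> closed_segment (left_limit x t) (x t)"
      using p by (auto simp: completed_graph_def)
    have "a * z \<ge> min (a * left_limit x t) (a * x t)"
    proof -
      obtain u where u: "0 \<le> u" "u \<le> 1" "z = (1 - u) * left_limit x t + u * x t"
        using z by (auto simp: closed_segment_def)
      have "a * z = (1 - u) * (a * left_limit x t) + u * (a * x t)" by (simp add: u algebra_simps)
      also have "\<dots> \<ge> (1 - u) * min (a * left_limit x t) (a * x t) + u * min (a * left_limit x t) (a * x t)"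
        using u by (intro add_mono mult_left_mono) auto
      finally show ?thesis by (simp add: algebra_simps)
    qed
    then consider "a * z \<ge> a * x t" | "a * z \<ge> a * left_limit x t" by linarith
    then show "window_inf a b c q w x \<le> ?f p"
    proof cases
      case 1
      show ?thesis
        by (rule order_trans[OF window_inf_lower[OF t(1)]]) (use 1 in \<open>auto simp: min_def max_def\<close>)
    next
      case 2
      have "window_inf a b c q w x \<le> min 1 (max (a * left_limit x t + b * t + c) (\<bar>t - q\<bar> - w))"
      proof (cases "t = 0")
        case True
        then show ?thesis using window_inf_lower[OF t(1), of a b c q w x] by (simp add: left_limit_def)
      next
        case False
        then have "0 < t" using t by simp
        show ?thesis
        proof (rule tendsto_lowerbound)
          show "((\<lambda>s. min 1 (max (a * x s + b * s + c) (\<bar>s - q\<bar> - w))) \<longlongrightarrow>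
              min 1 (max (a * left_limit x t + b * t + c) (\<bar>t - q\<bar> - w))) (at_left t)"
            by (intro tendsto_intros cadlag_tendsto_left_limit x \<open>0 < t\<close>)
          show "\<forall>\<^sub>F s in at_left t. window_inf a b c q w x \<le> min 1 (max (a * x s + b * s + c) (\<bar>s - q\<bar> - w))"
            using eventually_at_left_real[OF \<open>0 < t\<close>]
            by eventually_elim (intro window_inf_lower, auto)
        qed simp
      qed
      also have "\<dots> \<le> ?f p" using 2 by (auto simp: min_def max_def)
      finally show ?thesis .
    qed
  qed
  show "(INF p\<in>?G. ?f p) \<le> window_inf a b c q w x"
    unfolding window_inf_def
  proof (rule cINF_greatest)
    fix t :: real assume t: "t \<in> {0..}"
    show "(INF p\<in>?G. ?f p) \<le> min 1 (max (a * x t + b * t + c) (\<bar>t - q\<bar> - w))"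
    proof (cases "t \<le> T")
      case True
      then show ?thesis
        using cINF_lower[OF bd completed_graph_point[of t T x]] t by simp
    next
      case False
      have "(INF p\<in>?G. ?f p) \<le> 1"
        using cINF_lower[OF bd completed_graph_point[of 0 T x]] T by (simp add: min_le_iff_disj le_max_iff_disj)
      then show ?thesis using False T by (auto simp: le_max_iff_disj)
    qed
  qed auto
qed

lemma window_function_Lipschitz:
  fixes a b c q w :: real
  defines "f \<equiv> \<lambda>p. min 1 (max (a * snd p + b * fst p + c) (\<bar>fst p - q\<bar> - w))"
  shows "\<bar>f p - f p'\<bar> \<le> (\<bar>a\<bar> + \<bar>b\<bar> + 1) * dist p p'"
proof -
  have d: "\<bar>fst p - fst p'\<bar> \<le> dist p p'" "\<bar>snd p - snd p'\<bar> \<le> dist p p'"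
    using dist_fst_le[of p p'] dist_snd_le[of p p'] by (simp_all add: dist_real_def)
  have min: "\<bar>min 1 u - min 1 v\<bar> \<le> \<bar>u - v\<bar>" for u v :: real
    by (simp add: min_def)
  have max: "\<bar>max A B - max A' B'\<bar> \<le> C" if "\<bar>A - A'\<bar> \<le> C" "\<bar>B - B'\<bar> \<le> C" for A A' B B' C :: real
    using that unfolding abs_le_iff max_def by (auto split: if_splits)
  have "\<bar>a * (snd p - snd p') + b * (fst p - fst p')\<bar> \<le> \<bar>a\<bar> * dist p p' + \<bar>b\<bar> * dist p p'"
    using d by (intro order_trans[OF abs_triangle_ineq]) (auto simp: abs_mult intro!: add_mono mult_left_mono)
  then have *: "\<bar>a * snd p + b * fst p + c - (a * snd p' + b * fst p' + c)\<bar> \<le> (\<bar>a\<bar> + \<bar>b\<bar> + 1) * dist p p'"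
    using zero_le_dist[of p p'] unfolding distrib_right right_diff_distrib by linarith
  have "\<bar>fst p - q - w - (fst p' - q - w)\<bar> \<le> 1 * dist p p'" using d by simp
  also have "\<dots> \<le> (\<bar>a\<bar> + \<bar>b\<bar> + 1) * dist p p'" by (intro mult_right_mono) auto
  finally have "\<bar>\<bar>fst p - q\<bar> - w - (\<bar>fst p' - q\<bar> - w)\<bar> \<le> (\<bar>a\<bar> + \<bar>b\<bar> + 1) * dist p p'" by linarith
  then show ?thesis
    unfolding f_def by (intro order_trans[OF min] max *)
qed

lemma window_inf_M2_tendsto:
  assumes X: "\<And>n. cadlag (X n)" and x: "cadlag x" and lim: "M2_tendsto X x"
  shows "(\<lambda>n. window_inf a b c q w (X n)) \<longlonglongrightarrow> window_inf a b c q w x"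
proof -
  obtain T where T: "T > max 0 (q + w + 1)" "T > 0" "isCont x T"
    by (rule cadlag_continuity_point[OF x])
  define f where "f = (\<lambda>p. min 1 (max (a * snd p + b * fst p + c) (\<bar>fst p - q\<bar> - w)))"
  have ne: "completed_graph T y \<noteq> {}" for y
    using completed_graph_point[of 0 T y] T by auto
  have le: "\<bar>window_inf a b c q w (X n) - window_inf a b c q w x\<bar> \<le>
      (\<bar>a\<bar> + \<bar>b\<bar> + 1) * hausdorff_distance (completed_graph T (X n)) (completed_graph T x)" for n
  proof -
    have eq: "window_inf a b c q w y = (INF p\<in>completed_graph T y. f p)" if "cadlag y" for y
      unfolding f_def by (rule window_inf_eq_graph) (use T that in auto)
    show ?thesis
      unfolding eq[OF X] eq[OF x]
    proof (rule INF_Lipschitz_hausdorff)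
      show "\<bar>f p - f p'\<bar> \<le> (\<bar>a\<bar> + \<bar>b\<bar> + 1) * dist p p'" for p p'
        unfolding f_def by (rule window_function_Lipschitz)
      show "min 1 (- w) \<le> f p" for p by (auto simp: f_def min_le_iff_disj le_max_iff_disj)
    qed (auto intro!: completed_graph_bounded X x ne)
  qed
  have lim0: "(\<lambda>n. (\<bar>a\<bar> + \<bar>b\<bar> + 1) * hausdorff_distance (completed_graph T (X n)) (completed_graph T x)) \<longlonglongrightarrow> 0"
    using lim T by (intro tendsto_mult_right_zero) (auto simp: M2_tendsto_def)
  have "(\<lambda>n. window_inf a b c q w (X n) - window_inf a b c q w x) \<longlonglongrightarrow> 0"
    by (rule Lim_null_comparison[OF _ lim0]) (unfold real_norm_def, rule always_eventually, rule allI, rule le)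
  then show ?thesis by (simp add: LIM_zero_iff)
qed

text \<open>By right continuity a rational time just after \<open>t\<close> does nearly as well as
  \<open>t\<close>. The infimum becomes countable, so its measurability follows from that of the
  coordinates.\<close>

lemma window_inf_rational:
  assumes x: "cadlag x"
  shows "window_inf a b c q w x =
    (INF t\<in>{0..} \<inter> \<rat>. min 1 (max (a * x t + b * t + c) (\<bar>t - q\<bar> - w)))"
proof (rule antisym)
  have Q0: "{0..} \<inter> \<rat> \<noteq> ({} :: real set)" by (metis Int_iff Rats_0 atLeast_iff empty_iff order_refl)
  show "window_inf a b c q w x \<le> (INF t\<in>{0..} \<inter> \<rat>. min 1 (max (a * x t + b * t + c) (\<bar>t - q\<bar> - w)))"
    by (intro cINF_greatest Q0 window_inf_lower) auto
  show "(INF t\<in>{0..} \<inter> \<rat>. min 1 (max (a * x t + b * t + c) (\<bar>t - q\<bar> - w))) \<le> window_inf a b c q w x"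
    (is "?I \<le> _")
    unfolding window_inf_def
  proof (rule cINF_greatest)
    fix t :: real assume t: "t \<in> {0..}"
    show "?I \<le> min 1 (max (a * x t + b * t + c) (\<bar>t - q\<bar> - w))"
    proof (rule ccontr)
      assume "\<not> ?I \<le> min 1 (max (a * x t + b * t + c) (\<bar>t - q\<bar> - w))"
      moreover have "((\<lambda>s. min 1 (max (a * x s + b * s + c) (\<bar>s - q\<bar> - w))) \<longlongrightarrow>
              min 1 (max (a * x t + b * t + c) (\<bar>t - q\<bar> - w))) (at_right t)"
        by (intro tendsto_intros cadlag_tendsto_right x) (use t in auto)
      ultimately have "\<forall>\<^sub>F s in at_right t. min 1 (max (a * x s + b * s + c) (\<bar>s - q\<bar> - w)) < ?I"
        by (intro order_tendstoD) auto
      then obtain d where d: "d > 0"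
          "\<And>s. t < s \<Longrightarrow> s < t + d \<Longrightarrow> min 1 (max (a * x s + b * s + c) (\<bar>s - q\<bar> - w)) < ?I"
        using eventually_at_right_Ioo by blast
      obtain s where s: "s \<in> \<rat>" "t < s" "s < t + d"
        using Rats_dense_in_real[of t "t + d"] d by auto
      have "?I \<le> min 1 (max (a * x s + b * s + c) (\<bar>s - q\<bar> - w))"
        using s t by (intro cINF_lower window_inf_bdd_below) auto
      then show False using d(2)[OF s(2,3)] leD by blast
    qed
  qed auto
qed

lemma cadlag_process_measurable: "cadlag_process M X \<Longrightarrow> 0 \<le> t \<Longrightarrow> (\<lambda>\<omega>. X \<omega> t) \<in> borel_measurable M"
  by (simp add: cadlag_process_def)

lemma cadlag_process_cadlag: "cadlag_process M X \<Longrightarrow> \<omega> \<in> space M \<Longrightarrow> cadlag (X \<omega>)"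
  by (simp add: cadlag_process_def)

lemma window_inf_measurable:
  assumes X: "cadlag_process M X"
  shows "(\<lambda>\<omega>. window_inf a b c q w (X \<omega>)) \<in> borel_measurable M"
proof -
  have *: "(\<lambda>\<omega>. INF t\<in>{0..} \<inter> \<rat>. min 1 (max (a * X \<omega> t + b * t + c) (\<bar>t - q\<bar> - w))) \<in> borel_measurable M"
    by (intro borel_measurable_cINF_real countable_Int2 countable_rat
         borel_measurable_min borel_measurable_max borel_measurable_add borel_measurable_times
         borel_measurable_const cadlag_process_measurable[OF X]) auto
  have "window_inf a b c q w (X \<omega>) =
      (INF t\<in>{0..} \<inter> \<rat>. min 1 (max (a * X \<omega> t + b * t + c) (\<bar>t - q\<bar> - w)))"
    if "\<omega> \<in> space M" for \<omega>
    by (rule window_inf_rational) (rule cadlag_process_cadlag[OF X that])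
  then show ?thesis
    using measurable_cong[of M "\<lambda>\<omega>. window_inf a b c q w (X \<omega>)"
      "\<lambda>\<omega>. INF t\<in>{0..} \<inter> \<rat>. min 1 (max (a * X \<omega> t + b * t + c) (\<bar>t - q\<bar> - w))" borel] * by blast
qed

section \<open>Weak convergence and closed conditions\<close>

definition path_measurable :: "'a measure \<Rightarrow> (path \<times> path \<Rightarrow> real) \<Rightarrow> bool" where
  "path_measurable M f \<longleftrightarrow>
     (\<forall>X1 X2. cadlag_process M X1 \<longrightarrow> cadlag_process M X2 \<longrightarrow> (\<lambda>\<omega>. f (X1 \<omega>, X2 \<omega>)) \<in> borel_measurable M)"

text \<open>Measurability is required along both processes, because the Borel sigma-algebra of the
  path space is not used here.\<close>

definition M2_closed :: "'a measure \<Rightarrow> 'b measure \<Rightarrow> (path \<Rightarrow> path \<Rightarrow> bool) \<Rightarrow> bool" where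
  "M2_closed M N P \<longleftrightarrow>
     (\<exists>f. WM2_continuous f \<and> path_measurable M f \<and> path_measurable N f \<and>
        (\<forall>x1 x2. cadlag x1 \<longrightarrow> cadlag x2 \<longrightarrow> (P x1 x2 \<longleftrightarrow> f (x1, x2) \<le> 0)))"

lemma M2_closedI:
  assumes "WM2_continuous f" "path_measurable M f" "path_measurable N f"
    and "\<And>x1 x2. cadlag x1 \<Longrightarrow> cadlag x2 \<Longrightarrow> P x1 x2 \<longleftrightarrow> f (x1, x2) \<le> 0"
  shows "M2_closed M N P"
  using assms unfolding M2_closed_def by blast

lemma M2_closedE:
  assumes "M2_closed M N P"
  obtains f where "WM2_continuous f" "path_measurable M f" "path_measurable N f"
    "\<And>x1 x2. cadlag x1 \<Longrightarrow> cadlag x2 \<Longrightarrow> P x1 x2 \<longleftrightarrow> f (x1, x2) \<le> 0"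
  using assms unfolding M2_closed_def by blast

lemma WM2_continuous_compose2:
  assumes f: "WM2_continuous f" and g: "WM2_continuous g"
    and h: "\<And>F a b A B. ((A \<longlongrightarrow> a) F \<Longrightarrow> (B \<longlongrightarrow> b) F \<Longrightarrow> ((\<lambda>n::nat. h (A n) (B n)) \<longlongrightarrow> h a b) F)"
  shows "WM2_continuous (\<lambda>p. h (f p) (g p))"
  unfolding WM2_continuous_def
proof (intro allI impI)
  fix X1 X2 x1 x2
  assume *: "(\<forall>n. cadlag (X1 n) \<and> cadlag (X2 n)) \<and> cadlag x1 \<and> cadlag x2 \<and> M2_tendsto X1 x1 \<and> M2_tendsto X2 x2"
  show "(\<lambda>n. h (f (X1 n, X2 n)) (g (X1 n, X2 n))) \<longlonglongrightarrow> h (f (x1, x2)) (g (x1, x2))"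
    by (rule h) (use f g * in \<open>auto simp: WM2_continuous_def\<close>)
qed

lemma M2_closed_const: "M2_closed M N (\<lambda>x1 x2. P)"
  by (rule M2_closedI[of "\<lambda>_. if P then 0 else 1"]) (auto simp: WM2_continuous_def path_measurable_def)

lemma M2_closed_conj:
  assumes "M2_closed M N P" "M2_closed M N Q"
  shows "M2_closed M N (\<lambda>x1 x2. P x1 x2 \<and> Q x1 x2)"
  using assms
proof (elim M2_closedE)
  fix f g assume *: "WM2_continuous f" "WM2_continuous g" "path_measurable M f" "path_measurable N f"
    "path_measurable M g" "path_measurable N g"
    "\<And>x1 x2. cadlag x1 \<Longrightarrow> cadlag x2 \<Longrightarrow> P x1 x2 = (f (x1, x2) \<le> 0)"
    "\<And>x1 x2. cadlag x1 \<Longrightarrow> cadlag x2 \<Longrightarrow> Q x1 x2 = (g (x1, x2) \<le> 0)"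
  show ?thesis
  proof (rule M2_closedI[of "\<lambda>p. max (f p) (g p)"])
    show "WM2_continuous (\<lambda>p. max (f p) (g p))"
      by (rule WM2_continuous_compose2[where h = max]) (use * in \<open>auto intro: tendsto_max\<close>)
    show "path_measurable M (\<lambda>p. max (f p) (g p))" "path_measurable N (\<lambda>p. max (f p) (g p))"
      using *(3-6) unfolding path_measurable_def by (safe; intro borel_measurable_max; blast)+
  qed (use * in \<open>auto\<close>)
qed

lemma M2_closed_disj:
  assumes "M2_closed M N P" "M2_closed M N Q"
  shows "M2_closed M N (\<lambda>x1 x2. P x1 x2 \<or> Q x1 x2)"
  using assms
proof (elim M2_closedE)
  fix f g assume *: "WM2_continuous f" "WM2_continuous g" "path_measurable M f" "path_measurable N f"
    "path_measurable M g" "path_measurable N g"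
    "\<And>x1 x2. cadlag x1 \<Longrightarrow> cadlag x2 \<Longrightarrow> P x1 x2 = (f (x1, x2) \<le> 0)"
    "\<And>x1 x2. cadlag x1 \<Longrightarrow> cadlag x2 \<Longrightarrow> Q x1 x2 = (g (x1, x2) \<le> 0)"
  show ?thesis
  proof (rule M2_closedI[of "\<lambda>p. min (f p) (g p)"])
    show "WM2_continuous (\<lambda>p. min (f p) (g p))"
      by (rule WM2_continuous_compose2[where h = min]) (use * in \<open>auto intro: tendsto_min\<close>)
    show "path_measurable M (\<lambda>p. min (f p) (g p))" "path_measurable N (\<lambda>p. min (f p) (g p))"
      using *(3-6) unfolding path_measurable_def by (safe; intro borel_measurable_min; blast)+
  qed (use * in \<open>auto simp: min_le_iff_disj\<close>)
qed

lemma M2_closed_ball: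
  assumes "finite A" "\<And>i. i \<in> A \<Longrightarrow> M2_closed M N (P i)"
  shows "M2_closed M N (\<lambda>x1 x2. \<forall>i\<in>A. P i x1 x2)"
  using assms by (induction A rule: finite_induct) (simp_all add: M2_closed_const M2_closed_conj)

lemma M2_closed_bex:
  assumes "finite A" "\<And>i. i \<in> A \<Longrightarrow> M2_closed M N (P i)"
  shows "M2_closed M N (\<lambda>x1 x2. \<exists>i\<in>A. P i x1 x2)"
  using assms by (induction A rule: finite_induct) (simp_all add: M2_closed_const M2_closed_disj)

lemma M2_closed_window:
  "M2_closed M N (\<lambda>x1 x2. window_inf a b c q w x1 \<le> 0)"
  "M2_closed M N (\<lambda>x1 x2. window_inf a b c q w x2 \<le> 0)"
  "M2_closed M N (\<lambda>x1 x2. 0 \<le> window_inf a b c q w x2)"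
proof -
  have cont: "WM2_continuous (\<lambda>p. window_inf a b c q w (fst p))" "WM2_continuous (\<lambda>p. window_inf a b c q w (snd p))"
      "WM2_continuous (\<lambda>p. - window_inf a b c q w (snd p))"
    unfolding WM2_continuous_def by (safe; simp; intro tendsto_minus window_inf_M2_tendsto; blast)+
  have meas: "path_measurable L (\<lambda>p. window_inf a b c q w (fst p))" "path_measurable L (\<lambda>p. window_inf a b c q w (snd p))"
      "path_measurable L (\<lambda>p. - window_inf a b c q w (snd p))" for L :: "'l measure"
    unfolding path_measurable_def by (safe; simp; intro borel_measurable_uminus window_inf_measurable)+
  show "M2_closed M N (\<lambda>x1 x2. window_inf a b c q w x1 \<le> 0)"
    by (rule M2_closedI[OF cont(1) meas(1) meas(1)]) simp
  show "M2_closed M N (\<lambda>x1 x2. window_inf a b c q w x2 \<le> 0)"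
    by (rule M2_closedI[OF cont(2) meas(2) meas(2)]) simp
  show "M2_closed M N (\<lambda>x1 x2. 0 \<le> window_inf a b c q w x2)"
    by (rule M2_closedI[OF cont(3) meas(3) meas(3)]) simp
qed

lemma M2_closed_measurable:
  assumes "M2_closed M N P" "cadlag_process N Y1" "cadlag_process N Y2"
  shows "{\<omega> \<in> space N. P (Y1 \<omega>) (Y2 \<omega>)} \<in> sets N"
proof -
  obtain f where f: "path_measurable N f"
      "\<And>x1 x2. cadlag x1 \<Longrightarrow> cadlag x2 \<Longrightarrow> P x1 x2 \<longleftrightarrow> f (x1, x2) \<le> 0"
    by (rule M2_closedE[OF assms(1)]) (rule that)
  have [measurable]: "(\<lambda>\<omega>. f (Y1 \<omega>, Y2 \<omega>)) \<in> borel_measurable N"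
    using f(1) assms by (auto simp: path_measurable_def)
  have "{\<omega> \<in> space N. P (Y1 \<omega>) (Y2 \<omega>)} = {\<omega> \<in> space N. f (Y1 \<omega>, Y2 \<omega>) \<le> 0}"
    using assms(2,3) by (auto simp: f(2) cadlag_process_def)
  also have "\<dots> \<in> sets N" by measurable
  finally show ?thesis .
qed

lemma M2_closed_sym:
  assumes "M2_closed M N P" shows "M2_closed N M P"
  using assms unfolding M2_closed_def by blast

text \<open>The indicator of \<open>f \<le> 0\<close> is approximated from above by the bounded
  continuous functionals \<open>\<psi> k (f p)\<close>. First \<open>k\<close> is fixed by dominated
  convergence under the limit law, then weak convergence is applied to that single
  functional.\<close>

lemma M2_closed_portmanteau:
  assumes P: "M2_closed M N P" and M: "prob_space M" and N: "prob_space N"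
    and lim: "WM2_weak_tendsto M (\<lambda>i \<omega>. (X1 i \<omega>, X2 i \<omega>)) N (\<lambda>\<omega>. (Y1 \<omega>, Y2 \<omega>)) G"
    and X: "\<forall>\<^sub>F i in G. cadlag_process M (X1 i) \<and> cadlag_process M (X2 i)"
    and Y: "cadlag_process N Y1" "cadlag_process N Y2"
    and "0 < \<gamma>"
  shows "\<forall>\<^sub>F i in G. measure M {\<omega> \<in> space M. P (X1 i \<omega>) (X2 i \<omega>)}
           \<le> measure N {\<omega> \<in> space N. P (Y1 \<omega>) (Y2 \<omega>)} + \<gamma>"
proof -
  interpret M: prob_space M by fact
  interpret N: prob_space N by fact
  obtain f where f: "WM2_continuous f" "path_measurable M f" "path_measurable N f"
      "\<And>x1 x2. cadlag x1 \<Longrightarrow> cadlag x2 \<Longrightarrow> P x1 x2 \<longleftrightarrow> f (x1, x2) \<le> 0"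
    by (rule M2_closedE[OF P]) (rule that)
  define \<psi> where "\<psi> k u = max 0 (1 - real k * max 0 u)" for k :: nat and u :: real
  have \<psi>: "0 \<le> \<psi> k u" "\<psi> k u \<le> 1" "u \<le> 0 \<Longrightarrow> \<psi> k u = 1" for k u by (auto simp: \<psi>_def)
  have \<psi>_cont: "continuous_on UNIV (\<psi> k)" for k unfolding \<psi>_def by (intro continuous_intros)
  then have \<psi>_meas [measurable]: "\<psi> k \<in> borel_measurable borel" for k by (intro borel_measurable_continuous_onI)
  have \<psi>_lim: "(\<lambda>k. \<psi> k u) \<longlonglongrightarrow> indicator {..0} u" for u
  proof (cases "u \<le> 0")
    case False
    then obtain k0 :: nat where k0: "1 / u < real k0" using reals_Archimedean2 by blast
    have "\<psi> k u = 0" if "k \<ge> k0" for k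
    proof -
      have "1 \<le> real k0 * u" using k0 False by (simp add: field_simps)
      also have "\<dots> \<le> real k * u" using that False by (intro mult_right_mono) auto
      finally show ?thesis using False by (simp add: \<psi>_def)
    qed
    then have "\<forall>\<^sub>F k in sequentially. \<psi> k u = indicator {..0} u"
      using False by (auto simp: eventually_sequentially indicator_def)
    then show ?thesis by (rule tendsto_eventually)
  qed (simp add: \<psi>(3))
  have fY [measurable]: "(\<lambda>\<omega>. f (Y1 \<omega>, Y2 \<omega>)) \<in> borel_measurable N"
    using f(3) Y by (auto simp: path_measurable_def)
  have "(\<lambda>k. \<integral>\<omega>. \<psi> k (f (Y1 \<omega>, Y2 \<omega>)) \<partial>N) \<longlonglongrightarrow> (\<integral>\<omega>. indicator {..0} (f (Y1 \<omega>, Y2 \<omega>)) \<partial>N)"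
    by (rule integral_dominated_convergence[where w = "\<lambda>_. 1"]) (auto simp: \<psi> \<psi>_lim)
  also have "(\<integral>\<omega>. indicator {..0} (f (Y1 \<omega>, Y2 \<omega>)) \<partial>N) = measure N {\<omega> \<in> space N. P (Y1 \<omega>) (Y2 \<omega>)}"
  proof -
    have "(\<integral>\<omega>. indicator {..0} (f (Y1 \<omega>, Y2 \<omega>)) \<partial>N) =
        (\<integral>\<omega>. indicator {\<omega> \<in> space N. P (Y1 \<omega>) (Y2 \<omega>)} \<omega> \<partial>N)"
      using Y by (intro Bochner_Integration.integral_cong) (auto simp: f(4) cadlag_process_def indicator_def)
    also have "\<dots> = measure N ({\<omega> \<in> space N. P (Y1 \<omega>) (Y2 \<omega>)} \<inter> space N)" by simp
    finally show ?thesis by (simp add: Int_def conj_commute)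
  qed
  finally have "\<forall>\<^sub>F k in sequentially. (\<integral>\<omega>. \<psi> k (f (Y1 \<omega>, Y2 \<omega>)) \<partial>N) < measure N {\<omega> \<in> space N. P (Y1 \<omega>) (Y2 \<omega>)} + \<gamma> / 2"
    by (rule order_tendstoD) (use \<open>0 < \<gamma>\<close> in simp)
  then obtain k where k: "(\<integral>\<omega>. \<psi> k (f (Y1 \<omega>, Y2 \<omega>)) \<partial>N) < measure N {\<omega> \<in> space N. P (Y1 \<omega>) (Y2 \<omega>)} + \<gamma> / 2"
    by (auto simp: eventually_sequentially)
  define g where "g p = \<psi> k (f p)" for p
  have "WM2_continuous g"
    unfolding g_def WM2_continuous_def
  proof (intro allI impI)
    fix U1 U2 u1 u2
    assume *: "(\<forall>n. cadlag (U1 n) \<and> cadlag (U2 n)) \<and> cadlag u1 \<and> cadlag u2 \<and> M2_tendsto U1 u1 \<and> M2_tendsto U2 u2"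
    show "(\<lambda>n. \<psi> k (f (U1 n, U2 n))) \<longlonglongrightarrow> \<psi> k (f (u1, u2))"
      by (rule continuous_on_tendsto_compose[OF \<psi>_cont]) (use f(1) * in \<open>auto simp: WM2_continuous_def\<close>)
  qed
  moreover have "WM2_bounded g" unfolding WM2_bounded_def g_def using \<psi>(1,2) by (intro exI[of _ 1]) auto
  ultimately have "((\<lambda>i. \<integral>\<omega>. g (X1 i \<omega>, X2 i \<omega>) \<partial>M) \<longlongrightarrow> (\<integral>\<omega>. g (Y1 \<omega>, Y2 \<omega>) \<partial>N)) G"
    using lim unfolding WM2_weak_tendsto_def by blast
  then have "\<forall>\<^sub>F i in G. (\<integral>\<omega>. g (X1 i \<omega>, X2 i \<omega>) \<partial>M) < measure N {\<omega> \<in> space N. P (Y1 \<omega>) (Y2 \<omega>)} + \<gamma>"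
    by (rule order_tendstoD) (use k \<open>0 < \<gamma>\<close> in \<open>simp add: g_def\<close>)
  then show ?thesis
    using X
  proof eventually_elim
    case (elim i)
    have fX [measurable]: "(\<lambda>\<omega>. f (X1 i \<omega>, X2 i \<omega>)) \<in> borel_measurable M"
      using f(2) elim(2) by (auto simp: path_measurable_def)
    have sets: "{\<omega> \<in> space M. P (X1 i \<omega>) (X2 i \<omega>)} \<in> sets M"
      using elim(2) by (intro M2_closed_measurable[OF M2_closed_sym[OF P]]) auto
    have "measure M {\<omega> \<in> space M. P (X1 i \<omega>) (X2 i \<omega>)} = (\<integral>\<omega>. indicator {\<omega> \<in> space M. P (X1 i \<omega>) (X2 i \<omega>)} \<omega> \<partial>M)"
      by (simp add: Int_def conj_commute)
    also have "\<dots> \<le> (\<integral>\<omega>. g (X1 i \<omega>, X2 i \<omega>) \<partial>M)"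
    proof (rule integral_mono)
      show "integrable M (\<lambda>\<omega>. g (X1 i \<omega>, X2 i \<omega>))"
        unfolding g_def by (rule M.integrable_const_bound[where B = 1]) (auto simp: \<psi>)
      show "indicator {\<omega> \<in> space M. P (X1 i \<omega>) (X2 i \<omega>)} \<omega> \<le> g (X1 i \<omega>, X2 i \<omega>)" if "\<omega> \<in> space M" for \<omega>
        using elim(2) that f(4)[of "X1 i \<omega>" "X2 i \<omega>"]
        by (auto simp: g_def \<psi> cadlag_process_def indicator_def)
    qed (use sets in \<open>simp add: M.emeasure_eq_measure\<close>)
    also note elim(1)
    finally show ?case by simp
  qed
qed

text \<open>The events \<open>P m\<close> need not be monotone in \<open>m\<close>, so their tail
  unions are used: these decrease to the event that \<open>P m\<close> holds infinitely often, which
  \<open>Q\<close> covers. How far \<open>i\<close> has to go depends on \<open>m\<close>, hence the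
  order of the quantifiers.\<close>

lemma weak_limsup:
  fixes P :: "nat \<Rightarrow> path \<Rightarrow> path \<Rightarrow> bool"
  assumes P: "\<And>m. M2_closed M N (P m)" and M: "prob_space M" and N: "prob_space N"
    and lim: "WM2_weak_tendsto M (\<lambda>i \<omega>. (X1 i \<omega>, X2 i \<omega>)) N (\<lambda>\<omega>. (Y1 \<omega>, Y2 \<omega>)) G"
    and X: "\<forall>\<^sub>F i in G. cadlag_process M (X1 i) \<and> cadlag_process M (X2 i)"
    and Y: "cadlag_process N Y1" "cadlag_process N Y2"
    and Q: "AE \<omega> in N. (\<exists>\<^sub>\<infinity>m. P m (Y1 \<omega>) (Y2 \<omega>)) \<longrightarrow> Q \<omega>" "{\<omega> \<in> space N. Q \<omega>} \<in> sets N"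
    and "0 < \<gamma>"
  shows "\<exists>m0. \<forall>m\<ge>m0. \<forall>\<^sub>F i in G. measure M {\<omega> \<in> space M. P m (X1 i \<omega>) (X2 i \<omega>)}
           \<le> measure N {\<omega> \<in> space N. Q \<omega>} + \<gamma>"
proof -
  interpret N: prob_space N by fact
  define B where "B m = {\<omega> \<in> space N. \<exists>k\<ge>m. P k (Y1 \<omega>) (Y2 \<omega>)}" for m
  have meas: "{\<omega> \<in> space N. P k (Y1 \<omega>) (Y2 \<omega>)} \<in> sets N" for k
    by (rule M2_closed_measurable[OF P Y])
  have B_eq: "B m = (\<Union>k. {\<omega> \<in> space N. P (m + k) (Y1 \<omega>) (Y2 \<omega>)})" for m
    unfolding B_def le_iff_add by auto
  have B [measurable]: "B m \<in> sets N" for m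
    unfolding B_eq by (rule sets.countable_UN) (use meas in blast)
  have lim_B: "(\<lambda>m. measure N (B m)) \<longlonglongrightarrow> measure N (\<Inter>m. B m)"
  proof (rule N.finite_Lim_measure_decseq)
    show "decseq B" unfolding decseq_def B_def by (blast intro: order_trans)
  qed auto
  have "measure N (\<Inter>m. B m) \<le> measure N {\<omega> \<in> space N. Q \<omega>}"
  proof (rule N.finite_measure_mono_AE)
    show "AE \<omega> in N. \<omega> \<in> (\<Inter>m. B m) \<longrightarrow> \<omega> \<in> {\<omega> \<in> space N. Q \<omega>}"
      using Q(1) by eventually_elim (simp add: B_def INFM_nat_le)
  qed (rule Q)
  then have "measure N (\<Inter>m. B m) < measure N {\<omega> \<in> space N. Q \<omega>} + \<gamma> / 2"
    using \<open>0 < \<gamma>\<close> by linarith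
  from order_tendstoD(2)[OF lim_B this]
  obtain m0 where m0: "\<And>m. m \<ge> m0 \<Longrightarrow> measure N (B m) < measure N {\<omega> \<in> space N. Q \<omega>} + \<gamma> / 2"
    by (auto simp: eventually_sequentially)
  have "\<forall>\<^sub>F i in G. measure M {\<omega> \<in> space M. P m (X1 i \<omega>) (X2 i \<omega>)} \<le> measure N {\<omega> \<in> space N. Q \<omega>} + \<gamma>"
    if m: "m \<ge> m0" for m
  proof -
    have "measure N {\<omega> \<in> space N. P m (Y1 \<omega>) (Y2 \<omega>)} \<le> measure N (B m)"
      by (rule N.finite_measure_mono[OF _ B]) (unfold B_def, blast)
    then have *: "measure N {\<omega> \<in> space N. P m (Y1 \<omega>) (Y2 \<omega>)} + \<gamma> / 2 \<le> measure N {\<omega> \<in> space N. Q \<omega>} + \<gamma>"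
      using m0[OF m] by simp
    have "0 < \<gamma> / 2" using \<open>0 < \<gamma>\<close> by simp
    from M2_closed_portmanteau[OF P M N lim X Y this, of m] show ?thesis
    proof eventually_elim
      case (elim i)
      then show ?case using * by linarith
    qed
  qed
  then show ?thesis by blast
qed

text \<open>The exceptional set is measurable but \<open>P\<close> itself need not be, so statements
  about stopping times and quantiles can be combined by union bounds without proving them
  measurable.\<close>

definition whp :: "'a measure \<Rightarrow> real \<Rightarrow> ('a \<Rightarrow> bool) \<Rightarrow> bool" where
  "whp M \<gamma> P \<longleftrightarrow> (\<exists>B\<in>sets M. measure M B \<le> \<gamma> \<and> (\<forall>\<omega>\<in>space M - B. P \<omega>))"

lemma whpI:
  assumes "{\<omega> \<in> space M. B \<omega>} \<in> sets M" "measure M {\<omega> \<in> space M. B \<omega>} \<le> \<gamma>"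
    and "\<And>\<omega>. \<omega> \<in> space M \<Longrightarrow> \<not> B \<omega> \<Longrightarrow> P \<omega>"
  shows "whp M \<gamma> P"
  unfolding whp_def using assms by (intro bexI[of _ "{\<omega> \<in> space M. B \<omega>}"]) auto

lemma whp_mono:
  assumes "whp M \<gamma> P" "\<gamma> \<le> \<gamma>'" "\<And>\<omega>. \<omega> \<in> space M \<Longrightarrow> P \<omega> \<Longrightarrow> Q \<omega>"
  shows "whp M \<gamma>' Q"
proof -
  obtain B where "B \<in> sets M" "measure M B \<le> \<gamma>" "\<forall>\<omega>\<in>space M - B. P \<omega>" using assms(1) by (auto simp: whp_def)
  then show ?thesis unfolding whp_def using assms(2,3) by (intro bexI[of _ B]) auto
qed

context prob_space
begin

lemma whp_conj:
  assumes "whp M a P" "whp M b Q"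
  shows "whp M (a + b) (\<lambda>\<omega>. P \<omega> \<and> Q \<omega>)"
proof -
  obtain A where A: "A \<in> sets M" "prob A \<le> a" "\<forall>\<omega>\<in>space M - A. P \<omega>"
    using assms(1) unfolding whp_def by blast
  moreover obtain B where B: "B \<in> sets M" "prob B \<le> b" "\<forall>\<omega>\<in>space M - B. Q \<omega>"
    using assms(2) unfolding whp_def by blast
  moreover have "prob (A \<union> B) \<le> a + b"
    using measure_Un_le[OF A(1) B(1)] A(2) B(2) by linarith
  ultimately show ?thesis
    unfolding whp_def by (intro bexI[of _ "A \<union> B"] conjI) simp_all
qed

lemma whp_all:
  assumes "finite I" "\<And>i. i \<in> I \<Longrightarrow> whp M (a i) (P i)"
  shows "whp M (\<Sum>i\<in>I. a i) (\<lambda>\<omega>. \<forall>i\<in>I. P i \<omega>)"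
  using assms
proof (induction I rule: finite_induct)
  case empty
  show ?case by (auto simp: whp_def intro!: bexI[of _ "{}"])
next
  case (insert i I)
  then show ?case using whp_conj[of "a i" "P i" "sum a I" "\<lambda>\<omega>. \<forall>i\<in>I. P i \<omega>"] by simp
qed

lemma whp_imp_prob_le:
  assumes "whp M \<gamma> P" "\<And>\<omega>. \<omega> \<in> space M \<Longrightarrow> P \<omega> \<Longrightarrow> \<not> Q \<omega>"
  shows "prob {\<omega> \<in> space M. Q \<omega>} \<le> \<gamma>"
proof -
  obtain B where B: "B \<in> sets M" "prob B \<le> \<gamma>" "\<forall>\<omega>\<in>space M - B. P \<omega>" using assms(1) by (auto simp: whp_def)
  have "{\<omega> \<in> space M. Q \<omega>} \<subseteq> B"
  proof
    fix \<omega> assume "\<omega> \<in> {\<omega> \<in> space M. Q \<omega>}"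
    then show "\<omega> \<in> B" using B(3) assms(2)[of \<omega>] by (cases "\<omega> \<in> B") auto
  qed
  then have "prob {\<omega> \<in> space M. Q \<omega>} \<le> prob B" by (rule finite_measure_mono[OF _ B(1)])
  then show ?thesis using B(2) by (rule order_trans)
qed

end

section \<open>Discretized first passage\<close>

text \<open>Each window comes close to a point on or above the line of slope \<open>1 - 1/m\<close>;
  such an existence condition is closed, and it can be verified from values on a grid. The windows
  start at \<open>5/m\<close> because scaled times up to \<open>3/m\<close> are left uncontrolled,
  and the mesh and width cost less than \<open>2/m\<close>.\<close>

definition windows_above :: "nat \<Rightarrow> nat \<Rightarrow> path \<Rightarrow> bool" where
  "windows_above m p x \<longleftrightarrow>
     (\<forall>j\<in>{5..<p}. window_inf (-1) (1 - 1 / real m) 0 (real j / real m) (1 / real m) x \<le> 0)"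

text \<open>Each condition ties its time to \<open>p/m\<close> separately, because the topology
  offers no common time for both coordinates. The condition with \<open>\<eta>\<close> catches a
  drop below level 1 by a fixed fraction, after which the denominator could no longer be replaced by
  the time.\<close>

definition cell_event :: "real \<Rightarrow> real \<Rightarrow> real \<Rightarrow> nat \<Rightarrow> nat \<Rightarrow> path \<Rightarrow> path \<Rightarrow> bool" where
  "cell_event \<eta> \<sigma> y m p x1 x2 \<longleftrightarrow>
     window_inf 1 (- (1 + 1 / real m)) 0 (real p / real m) (1 / real m) x2 \<le> 0 \<and>
     (window_inf 1 (- (1 - \<eta>)) 0 (real p / real m) (1 / real m) x2 \<le> 0 \<or>
      window_inf \<sigma> (- y) 0 (real p / real m) (1 / real m) x1 \<le> 0)"

text \<open>Discretized version, with mesh \<open>1/m\<close>, of the event that \<open>x2\<close> first crosses the identity at a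
  time \<open>\<tau> \<le> m\<close> with \<open>x2 \<tau> \<le> (1 - \<eta>) \<tau>\<close> or \<open>\<sigma> * x1 \<tau> \<le> y * \<tau>\<close>, or does not cross before \<open>m\<close>.
  It only involves finitely many conditions on \<open>x1\<close> and \<open>x2\<close> separately.\<close>

definition passage_event :: "real \<Rightarrow> real \<Rightarrow> real \<Rightarrow> nat \<Rightarrow> path \<Rightarrow> path \<Rightarrow> bool" where
  "passage_event \<eta> \<sigma> y m x1 x2 \<longleftrightarrow>
     (\<exists>p\<in>{3..m * m}. windows_above m p x2 \<and> cell_event \<eta> \<sigma> y m p x1 x2) \<or> windows_above m (m * m) x2"

lemma M2_closed_passage_event: "M2_closed M N (passage_event \<eta> \<sigma> y m)"
  unfolding passage_event_def windows_above_def cell_event_def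
  by (intro M2_closed_disj M2_closed_conj M2_closed_bex M2_closed_ball M2_closed_window) auto

text \<open>The grid of the points \<open>n * e\<close> is finer than the windows, so every window
  contains a grid point at which \<open>above\<close> applies.\<close>

lemma windows_aboveI:
  fixes e :: real
  assumes e: "0 < e" "e < 1 / real m" and "0 < m"
    and above: "\<And>n. 3 / real m < real n * e \<Longrightarrow> real n * e < real p / real m \<Longrightarrow> (1 - 1 / real m) * (real n * e) \<le> x (real n * e)"
  shows "windows_above m p x"
  unfolding windows_above_def
proof
  fix j assume j: "j \<in> {5..<p}"
  \<comment> \<open>The last grid point not after \<open>j/m\<close>; its distance from
    \<open>j/m\<close> is less than \<open>e < 1/m\<close>.\<close>
  define n where "n = nat \<lfloor>real j / real m / e\<rfloor>"
  have "0 \<le> real j / real m / e" using e by simp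
  then have n: "real n \<le> real j / real m / e" "real j / real m / e < real n + 1"
    unfolding n_def by linarith+
  have n1: "real n * e \<le> real j / real m" "real j / real m < real n * e + e"
    using n(1) pos_le_divide_eq[OF e(1), of "real n" "real j / real m"]
      n(2) pos_divide_less_eq[OF e(1), of "real j / real m" "real n + 1"] by (simp_all add: algebra_simps)
  have "5 / real m \<le> real j / real m" "real j / real m < real p / real m"
    using j \<open>0 < m\<close> by (auto simp: divide_simps)
  moreover have "5 / real m = 3 / real m + 1 / real m + 1 / real m" by (simp add: field_simps)
  moreover have "0 < 1 / real m" using \<open>0 < m\<close> by simp
  ultimately have "3 / real m < real n * e" "real n * e < real p / real m"
    using n1 e by linarith+
  then have "(1 - 1 / real m) * (real n * e) \<le> x (real n * e)" by (rule above)
  then show "window_inf (-1) (1 - 1 / real m) 0 (real j / real m) (1 / real m) x \<le> 0"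
    using n1 e by (intro window_inf_le_0I[of "real n * e"]) auto
qed

text \<open>For large \<open>m\<close> the marked cell must lie near \<open>\<phi>\<close>. It
  cannot be much later, since \<open>x2\<close> is strictly below the identity on an interval soon
  after \<open>\<phi>\<close> and \<open>windows_above\<close> fails there. It cannot be much
  earlier, since there \<open>x2\<close> exceeds the identity by a factor \<open>u > 1\<close>. If
  the conclusion failed, continuity of both paths at \<open>\<phi>\<close> would contradict the
  conditions of the cell.\<close>

lemma passage_event_limit:
  assumes x2: "cadlag x2" and "0 < \<phi>" "0 < \<eta>"
    and below: "\<And>\<gamma>. 0 < \<gamma> \<Longrightarrow> \<exists>s. \<phi> \<le> s \<and> s < \<phi> + \<gamma> \<and> x2 s < s"
    and above: "\<And>\<gamma>. 0 < \<gamma> \<Longrightarrow> \<exists>u>1. \<forall>t. 0 < t \<longrightarrow> t < \<phi> - \<gamma> \<longrightarrow> u * t \<le> x2 t"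
    and cont: "isCont x1 \<phi>" "isCont x2 \<phi>" "x2 \<phi> = \<phi>"
    and inf: "\<exists>\<^sub>\<infinity>m. passage_event \<eta> \<sigma> y m x1 x2"
  shows "\<sigma> * x1 \<phi> \<le> y * \<phi>"
proof (rule ccontr)
  assume "\<not> \<sigma> * x1 \<phi> \<le> y * \<phi>"
  \<comment> \<open>Half of the smaller margin by which the two alternatives of the cell fail at
    \<open>\<phi>\<close>; the second margin is \<open>\<eta> * \<phi>\<close> because
    \<open>x2 \<phi> = \<phi>\<close>.\<close>
  define e where "e = min (\<sigma> * x1 \<phi> - y * \<phi>) (\<eta> * \<phi>) / 2"
  have e_le: "2 * e \<le> \<sigma> * x1 \<phi> - y * \<phi>" "2 * e \<le> \<eta> * \<phi>" by (auto simp: e_def)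
  have "e > 0" using \<open>\<not> _\<close> \<open>0 < \<phi>\<close> \<open>0 < \<eta>\<close> by (auto simp: e_def)
  have "isCont (\<lambda>t. \<sigma> * x1 t - y * t) \<phi>" "isCont (\<lambda>t. x2 t - (1 - \<eta>) * t) \<phi>"
    by (intro continuous_intros cont)+
  then have "((\<lambda>t. \<sigma> * x1 t - y * t) \<longlongrightarrow> \<sigma> * x1 \<phi> - y * \<phi>) (nhds \<phi>)"
      "((\<lambda>t. x2 t - (1 - \<eta>) * t) \<longlongrightarrow> x2 \<phi> - (1 - \<eta>) * \<phi>) (nhds \<phi>)"
    using tendsto_at_iff_tendsto_nhds[of "\<lambda>t. \<sigma> * x1 t - y * t" \<phi>]
      tendsto_at_iff_tendsto_nhds[of "\<lambda>t. x2 t - (1 - \<eta>) * t" \<phi>] by (simp_all add: isCont_def)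
  moreover have "e < \<sigma> * x1 \<phi> - y * \<phi>" "e < x2 \<phi> - (1 - \<eta>) * \<phi>"
    using \<open>e > 0\<close> cont(3) e_le by (auto simp: algebra_simps)
  ultimately have "\<forall>\<^sub>F t in nhds \<phi>. e < \<sigma> * x1 t - y * t \<and> e < x2 t - (1 - \<eta>) * t"
    by (intro eventually_conj) (blast dest: order_tendstoD(1))+
  then obtain \<rho> where \<rho>: "\<rho> > 0" "\<And>t. \<bar>t - \<phi>\<bar> < \<rho> \<Longrightarrow> e < \<sigma> * x1 t - y * t"
      "\<And>t. \<bar>t - \<phi>\<bar> < \<rho> \<Longrightarrow> e < x2 t - (1 - \<eta>) * t"
    unfolding eventually_nhds_metric dist_real_def by blast
  obtain s where s: "\<phi> \<le> s" "s < \<phi> + \<rho> / 4" "x2 s < s" using below[of "\<rho> / 4"] \<rho>(1) by auto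
  define e2 where "e2 = (s - x2 s) / 2"
  have "e2 > 0" using s by (simp add: e2_def)
  \<comment> \<open>Right continuity spreads the strict crossing at \<open>s\<close> to an interval,
    which contains a whole window once \<open>m\<close> is large.\<close>
  have "((\<lambda>t. x2 t - t) \<longlongrightarrow> x2 s - s) (at_right s)"
    by (intro tendsto_intros cadlag_tendsto_right x2) (use s \<open>0 < \<phi>\<close> in auto)
  then have "\<forall>\<^sub>F t in at_right s. x2 t - t < - e2"
    by (rule order_tendstoD(2)) (use \<open>e2 > 0\<close> in \<open>simp add: e2_def field_simps\<close>)
  then obtain d0 where d0: "d0 > 0" "\<And>t. s < t \<Longrightarrow> t < s + d0 \<Longrightarrow> x2 t - t < - e2"
    using eventually_at_right_Ioo by blast
  define d where "d = min d0 (\<rho> / 4)"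
  have d: "d > 0" "s + d < \<phi> + \<rho> / 2" "\<And>t. s < t \<Longrightarrow> t < s + d \<Longrightarrow> x2 t - t < - e2"
    using d0 \<rho>(1) s unfolding d_def by auto
  obtain u where u: "u > 1" "\<And>t. 0 < t \<Longrightarrow> t < \<phi> - \<rho> / 2 \<Longrightarrow> u * t \<le> x2 t"
    using above[of "\<rho> / 2"] \<rho>(1) by auto
  have small: "\<forall>\<^sub>F m in sequentially. c / real m < b" if "0 < b" for b c :: real
    by (rule order_tendstoD(2)[OF lim_const_over_n that])
  have large: "\<forall>\<^sub>F m in sequentially. b < real m" for b :: real
    using filterlim_at_top_dense filterlim_real_sequentially by blast
  have "\<forall>\<^sub>F m in sequentially. 8 / real m < \<rho> \<and> 8 / real m < d \<and> 5 / real m < \<phi> \<and>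
      (\<phi> + \<rho> + 1) / real m < e2 \<and> 2 / real m < u - 1 \<and> \<phi> + \<rho> < real m \<and> 1 < real m"
    by (intro eventually_conj small large) (use \<rho> d \<open>0 < \<phi>\<close> \<open>e2 > 0\<close> u in auto)
  then obtain m where m: "passage_event \<eta> \<sigma> y m x1 x2" "8 / real m < \<rho>" "8 / real m < d" "5 / real m < \<phi>"
      "(\<phi> + \<rho> + 1) / real m < e2" "2 / real m < u - 1" "\<phi> + \<rho> < real m" "1 < real m"
    using inf frequently_eventually_conj[of _ sequentially] unfolding cofinite_eq_sequentially
    by (smt (verit, best) frequently_ex)
  define w where "w = 1 / real m"
  have w: "0 < w" "w \<le> 1" "8 * w < \<rho>" "8 * w < d" "5 * w < \<phi>" "(\<phi> + \<rho> + 1) * w < e2" "2 * w < u - 1"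
    using m by (auto simp: w_def)
  have upper: "real p * w < s + d" if p: "windows_above m p x2" for p
  proof (rule ccontr)
    assume "\<not> real p * w < s + d"
    \<comment> \<open>The window with this centre, even when enlarged by \<open>w\<close>, lies
      inside \<open>(s, s + d)\<close>, where \<open>x2\<close> is below the identity by
      \<open>e2\<close>.\<close>
    define j where "j = nat \<lceil>(s + d / 2) / w\<rceil>"
    have pos: "0 \<le> (s + d / 2) / w" using s d w \<open>0 < \<phi>\<close> by simp
    have j: "(s + d / 2) / w \<le> real j" "real j < (s + d / 2) / w + 1"
      using pos unfolding j_def by linarith+
    then have j1: "s + d / 2 \<le> real j * w" "real j * w < s + d / 2 + w"
      using w(1) by (simp_all add: field_simps)
    have "real j * w < real p * w" using j1 \<open>\<not> real p * w < s + d\<close> w by linarith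
    then have "j < p" using w(1) by simp
    moreover have "5 * w < real j * w" using j1 w s d by linarith
    then have "5 \<le> j" using w(1) by simp
    ultimately have "window_inf (-1) (1 - w) 0 (real j * w) w x2 \<le> 0"
      using p by (auto simp: windows_above_def w_def)
    from window_inf_le_0D[OF this w(1)] obtain t where t: "\<bar>t - real j * w\<bar> < w + w" "-1 * x2 t + (1 - w) * t + 0 < w"
      by blast
    have t1: "s < t" "t < s + d" using t(1) j1 w by linarith+
    \<comment> \<open>The slope defect \<open>w\<close> costs at most
      \<open>(\<phi> + \<rho>) * w\<close> and the tolerance of \<open>window_inf_le_0D\<close>
      another \<open>w\<close>; together they stay below \<open>e2\<close>.\<close>
    have "t * w \<le> (\<phi> + \<rho>) * w" using t1 d w \<rho> by (intro mult_right_mono) auto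
    then have "t - e2 \<le> x2 t" using t(2) w by (simp add: algebra_simps)
    then show False using d(3)[OF t1] by simp
  qed
  have "\<not> windows_above m (m * m) x2"
  proof
    assume "windows_above m (m * m) x2"
    from upper[OF this] have "real m < s + d" using m(8) by (simp add: w_def)
    then show False using m(7) d \<rho> by linarith
  qed
  then obtain p where p: "3 \<le> p" "windows_above m p x2" "cell_event \<eta> \<sigma> y m p x1 x2"
    using m(1) unfolding passage_event_def by auto
  have cell: "window_inf 1 (- (1 + w)) 0 (real p * w) w x2 \<le> 0"
      "window_inf 1 (- (1 - \<eta>)) 0 (real p * w) w x2 \<le> 0 \<or> window_inf \<sigma> (- y) 0 (real p * w) w x1 \<le> 0"
    using p(3) by (auto simp: cell_event_def w_def)
  \<comment> \<open>Tolerance \<open>w * w\<close> instead of \<open>w\<close>: once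
    \<open>w < t\<close> is known, it is at most \<open>w * t\<close> and can be absorbed into the
    slope.\<close>
  have "0 < w * w" using w by simp
  from window_inf_le_0D[OF cell(1) this] obtain t
    where t: "\<bar>t - real p * w\<bar> < w + w * w" "1 * x2 t + - (1 + w) * t + 0 < w * w" by blast
  have ww: "w * w \<le> w" using w by (simp add: mult_left_le)
  have "3 * w \<le> real p * w" using p(1) w by (intro mult_right_mono) auto
  then have tw: "w < t" using t(1) ww by linarith
  have "x2 t < u * t"
  proof -
    have "w * w \<le> w * t" using tw w by (intro mult_left_mono) auto
    then have "x2 t < (1 + 2 * w) * t" using t(2) by (simp add: algebra_simps)
    also have "\<dots> \<le> u * t" using w tw by (intro mult_right_mono) auto
    finally show ?thesis .
  qed
  then have "\<phi> - \<rho> / 2 \<le> t" using u(2)[of t] tw w by fastforce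
  moreover have "real p * w < \<phi> + \<rho> / 2" using upper[OF p(2)] d by simp
  ultimately have near: "\<bar>t' - \<phi>\<bar> < \<rho>" if "\<bar>t' - real p * w\<bar> < w + min e w" for t'
    using that t(1) ww w by linarith
  have "0 < min e w" using \<open>0 < e\<close> w by simp
  from cell(2) show False
  proof
    assume "window_inf 1 (- (1 - \<eta>)) 0 (real p * w) w x2 \<le> 0"
    from window_inf_le_0D[OF this \<open>0 < min e w\<close>] obtain t'
      where t': "\<bar>t' - real p * w\<bar> < w + min e w" "1 * x2 t' + - (1 - \<eta>) * t' + 0 < min e w" by blast
    then show False using \<rho>(3)[OF near[OF t'(1)]] by (simp add: algebra_simps)
  next
    assume "window_inf \<sigma> (- y) 0 (real p * w) w x1 \<le> 0"
    from window_inf_le_0D[OF this \<open>0 < min e w\<close>] obtain t'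
      where t': "\<bar>t' - real p * w\<bar> < w + min e w" "\<sigma> * x1 t' + - y * t' + 0 < min e w" by blast
    then show False using \<rho>(2)[OF near[OF t'(1)]] by (simp add: algebra_simps)
  qed
qed

section \<open>The limit process at its first passage time\<close>

lemma isCont_if_no_jump:
  assumes "cadlag x" "0 < t" "left_limit x t = x t"
  shows "isCont x t"
  using cadlag_tendsto_left_limit[OF assms(1,2)] cadlag_tendsto_right[of x t] assms
  unfolding isCont_def by (simp add: filterlim_split_at)

lemma cadlag_sqrt:
  assumes "cadlag x" shows "cadlag (\<lambda>t. sqrt (x t))"
  using assms unfolding cadlag_def by (blast intro: tendsto_real_sqrt)

lemma cadlag_process_sqrt:
  assumes "cadlag_process M X" shows "cadlag_process M (\<lambda>\<omega> t. sqrt (X \<omega> t))"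
  using assms cadlag_sqrt unfolding cadlag_process_def by (auto intro!: borel_measurable_sqrt)

text \<open>\<open>T\<close> is approximated from the right by \<open>(D + 1) / (n + 1)\<close>,
  which takes countably many values; adding 1 makes the approximation strictly larger than
  \<open>T\<close>, as the filter \<open>at_right\<close> requires.\<close>

lemma cadlag_process_at_random_time:
  assumes X: "cadlag_process M X" and T [measurable]: "T \<in> borel_measurable M"
    and pos: "\<And>\<omega>. \<omega> \<in> space M \<Longrightarrow> 0 \<le> T \<omega>"
  shows "(\<lambda>\<omega>. X \<omega> (T \<omega>)) \<in> borel_measurable M"
proof (rule borel_measurable_LIMSEQ_real)
  define D where "D n \<omega> = nat \<lfloor>real (Suc n) * T \<omega>\<rfloor>" for n \<omega>
  show "(\<lambda>\<omega>. X \<omega> ((real (D n \<omega>) + 1) / real (Suc n))) \<in> borel_measurable M" for n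
  proof (rule measurable_compose_countable[where f = "\<lambda>k \<omega>. X \<omega> ((real k + 1) / real (Suc n))"])
    show "(\<lambda>\<omega>. X \<omega> ((real k + 1) / real (Suc n))) \<in> borel_measurable M" for k :: nat
      by (rule cadlag_process_measurable[OF X]) simp
    show "D n \<in> M \<rightarrow>\<^sub>M count_space UNIV" unfolding D_def by measurable
  qed
  show "(\<lambda>n. X \<omega> ((real (D n \<omega>) + 1) / real (Suc n))) \<longlonglongrightarrow> X \<omega> (T \<omega>)" if \<omega>: "\<omega> \<in> space M" for \<omega>
  proof (rule filterlim_compose[OF cadlag_tendsto_right[OF cadlag_process_cadlag[OF X \<omega>] pos[OF \<omega>]]])
    define a where "a n = (real (D n \<omega>) + 1) / real (Suc n)" for n
    have a: "T \<omega> < a n" "a n \<le> T \<omega> + 1 / real (Suc n)" for n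
    proof -
      have "0 \<le> real (Suc n) * T \<omega>" using pos[OF \<omega>] by simp
      then have "real (D n \<omega>) \<le> real (Suc n) * T \<omega>" "real (Suc n) * T \<omega> < real (D n \<omega>) + 1"
        unfolding D_def by linarith+
      then show "T \<omega> < a n" "a n \<le> T \<omega> + 1 / real (Suc n)"
        unfolding a_def by (simp_all add: pos_less_divide_eq pos_divide_le_eq distrib_left mult.commute del: of_nat_Suc)
    qed
    have "a \<longlonglongrightarrow> T \<omega>"
    proof (rule tendsto_sandwich[OF _ _ tendsto_const])
      have "(\<lambda>n. T \<omega> + 1 / real (Suc n)) \<longlonglongrightarrow> T \<omega> + 0"
        by (intro tendsto_add tendsto_const LIMSEQ_Suc[OF lim_const_over_n])
      then show "(\<lambda>n. T \<omega> + 1 / real (Suc n)) \<longlonglongrightarrow> T \<omega>" by simp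
    qed (use a in \<open>auto intro!: always_eventually less_imp_le\<close>)
    then have "filterlim a (at_right (T \<omega>)) sequentially"
      by (rule tendsto_imp_filterlim_at_right) (use a in simp)
    then show "filterlim (\<lambda>n. (real (D n \<omega>) + 1) / real (Suc n)) (at_right (T \<omega>)) sequentially"
      unfolding a_def[abs_def] .
  qed
qed

lemma joint_path_measurable:
  assumes "\<And>t. 0 \<le> t \<Longrightarrow> (\<lambda>\<omega>. X1 \<omega> t) \<in> borel_measurable M" "\<And>t. 0 \<le> t \<Longrightarrow> (\<lambda>\<omega>. X2 \<omega> t) \<in> borel_measurable M"
  shows "joint_path X1 X2 \<in> M \<rightarrow>\<^sub>M path_space"
  unfolding joint_path_def path_space_def
  by (intro measurable_restrict borel_measurable_Pair) (use assms in auto)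

section \<open>Deterministic properties of first passage times\<close>

lemma first_passage_less_iff:
  "first_passage y u < ereal t \<longleftrightarrow> (\<exists>s. 0 < s \<and> s < t \<and> sqrt (y s) / s < u)"
  unfolding first_passage_def by (auto simp: INF_less_iff)

text \<open>Strict inequality and right continuity move a witness to a rational time that is still
  before \<open>t\<close>. Hence this event depends on countably many coordinates, all at times
  before \<open>t\<close>.\<close>

lemma first_passage_less_iff_rational:
  assumes y: "cadlag y"
  shows "first_passage y u < ereal t \<longleftrightarrow> (\<exists>s\<in>\<rat>. 0 < s \<and> s < t \<and> sqrt (y s) / s < u)"
proof
  assume "first_passage y u < ereal t"
  then obtain s where s: "0 < s" "s < t" "sqrt (y s) / s < u" by (auto simp: first_passage_less_iff)
  have "((\<lambda>s. sqrt (y s) / s) \<longlongrightarrow> sqrt (y s) / s) (at_right s)"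
    by (intro tendsto_intros cadlag_tendsto_right y) (use s in auto)
  then have "\<forall>\<^sub>F s in at_right s. sqrt (y s) / s < u" by (rule order_tendstoD(2)) (rule s)
  then obtain d where d: "d > 0" "\<And>s'. s < s' \<Longrightarrow> s' < s + d \<Longrightarrow> sqrt (y s') / s' < u"
    using eventually_at_right_Ioo by blast
  obtain s' where "s' \<in> \<rat>" "s < s'" "s' < min t (s + d)"
    using Rats_dense_in_real[of s "min t (s + d)"] d s by auto
  then show "\<exists>s\<in>\<rat>. 0 < s \<and> s < t \<and> sqrt (y s) / s < u"
    using d s by (intro bexI[of _ s']) auto
qed (auto simp: first_passage_less_iff)

lemma first_passage_nonneg: "0 \<le> first_passage y u"
  unfolding first_passage_def by (intro INF_greatest) auto

lemma first_passage_antimono: "u \<le> v \<Longrightarrow> first_passage y v \<le> first_passage y u"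
  unfolding first_passage_def by (intro INF_superset_mono) auto

lemma first_passage_ge:
  assumes "ereal \<phi> \<le> first_passage y u" "0 < s" "s < \<phi>"
  shows "u * s \<le> sqrt (y s)"
proof (rule ccontr)
  assume "\<not> u * s \<le> sqrt (y s)"
  then have "sqrt (y s) / s < u" using assms by (simp add: field_simps)
  then have "first_passage y u < ereal \<phi>" using assms by (auto simp: first_passage_less_iff)
  then show False using assms(1) by simp
qed

lemma first_passage_approx:
  assumes "first_passage y u = ereal \<phi>" "0 < \<gamma>"
  shows "\<exists>s. \<phi> \<le> s \<and> 0 < s \<and> s < \<phi> + \<gamma> \<and> sqrt (y s) < u * s"
proof -
  have "first_passage y u < ereal (\<phi> + \<gamma>)" using assms by simp
  then obtain s where s: "0 < s" "s < \<phi> + \<gamma>" "sqrt (y s) / s < u" by (auto simp: first_passage_less_iff)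
  then have "sqrt (y s) < u * s" by (simp add: field_simps)
  moreover have "\<phi> \<le> s"
    using first_passage_ge[of \<phi> y u s] assms(1) s(1) \<open>sqrt (y s) < u * s\<close> by force
  ultimately show ?thesis using s by blast
qed

text \<open>Before \<open>\<phi>\<close> the path is on or above the line, hence so is its left
  limit; points below the line at or soon after \<open>\<phi>\<close> and right continuity put the
  value at \<open>\<phi>\<close> on or below it. Without a negative jump all these values
  coincide.\<close>

lemma first_passage_value:
  assumes y: "cadlag y" and jumps: "left_limit y \<phi> \<le> y \<phi>"
    and \<phi>: "first_passage y u = ereal \<phi>" "0 < \<phi>"
  shows "sqrt (y \<phi>) = u * \<phi>" "left_limit y \<phi> = y \<phi>"
proof -
  have le: "u * \<phi> \<le> sqrt (left_limit y \<phi>)"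
  proof (rule tendsto_le)
    show "((\<lambda>s. u * s) \<longlongrightarrow> u * \<phi>) (at_left \<phi>)" by (intro tendsto_intros)
    show "((\<lambda>s. sqrt (y s)) \<longlongrightarrow> sqrt (left_limit y \<phi>)) (at_left \<phi>)"
      by (intro tendsto_intros cadlag_tendsto_left_limit y \<phi>)
    show "\<forall>\<^sub>F s in at_left \<phi>. u * s \<le> sqrt (y s)"
      using eventually_at_left_real[OF \<phi>(2)]
      by eventually_elim (rule first_passage_ge[of \<phi>], use \<phi> in auto)
  qed simp
  have ge: "sqrt (y \<phi>) \<le> u * \<phi>"
  proof (rule ccontr)
    assume *: "\<not> sqrt (y \<phi>) \<le> u * \<phi>"
    have "((\<lambda>s. sqrt (y s) - u * s) \<longlongrightarrow> sqrt (y \<phi>) - u * \<phi>) (at_right \<phi>)"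
      by (intro tendsto_intros cadlag_tendsto_right y) (use \<phi> in auto)
    then have "\<forall>\<^sub>F s in at_right \<phi>. 0 < sqrt (y s) - u * s"
      by (rule order_tendstoD(1)) (use * in simp)
    then obtain d where d: "d > 0" "\<And>s. \<phi> < s \<Longrightarrow> s < \<phi> + d \<Longrightarrow> 0 < sqrt (y s) - u * s"
      using eventually_at_right_Ioo by blast
    obtain s where s: "\<phi> \<le> s" "s < \<phi> + d" "sqrt (y s) < u * s"
      using first_passage_approx[OF \<phi>(1) d(1)] by blast
    then show False using d(2)[of s] * by (cases "s = \<phi>") auto
  qed
  have "sqrt (left_limit y \<phi>) \<le> sqrt (y \<phi>)" using jumps by simp
  then have "sqrt (left_limit y \<phi>) = sqrt (y \<phi>)" using le ge by linarith
  then show "left_limit y \<phi> = y \<phi>" by (simp add: real_sqrt_eq_iff)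
  show "sqrt (y \<phi>) = u * \<phi>" using le ge \<open>sqrt (left_limit y \<phi>) = sqrt (y \<phi>)\<close> by linarith
qed

locale limit_process = prob_space N
  for N :: "'b measure" +
  fixes Y1 Y2 :: "'b process" and h :: real
  assumes Y1: "cadlag_process N Y1" and Y2: "cadlag_process N Y2"
    and h: "0 < h" "h < 1"
    and self_similar: "\<And>a. 0 < a \<Longrightarrow> joint_law N (\<lambda>\<omega> t. Y1 \<omega> (a * t)) (\<lambda>\<omega> t. Y2 \<omega> (a * t)) =
      joint_law N (\<lambda>\<omega> t. a powr h * Y1 \<omega> t) (\<lambda>\<omega> t. a powr (2 * h) * Y2 \<omega> t)"
    and qlc: "quasi_left_continuous N (usual_augmentation N Y1 Y2) Y1"
    and Y2_pos: "AE \<omega> in N. \<forall>t>0. 0 < Y2 \<omega> t \<and> left_limit (Y2 \<omega>) t \<le> Y2 \<omega> t"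
    and passage_pos: "AE \<omega> in N. 0 < first_passage (Y2 \<omega>) 1"
    and passage_cont: "AE \<omega> in N. isCont (first_passage (Y2 \<omega>)) 1"
begin

section \<open>Measurability and finiteness of the passage times of the limit process\<close>

definition passage :: "real \<Rightarrow> 'b \<Rightarrow> real" where
  "passage u \<omega> = real_of_ereal (first_passage (Y2 \<omega>) u)"

lemma passage_nonneg: "0 \<le> passage u \<omega>"
  unfolding passage_def by (simp add: real_of_ereal_pos first_passage_nonneg)

text \<open>The sigma-algebra \<open>L\<close> is left open: this serves both the measurability of
  the passage time and its stopping property for the augmented filtration.\<close>

lemma first_passage_less_sets:
  assumes L: "space L = space N" "\<And>s. 0 < s \<Longrightarrow> s < t \<Longrightarrow> (\<lambda>\<omega>. Y2 \<omega> s) \<in> borel_measurable L"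
  shows "{\<omega> \<in> space N. first_passage (Y2 \<omega>) u < ereal t} \<in> sets L"
proof -
  have "{\<omega> \<in> space L. sqrt (Y2 \<omega> s) / s < u} \<in> sets L" if "s \<in> \<rat> \<inter> {0<..<t}" for s
  proof -
    have [measurable]: "(\<lambda>\<omega>. Y2 \<omega> s) \<in> borel_measurable L" using L(2)[of s] that by auto
    show ?thesis by measurable
  qed
  then have "(\<Union>s\<in>\<rat> \<inter> {0<..<t}. {\<omega> \<in> space L. sqrt (Y2 \<omega> s) / s < u}) \<in> sets L"
    by (intro sets.countable_UN') (auto intro: countable_Int1 countable_rat)
  also have "(\<Union>s\<in>\<rat> \<inter> {0<..<t}. {\<omega> \<in> space L. sqrt (Y2 \<omega> s) / s < u}) = {\<omega> \<in> space N. first_passage (Y2 \<omega>) u < ereal t}"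
    using cadlag_process_cadlag[OF Y2] L(1) by (fastforce simp: first_passage_less_iff_rational)
  finally show ?thesis .
qed

lemma first_passage_measurable [measurable]:
  "(\<lambda>\<omega>. first_passage (Y2 \<omega>) u) \<in> borel_measurable N"
proof (rule borel_measurableI_less)
  fix t :: ereal
  show "{\<omega> \<in> space N. first_passage (Y2 \<omega>) u < t} \<in> sets N"
  proof (cases t)
    case (real r)
    then show ?thesis using first_passage_less_sets[of N r u] cadlag_process_measurable[OF Y2] by simp
  next
    case PInf
    have "{\<omega> \<in> space N. first_passage (Y2 \<omega>) u < t} = (\<Union>n. {\<omega> \<in> space N. first_passage (Y2 \<omega>) u < ereal (real n)})"
      using PInf by (auto simp: less_PInf_Ex_of_nat intro: less_trans)
    also have "\<dots> \<in> sets N"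
      using first_passage_less_sets[of N _ u] cadlag_process_measurable[OF Y2] by (intro sets.countable_UN) auto
    finally show ?thesis .
  qed simp
qed

lemma passage_measurable [measurable]: "passage u \<in> borel_measurable N"
  unfolding passage_def[abs_def] by measurable

lemma prob_Y2_scaling:
  assumes "0 < a"
  shows "prob {\<omega> \<in> space N. c \<le> Y2 \<omega> a} = prob {\<omega> \<in> space N. c \<le> a powr (2 * h) * Y2 \<omega> 1}"
proof -
  define S where "S = {p \<in> space path_space. c \<le> snd (p (1::real))}"
  have "(\<lambda>p. p 1) \<in> path_space \<rightarrow>\<^sub>M (borel :: (real \<times> real) measure)"
    unfolding path_space_def by (rule measurable_component_singleton) simp
  then have "(\<lambda>p. snd (p 1)) \<in> borel_measurable path_space"
    by (rule measurable_compose) (simp add: borel_prod[symmetric])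
  then have S: "S \<in> sets path_space" unfolding S_def by measurable
  have m1: "joint_path (\<lambda>\<omega> t. Y1 \<omega> (a * t)) (\<lambda>\<omega> t. Y2 \<omega> (a * t)) \<in> N \<rightarrow>\<^sub>M path_space"
    using assms by (intro joint_path_measurable cadlag_process_measurable Y1 Y2) auto
  have m2: "joint_path (\<lambda>\<omega> t. a powr h * Y1 \<omega> t) (\<lambda>\<omega> t. a powr (2 * h) * Y2 \<omega> t) \<in> N \<rightarrow>\<^sub>M path_space"
    by (intro joint_path_measurable borel_measurable_times borel_measurable_const cadlag_process_measurable Y1 Y2) auto
  have "measure (joint_law N (\<lambda>\<omega> t. Y1 \<omega> (a * t)) (\<lambda>\<omega> t. Y2 \<omega> (a * t))) S =
      prob {\<omega> \<in> space N. c \<le> Y2 \<omega> a}"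
    unfolding joint_law_def using measurable_space[OF m1]
    by (subst measure_distr[OF m1 S]) (auto intro!: arg_cong[where f = prob] simp: S_def joint_path_def)
  moreover have "measure (joint_law N (\<lambda>\<omega> t. a powr h * Y1 \<omega> t) (\<lambda>\<omega> t. a powr (2 * h) * Y2 \<omega> t)) S =
      prob {\<omega> \<in> space N. c \<le> a powr (2 * h) * Y2 \<omega> 1}"
    unfolding joint_law_def using measurable_space[OF m2]
    by (subst measure_distr[OF m2 S]) (auto intro!: arg_cong[where f = prob] simp: S_def joint_path_def)
  ultimately show ?thesis using self_similar[OF assms] by simp
qed

text \<open>An infinite passage time forces \<open>Y2\<close> at time \<open>a\<close> to be at
  least \<open>a^2\<close> for every \<open>a\<close>. By self-similarity this has the probability
  that \<open>Y2\<close> at time 1 is at least \<open>a powr (2 - 2 * h)\<close>, which vanishes as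
  \<open>a\<close> grows because \<open>h < 1\<close>.\<close>

lemma passage_finite: "AE \<omega> in N. first_passage (Y2 \<omega>) 1 < \<infinity>"
proof -
  have [measurable]: "(\<lambda>\<omega>. Y2 \<omega> t) \<in> borel_measurable N" if "0 \<le> t" for t
    by (rule cadlag_process_measurable[OF Y2 that])
  define S where "S n = {\<omega> \<in> space N. real (Suc n) powr (2 - 2 * h) \<le> Y2 \<omega> 1}" for n
  have "prob {\<omega> \<in> space N. first_passage (Y2 \<omega>) 1 = \<infinity>} \<le> prob (S n)" for n
  proof -
    define a where "a = real (Suc n)"
    have a: "0 < a" by (simp add: a_def)
    have "prob {\<omega> \<in> space N. first_passage (Y2 \<omega>) 1 = \<infinity>} \<le> prob {\<omega> \<in> space N. a\<^sup>2 \<le> Y2 \<omega> a}"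
    proof (rule finite_measure_mono)
      show "{\<omega> \<in> space N. first_passage (Y2 \<omega>) 1 = \<infinity>} \<subseteq> {\<omega> \<in> space N. a\<^sup>2 \<le> Y2 \<omega> a}"
      proof safe
        fix \<omega> assume "first_passage (Y2 \<omega>) 1 = \<infinity>"
        then have "1 * a \<le> sqrt (Y2 \<omega> a)" using a by (intro first_passage_ge[of "a + 1"]) auto
        then show "a\<^sup>2 \<le> Y2 \<omega> a" using a sqrt_ge_absD[of a "Y2 \<omega> a"] by linarith
      qed
      have [measurable]: "(\<lambda>\<omega>. Y2 \<omega> a) \<in> borel_measurable N"
        using a by (intro cadlag_process_measurable[OF Y2]) simp
      show "{\<omega> \<in> space N. a\<^sup>2 \<le> Y2 \<omega> a} \<in> events" by measurable
    qed
    also have "\<dots> = prob {\<omega> \<in> space N. a\<^sup>2 \<le> a powr (2 * h) * Y2 \<omega> 1}" by (rule prob_Y2_scaling[OF a])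
    also have "{\<omega> \<in> space N. a\<^sup>2 \<le> a powr (2 * h) * Y2 \<omega> 1} = S n"
    proof -
      have "a\<^sup>2 = a powr (2 * h) * a powr (2 - 2 * h)" using a by (simp add: powr_add[symmetric] powr_numeral)
      then show ?thesis using a by (auto simp: S_def a_def)
    qed
    finally show ?thesis .
  qed
  moreover have "(\<lambda>n. prob (S n)) \<longlonglongrightarrow> prob (\<Inter>n. S n)"
  proof (rule finite_Lim_measure_decseq)
    show "decseq S"
    proof (intro decseq_SucI subsetI)
      fix n \<omega> assume "\<omega> \<in> S (Suc n)"
      moreover have "real (Suc n) powr (2 - 2 * h) \<le> real (Suc (Suc n)) powr (2 - 2 * h)"
        using h by (intro powr_mono2) auto
      ultimately show "\<omega> \<in> S n" unfolding S_def by (auto simp del: of_nat_Suc)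
    qed
    show "range S \<subseteq> events" unfolding S_def by auto
  qed
  moreover have "(\<Inter>n. S n) = {}"
  proof -
    have "\<exists>n. \<omega> \<notin> S n" for \<omega>
    proof -
      have "filterlim (\<lambda>n. real (Suc n) powr (2 - 2 * h)) at_top sequentially"
        using h by real_asymp
      then have "\<forall>\<^sub>F n in sequentially. Y2 \<omega> 1 < real (Suc n) powr (2 - 2 * h)"
        by (simp add: filterlim_at_top_dense)
      then obtain n where "Y2 \<omega> 1 < real (Suc n) powr (2 - 2 * h)" using eventually_happens by fastforce
      then show ?thesis by (intro exI[of _ n]) (auto simp: S_def)
    qed
    then show ?thesis by blast
  qed
  ultimately have "prob {\<omega> \<in> space N. first_passage (Y2 \<omega>) 1 = \<infinity>} \<le> 0"
    by (intro LIMSEQ_le_const[of "\<lambda>n. prob (S n)" 0]) auto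
  then have "prob {\<omega> \<in> space N. first_passage (Y2 \<omega>) 1 = \<infinity>} = 0" by (simp add: measure_le_0_iff)
  then have "AE \<omega> in N. first_passage (Y2 \<omega>) 1 \<noteq> \<infinity>" by (subst (asm) prob_eq_0) auto
  then show ?thesis by eventually_elim auto
qed

end

context limit_process
begin

lemma passage_eq:
  assumes "first_passage (Y2 \<omega>) u < \<infinity>"
  shows "first_passage (Y2 \<omega>) u = ereal (passage u \<omega>)"
  using assms first_passage_nonneg[of "Y2 \<omega>" u] unfolding passage_def
  by (cases "first_passage (Y2 \<omega>) u") auto

definition regular :: "'b \<Rightarrow> bool" where
  "regular \<omega> \<longleftrightarrow> \<omega> \<in> space N \<and> first_passage (Y2 \<omega>) 1 < \<infinity> \<and> 0 < first_passage (Y2 \<omega>) 1 \<and>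
     isCont (first_passage (Y2 \<omega>)) 1 \<and> (\<forall>t>0. 0 < Y2 \<omega> t \<and> left_limit (Y2 \<omega>) t \<le> Y2 \<omega> t)"

lemma AE_regular: "AE \<omega> in N. regular \<omega>"
  using AE_space passage_finite passage_pos passage_cont Y2_pos
  by eventually_elim (simp add: regular_def)

context
  fixes \<omega> assumes reg: "regular \<omega>"
begin

lemma regular_passage_eq: "1 \<le> u \<Longrightarrow> first_passage (Y2 \<omega>) u = ereal (passage u \<omega>)"
  using reg first_passage_antimono[of 1 u "Y2 \<omega>"] by (intro passage_eq) (auto simp: regular_def)

lemma regular_passage_pos: "0 < passage 1 \<omega>"
  using reg regular_passage_eq[of 1] by (simp add: regular_def)

lemma regular_cadlag: "cadlag (Y2 \<omega>)"
  using reg cadlag_process_cadlag[OF Y2] by (simp add: regular_def)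

lemma regular_jumps: "0 < t \<Longrightarrow> left_limit (Y2 \<omega>) t \<le> Y2 \<omega> t"
  using reg by (simp add: regular_def)

lemma regular_value: "sqrt (Y2 \<omega> (passage 1 \<omega>)) = passage 1 \<omega>"
  using first_passage_value(1)[OF regular_cadlag regular_jumps regular_passage_eq regular_passage_pos]
    regular_passage_pos by simp

lemma regular_isCont: "isCont (\<lambda>t. sqrt (Y2 \<omega> t)) (passage 1 \<omega>)"
proof -
  have "left_limit (Y2 \<omega>) (passage 1 \<omega>) = Y2 \<omega> (passage 1 \<omega>)"
    using first_passage_value(2)[OF regular_cadlag regular_jumps regular_passage_eq regular_passage_pos]
      regular_passage_pos by simp
  then have "isCont (Y2 \<omega>) (passage 1 \<omega>)"
    by (rule isCont_if_no_jump[OF regular_cadlag regular_passage_pos])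
  then show ?thesis by (intro continuous_intros)
qed

lemma regular_passage_antimono: "1 \<le> u \<Longrightarrow> u \<le> v \<Longrightarrow> passage v \<omega> \<le> passage u \<omega>"
  using first_passage_antimono[of u v "Y2 \<omega>"] by (simp add: regular_passage_eq)

text \<open>At a positive passage time the path lies exactly on its line, so two levels cannot share
  one. This strictness keeps the announcing times before the announced one.\<close>

lemma regular_passage_less: "1 < u \<Longrightarrow> passage u \<omega> < passage 1 \<omega>"
proof (rule ccontr)
  assume u: "1 < u" "\<not> passage u \<omega> < passage 1 \<omega>"
  then have "passage u \<omega> = passage 1 \<omega>" using regular_passage_antimono[of 1 u] by simp
  then have "first_passage (Y2 \<omega>) u = ereal (passage 1 \<omega>)" using regular_passage_eq[of u] u by simp
  from first_passage_value(1)[OF regular_cadlag regular_jumps[OF regular_passage_pos] this regular_passage_pos]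
  show False using regular_value regular_passage_pos u by simp
qed

lemma regular_passage_tendsto: "((\<lambda>u. passage u \<omega>) \<longlongrightarrow> passage 1 \<omega>) (at_right 1)"
proof -
  have "(first_passage (Y2 \<omega>) \<longlongrightarrow> first_passage (Y2 \<omega>) 1) (at_right 1)"
    using reg unfolding regular_def isCont_def by (blast intro: filterlim_mono at_le)
  then have "(first_passage (Y2 \<omega>) \<longlongrightarrow> ereal (passage 1 \<omega>)) (at_right 1)"
    by (simp add: regular_passage_eq)
  then have "((\<lambda>u. ereal (passage u \<omega>)) \<longlongrightarrow> ereal (passage 1 \<omega>)) (at_right 1)"
    by (rule filterlim_cong[THEN iffD1, rotated 3])
      (auto simp: eventually_at_filter regular_passage_eq intro!: always_eventually)
  then show ?thesis by simp
qed

lemma regular_passage_seq: "(\<lambda>k. passage (1 + 1 / real (Suc k)) \<omega>) \<longlonglongrightarrow> passage 1 \<omega>"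
proof (rule filterlim_compose[OF regular_passage_tendsto])
  have "(\<lambda>k. 1 + 1 / real (Suc k)) \<longlonglongrightarrow> 1 + 0"
    by (intro tendsto_add tendsto_const LIMSEQ_Suc[OF lim_const_over_n])
  then show "filterlim (\<lambda>k. 1 + 1 / real (Suc k)) (at_right 1) sequentially"
    by (intro tendsto_imp_filterlim_at_right) auto
qed

lemma regular_below:
  assumes "0 < \<gamma>"
  shows "\<exists>s. passage 1 \<omega> \<le> s \<and> s < passage 1 \<omega> + \<gamma> \<and> sqrt (Y2 \<omega> s) < s"
  using first_passage_approx[OF regular_passage_eq[of 1] assms] by auto

text \<open>Continuity in the level enters here: some level \<open>u > 1\<close> is passed only
  after \<open>passage 1 \<omega> - \<gamma>\<close>, and until then the path stays above the
  steeper line.\<close>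

lemma regular_above:
  assumes "0 < \<gamma>"
  shows "\<exists>u>1. \<forall>t. 0 < t \<longrightarrow> t < passage 1 \<omega> - \<gamma> \<longrightarrow> u * t \<le> sqrt (Y2 \<omega> t)"
proof -
  have "\<forall>\<^sub>F k in sequentially. passage 1 \<omega> - \<gamma> < passage (1 + 1 / real (Suc k)) \<omega>"
    by (rule order_tendstoD(1)[OF regular_passage_seq]) (use assms in simp)
  then obtain k where k: "passage 1 \<omega> - \<gamma> < passage (1 + 1 / real (Suc k)) \<omega>"
    by (auto simp: eventually_sequentially)
  define u where "u = 1 + 1 / real (Suc k)"
  have "1 < u" by (simp add: u_def)
  moreover have "u * t \<le> sqrt (Y2 \<omega> t)" if "0 < t" "t < passage 1 \<omega> - \<gamma>" for t
    using that k \<open>1 < u\<close> by (intro first_passage_ge[of "passage u \<omega>"]) (auto simp: regular_passage_eq u_def)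
  ultimately show ?thesis by blast
qed

end

text \<open>The event is an intersection of events that the passage precedes \<open>v n\<close>,
  with \<open>v n\<close> decreasing to \<open>t\<close>. For each \<open>s > t\<close> the sequence
  is chosen below \<open>s\<close>, so all of them are visible by time \<open>s\<close>; this is
  what the right-continuous filtration asks for.\<close>

lemma passage_stopping_time:
  assumes "1 \<le> u"
  shows "stopping_time (usual_augmentation N Y1 Y2) (passage u)"
proof
  fix t :: real
  define gens where "gens s = natural_generators N Y1 Y2 s \<union> null_sets (completion N)" for s
  have sub: "gens s \<subseteq> Pow (space N)" for s
    using sets.sets_into_space[of _ "completion N"]
    by (auto simp: gens_def natural_generators_def null_sets_def)
  have "(\<Inter>s\<in>{t<..}. sigma_sets (space N) (gens s)) \<subseteq> Pow (space N)"
    by (rule order_trans[OF INF_lower[of "t + 1"]]) (auto dest: sigma_sets_into_sp[OF sub])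
  moreover have "{\<omega> \<in> space N. passage u \<omega> \<le> t} \<in> sigma_sets (space N) (gens s)" if "t < s" for s
  proof (cases "t < 0")
    case True
    then have "{\<omega> \<in> space N. passage u \<omega> \<le> t} = {}" using passage_nonneg[of u] by (auto simp: not_le intro: less_le_trans)
    then show ?thesis by (simp only: sigma_sets.Empty)
  next
    case False
    define L where "L = sigma (space N) (gens s)"
    have L: "space L = space N" "sets L = sigma_sets (space N) (gens s)"
      unfolding L_def using sub by (auto simp: space_measure_of sets_measure_of)
    have Y2_meas: "(\<lambda>\<omega>. Y2 \<omega> v) \<in> borel_measurable L" if "0 < v" "v \<le> s" for v
    proof (rule measurableI)
      fix B :: "real set" assume "B \<in> sets borel"
      then have "(\<lambda>\<omega>. Y2 \<omega> v) -` B \<inter> space N \<in> gens s"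
        using that unfolding gens_def natural_generators_def by (intro UnI1 UN_I[of v] UnI2) auto
      then show "(\<lambda>\<omega>. Y2 \<omega> v) -` B \<inter> space L \<in> sets L" using L by (simp add: sigma_sets.Basic)
    qed simp
    define v where "v n = t + (s - t) / real (Suc n)" for n
    have v: "t < v n" "v n \<le> s" for n
      using \<open>t < s\<close> divide_left_mono[of 1 "real (Suc n)" "s - t"] by (auto simp: v_def)
    have "{\<omega> \<in> space N. first_passage (Y2 \<omega>) u < ereal (v n)} \<in> sets L" for n
      using v[of n] Y2_meas by (intro first_passage_less_sets L) auto
    then have "(\<Inter>n. {\<omega> \<in> space N. first_passage (Y2 \<omega>) u < ereal (v n)}) \<in> sets L"
      by (intro sets.countable_INT) auto
    \<comment> \<open>An infinite passage is turned into 0 by \<open>real_of_ereal\<close>, so these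
      outcomes count as passed by time \<open>t\<close>; they form a null set and hence belong to
      the augmentation.\<close>
    moreover have "{\<omega> \<in> space N. first_passage (Y2 \<omega>) u = \<infinity>} \<in> sets L"
    proof -
      have "AE \<omega> in N. first_passage (Y2 \<omega>) u \<noteq> \<infinity>"
        using AE_regular by eventually_elim (simp add: regular_passage_eq assms)
      then have "{\<omega> \<in> space N. first_passage (Y2 \<omega>) u = \<infinity>} \<in> null_sets N"
        by (subst (asm) AE_iff_null) auto
      then have "{\<omega> \<in> space N. first_passage (Y2 \<omega>) u = \<infinity>} \<in> gens s"
        by (simp add: gens_def null_sets_completionI)
      then show ?thesis using L by (simp add: sigma_sets.Basic)
    qed
    moreover have "{\<omega> \<in> space N. passage u \<omega> \<le> t} =
        (\<Inter>n. {\<omega> \<in> space N. first_passage (Y2 \<omega>) u < ereal (v n)}) \<union> {\<omega> \<in> space N. first_passage (Y2 \<omega>) u = \<infinity>}"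
    proof -
      have "passage u \<omega> \<le> t \<longleftrightarrow> (\<forall>n. first_passage (Y2 \<omega>) u < ereal (v n)) \<or> first_passage (Y2 \<omega>) u = \<infinity>" for \<omega>
      proof (cases "first_passage (Y2 \<omega>) u = \<infinity>")
        case True
        then show ?thesis using False by (simp add: passage_def)
      next
        case fin: False
        then have eq: "first_passage (Y2 \<omega>) u = ereal (passage u \<omega>)" by (intro passage_eq) simp
        have "v \<longlonglongrightarrow> t + 0"
          unfolding v_def by (intro tendsto_add tendsto_const LIMSEQ_Suc[OF lim_const_over_n])
        then have "passage u \<omega> \<le> t" if "\<forall>n. passage u \<omega> < v n"
          using that by (intro LIMSEQ_le_const[of v t]) (auto intro: less_imp_le)
        then show ?thesis using v(1) fin by (auto simp: eq intro: le_less_trans)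
      qed
      then show ?thesis by auto
    qed
    ultimately have "{\<omega> \<in> space N. passage u \<omega> \<le> t} \<in> sets L" by (simp only: sets.Un)
    then show ?thesis by (simp only: L)
  qed
  ultimately have "{\<omega> \<in> space N. passage u \<omega> \<le> t} \<in> sets (usual_augmentation N Y1 Y2 t)"
    "space (usual_augmentation N Y1 Y2 t) = space N"
    unfolding usual_augmentation_def gens_def[symmetric]
    by (auto simp: sets_measure_of space_measure_of_conv intro!: sigma_sets.Basic)
  then show "Measurable.pred (usual_augmentation N Y1 Y2 t) (\<lambda>\<omega>. passage u \<omega> \<le> t)"
    by (simp add: pred_def)
qed

lemma AE_isCont_Y1: "AE \<omega> in N. isCont (Y1 \<omega>) (passage 1 \<omega>)"
proof -
  have "finite_predictable_time N (usual_augmentation N Y1 Y2) (passage 1)"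
    unfolding finite_predictable_time_def
  proof (intro conjI exI[of _ "\<lambda>k. passage (1 + 1 / real (Suc k))"] allI ballI)
    show "AE \<omega> in N. incseq (\<lambda>k. passage (1 + 1 / real (Suc k)) \<omega>) \<and>
        (\<lambda>k. passage (1 + 1 / real (Suc k)) \<omega>) \<longlonglongrightarrow> passage 1 \<omega> \<and>
        (0 < passage 1 \<omega> \<longrightarrow> (\<forall>k. passage (1 + 1 / real (Suc k)) \<omega> < passage 1 \<omega>))"
      using AE_regular
    proof eventually_elim
      case (elim \<omega>)
      have "incseq (\<lambda>k. passage (1 + 1 / real (Suc k)) \<omega>)"
        unfolding incseq_Suc_iff
        by (intro allI regular_passage_antimono[OF elim]) (auto simp: field_simps)
      then show ?case using regular_passage_seq[OF elim] regular_passage_less[OF elim] by simp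
    qed
  qed (rule passage_stopping_time passage_nonneg, simp?)+
  then have "AE \<omega> in N. Y1 \<omega> (passage 1 \<omega>) - left_limit (Y1 \<omega>) (passage 1 \<omega>) = 0"
    using qlc unfolding quasi_left_continuous_def by blast
  then show ?thesis
    using AE_regular
  proof eventually_elim
    case (elim \<omega>)
    then show ?case
      using regular_passage_pos[OF elim(2)] cadlag_process_cadlag[OF Y1, of \<omega>]
      by (intro isCont_if_no_jump) (auto simp: regular_def)
  qed
qed

lemma Y1_passage_measurable [measurable]: "(\<lambda>\<omega>. Y1 \<omega> (passage 1 \<omega>)) \<in> borel_measurable N"
  by (rule cadlag_process_at_random_time[OF Y1 passage_measurable passage_nonneg])

lemma AE_passage_event_limit:
  assumes "0 < \<eta>"
  shows "AE \<omega> in N. (\<exists>\<^sub>\<infinity>m. passage_event \<eta> \<sigma> y m (Y1 \<omega>) (\<lambda>t. sqrt (Y2 \<omega> t))) \<longrightarrow>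
    \<sigma> * Y1 \<omega> (passage 1 \<omega>) \<le> y * passage 1 \<omega>"
  using AE_regular AE_isCont_Y1
proof eventually_elim
  case (elim \<omega>)
  show ?case
  proof
    assume inf: "\<exists>\<^sub>\<infinity>m. passage_event \<eta> \<sigma> y m (Y1 \<omega>) (\<lambda>t. sqrt (Y2 \<omega> t))"
    show "\<sigma> * Y1 \<omega> (passage 1 \<omega>) \<le> y * passage 1 \<omega>"
      by (rule passage_event_limit[OF cadlag_sqrt[OF regular_cadlag[OF elim(1)]] regular_passage_pos[OF elim(1)] assms
        regular_below[OF elim(1)] regular_above[OF elim(1)] elim(2) regular_isCont[OF elim(1)] regular_value[OF elim(1)] inf])
  qed
qed

lemma AE_limit_statistic: "AE \<omega> in N. limit_statistic Y1 Y2 \<omega> * passage 1 \<omega> = Y1 \<omega> (passage 1 \<omega>)"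
  using AE_regular
proof eventually_elim
  case (elim \<omega>)
  then show ?case
    using regular_value[OF elim] regular_passage_pos[OF elim]
    by (simp add: limit_statistic_def Let_def passage_def)
qed

lemma limit_statistic_measurable [measurable]: "limit_statistic Y1 Y2 \<in> borel_measurable N"
proof -
  have [measurable]: "(\<lambda>\<omega>. Y2 \<omega> (passage 1 \<omega>)) \<in> borel_measurable N"
    by (rule cadlag_process_at_random_time[OF Y2 passage_measurable passage_nonneg])
  have "(\<lambda>\<omega>. Y1 \<omega> (passage 1 \<omega>) / sqrt (Y2 \<omega> (passage 1 \<omega>))) \<in> borel_measurable N" by measurable
  then show ?thesis by (simp add: limit_statistic_def[abs_def] Let_def passage_def)
qed

end

section \<open>The scaled processes\<close>

lemma window_inf_less_0D:
  assumes "\<not> 0 \<le> window_inf a b c q w x"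
  obtains t where "0 \<le> t" "\<bar>t - q\<bar> < w" "a * x t + b * t + c < 0"
proof -
  have "window_inf a b c q w x < 0" using assms by simp
  then obtain t where "0 \<le> t" "min 1 (max (a * x t + b * t + c) (\<bar>t - q\<bar> - w)) < 0"
    unfolding window_inf_def by (subst (asm) cINF_less_iff) (auto simp: window_inf_bdd_below)
  then show ?thesis by (intro that[of t]) (auto simp: min_less_iff_disj)
qed

section \<open>Growth bounds from a doubling inequality\<close>

lemma doubling_growth:
  fixes l :: "real \<Rightarrow> real"
  assumes "0 < x0" "1 \<le> D" "0 \<le> K"
    and double: "\<And>x. x0 \<le> x \<Longrightarrow> l (2 * x) \<le> D * l x"
    and base: "\<And>x. x0 \<le> x \<Longrightarrow> x \<le> 2 * x0 \<Longrightarrow> l x \<le> K"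
  shows "2 ^ k * x0 \<le> x \<Longrightarrow> x \<le> 2 ^ Suc k * x0 \<Longrightarrow> l x \<le> K * D ^ k"
proof (induction k arbitrary: x)
  case 0
  then show ?case using base by simp
next
  case (Suc k)
  have "x0 \<le> 2 ^ k * x0" using \<open>0 < x0\<close> by simp
  then have "l (2 * (x / 2)) \<le> D * l (x / 2)" using Suc.prems by (intro double) simp
  also have "\<dots> \<le> D * (K * D ^ k)" using Suc.prems assms(2) by (intro mult_left_mono Suc.IH) auto
  finally show ?case by (simp add: mult_ac)
qed

text \<open>A bound of Potter type: counting the dyadic blocks between \<open>x0\<close> and
  \<open>x\<close> converts the factor \<open>2 powr d\<close> per doubling into the power
  \<open>d\<close> of \<open>x / x0\<close>.\<close>

lemma doubling_growth_powr:
  fixes l :: "real \<Rightarrow> real"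
  assumes "0 < x0" "0 < d" "0 \<le> K"
    and double: "\<And>x. x0 \<le> x \<Longrightarrow> l (2 * x) \<le> 2 powr d * l x"
    and base: "\<And>x. x0 \<le> x \<Longrightarrow> x \<le> 2 * x0 \<Longrightarrow> l x \<le> K"
    and x: "x0 \<le> x"
  shows "l x \<le> K * (x / x0) powr d"
proof -
  define k where "k = nat \<lfloor>log 2 (x / x0)\<rfloor>"
  have q: "1 \<le> x / x0" using assms by simp
  have "0 \<le> log 2 (x / x0)" using q by (subst zero_le_log_cancel_iff) auto
  then have k: "real k \<le> log 2 (x / x0)" "log 2 (x / x0) < real k + 1"
    unfolding k_def by linarith+
  have p: "2 powr real k \<le> x / x0" "x / x0 \<le> 2 powr (real k + 1)"
    using k q le_log_iff[of 2 "x / x0" "real k"] log_le_iff[of 2 "x / x0" "real k + 1"] by auto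
  have "2 ^ k * x0 \<le> x" "x \<le> 2 ^ Suc k * x0"
    using p \<open>0 < x0\<close> by (simp_all add: powr_realpow powr_add field_simps)
  then have "l x \<le> K * (2 powr d) ^ k"
    using doubling_growth[of x0 "2 powr d" K l k x] assms by (simp add: ge_one_powr_ge_zero)
  also have "(2 powr d) ^ k = (2 powr real k) powr d"
    by (simp add: powr_powr powr_realpow[symmetric] mult.commute)
  also have "K * \<dots> \<le> K * (x / x0) powr d" using p assms by (intro mult_left_mono powr_mono2) auto
  finally show ?thesis .
qed

lemma cadlag_time_change:
  assumes x: "cadlag x" and e: "0 < e"
  shows "cadlag (\<lambda>t. x (t / e))"
  unfolding cadlag_def
proof (intro conjI allI impI)
  fix t :: real assume t: "0 \<le> t"
  have lim: "filterlim (\<lambda>s. s / e) (at_right (t / e)) (at_right t)"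
    unfolding filterlim_at
    by (intro conjI tendsto_intros)
      (use e in \<open>auto simp: eventually_at_filter divide_strict_right_mono intro!: always_eventually\<close>)
  have "0 \<le> t / e" using t e by simp
  from filterlim_compose[OF cadlag_tendsto_right[OF x this] lim]
  show "((\<lambda>t. x (t / e)) \<longlongrightarrow> x (t / e)) (at_right t)" .
next
  fix t :: real assume t: "0 < t"
  have lim: "filterlim (\<lambda>s. s / e) (at_left (t / e)) (at_left t)"
    unfolding filterlim_at
    by (intro conjI tendsto_intros)
      (use e in \<open>auto simp: eventually_at_filter divide_strict_right_mono intro!: always_eventually\<close>)
  have "0 < t / e" using t e by simp
  from filterlim_compose[OF cadlag_tendsto_left_limit[OF x this] lim]
  show "\<exists>l. ((\<lambda>t. x (t / e)) \<longlongrightarrow> l) (at_left t)" by (rule exI)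
qed

lemma cadlag_affine:
  assumes "cadlag x" shows "cadlag (\<lambda>t. a * (x t - t / e * b))"
  unfolding cadlag_def
proof (intro conjI allI impI)
  fix t :: real assume t: "0 < t"
  have "((\<lambda>t. a * (x t - t / e * b)) \<longlongrightarrow> a * (left_limit x t - t / e * b)) (at_left t)"
    unfolding divide_inverse by (intro tendsto_intros cadlag_tendsto_left_limit assms t)
  then show "\<exists>l. ((\<lambda>t. a * (x t - t / e * b)) \<longlongrightarrow> l) (at_left t)" ..
next
  fix t :: real assume t: "0 \<le> t"
  show "((\<lambda>t. a * (x t - t / e * b)) \<longlongrightarrow> a * (x t - t / e * b)) (at_right t)"
    unfolding divide_inverse by (intro tendsto_intros cadlag_tendsto_right assms t)
qed

lemma eventually_pos: "\<forall>\<^sub>F e :: real in at_right 0. 0 < e"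
  by (simp add: eventually_at_filter)

lemma not_frequently_large:
  assumes "\<And>m. m0 < m \<Longrightarrow> \<not> P m"
  shows "\<not> (\<exists>\<^sub>\<infinity>m::nat. P m)"
  using assms unfolding INFM_nat by blast

locale sequential_limit = limit_process N Y1 Y2 h + M: prob_space M
  for N :: "'b measure" and Y1 Y2 :: "'b process" and h :: real and M :: "'a measure" +
  fixes Z1 Z2 :: "'a process" and \<mu> \<nu> :: real and l A_inv :: "real \<Rightarrow> real"
  assumes Z1: "cadlag_process M Z1" and Z2: "cadlag_process M Z2" and Z2_nonneg: "nonneg_process M Z2"
    and slow: "slowly_varying l"
    and weak: "WM2_weak_tendsto
       M (\<lambda>\<epsilon> \<omega>. (\<lambda>t. \<epsilon> powr h * l (1 / \<epsilon>) * (Z1 \<omega> (t / \<epsilon>) - t / \<epsilon> * \<mu>),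
                  \<lambda>t. \<epsilon> powr h * l (1 / \<epsilon>) * sqrt (Z2 \<omega> (t / \<epsilon>))))
       N (\<lambda>\<omega>. (Y1 \<omega>, \<lambda>t. sqrt (Y2 \<omega> t))) (at_right 0)"
    and A_inv: "asymptotic_inverse (\<lambda>x. x powr (1 - h) * l x) A_inv"
    and nu: "0 < \<nu>" "\<nu> < 1 / (1 - h)"
    and no_early: "no_early_stopping M Z2 \<nu> (\<lambda>\<epsilon>. A_inv (1 / \<epsilon>))"
begin

section \<open>Scaled paths and their tightness\<close>

definition V1 :: "real \<Rightarrow> 'a process" where
  "V1 e \<omega> = (\<lambda>t. e powr h * l (1 / e) * (Z1 \<omega> (t / e) - t / e * \<mu>))"

definition V2 :: "real \<Rightarrow> 'a process" where
  "V2 e \<omega> = (\<lambda>t. e powr h * l (1 / e) * sqrt (Z2 \<omega> (t / e)))"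

text \<open>\<open>A(1/e)\<close> in the notation of the paper.\<close>

definition B :: "real \<Rightarrow> real" where
  "B e = e powr (h - 1) * l (1 / e)"

lemma powr_h_eq: "0 < e \<Longrightarrow> e powr h * l (1 / e) = B e * e"
  by (simp add: B_def powr_diff)

lemma V1_grid: "0 < e \<Longrightarrow> V1 e \<omega> (real n * e) = B e * e * (Z1 \<omega> (real n) - real n * \<mu>)"
  by (simp add: V1_def powr_h_eq)

lemma V2_grid: "0 < e \<Longrightarrow> V2 e \<omega> (real n * e) = B e * e * sqrt (Z2 \<omega> (real n))"
  by (simp add: V2_def powr_h_eq)

lemma V1_cadlag:
  assumes e: "0 < e" shows "cadlag_process M (V1 e)"
proof -
  have "cadlag (V1 e \<omega>)" if "\<omega> \<in> space M" for \<omega>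
    unfolding V1_def by (rule cadlag_affine[OF cadlag_time_change[OF cadlag_process_cadlag[OF Z1 that] e]])
  moreover have "(\<lambda>\<omega>. V1 e \<omega> t) \<in> borel_measurable M" if "0 \<le> t" for t
    unfolding V1_def using e that
    by (intro borel_measurable_times borel_measurable_diff borel_measurable_const cadlag_process_measurable[OF Z1]) auto
  ultimately show ?thesis by (simp add: cadlag_process_def)
qed

lemma V2_cadlag:
  assumes e: "0 < e" shows "cadlag_process M (V2 e)"
proof -
  have "cadlag (V2 e \<omega>)" if "\<omega> \<in> space M" for \<omega>
    using cadlag_affine[OF cadlag_sqrt[OF cadlag_time_change[OF cadlag_process_cadlag[OF Z2 that] e]],
      where b = 0] unfolding V2_def by simp
  moreover have "(\<lambda>\<omega>. V2 e \<omega> t) \<in> borel_measurable M" if "0 \<le> t" for t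
    unfolding V2_def using e that
    by (intro borel_measurable_times borel_measurable_const cadlag_process_measurable[OF cadlag_process_sqrt[OF Z2]]) auto
  ultimately show ?thesis by (simp add: cadlag_process_def)
qed

lemma weak_V: "WM2_weak_tendsto M (\<lambda>e \<omega>. (V1 e \<omega>, V2 e \<omega>)) N (\<lambda>\<omega>. (Y1 \<omega>, \<lambda>t. sqrt (Y2 \<omega> t))) (at_right 0)"
  using weak unfolding V1_def V2_def .

lemma limsup_V:
  fixes P :: "nat \<Rightarrow> path \<Rightarrow> path \<Rightarrow> bool"
  assumes P: "\<And>m. M2_closed M N (P m)"
    and Q: "AE \<omega> in N. (\<exists>\<^sub>\<infinity>m. P m (Y1 \<omega>) (\<lambda>t. sqrt (Y2 \<omega> t))) \<longrightarrow> Q \<omega>" "{\<omega> \<in> space N. Q \<omega>} \<in> sets N"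
    and "0 < \<gamma>"
  shows "\<exists>m0. \<forall>m\<ge>m0. \<forall>\<^sub>F e in at_right 0.
    whp M (measure N {\<omega> \<in> space N. Q \<omega>} + \<gamma>) (\<lambda>\<omega>. \<not> P m (V1 e \<omega>) (V2 e \<omega>))"
proof -
  have ev: "\<forall>\<^sub>F e in at_right 0. cadlag_process M (V1 e) \<and> cadlag_process M (V2 e)"
    using eventually_pos by eventually_elim (simp add: V1_cadlag V2_cadlag)
  obtain m0 where m0: "\<forall>m\<ge>m0. \<forall>\<^sub>F e in at_right 0. measure M {\<omega> \<in> space M. P m (V1 e \<omega>) (V2 e \<omega>)}
      \<le> measure N {\<omega> \<in> space N. Q \<omega>} + \<gamma>"
    using weak_limsup[where P = P and Q = Q, OF P M.prob_space_axioms prob_space_axioms weak_V ev Y1 cadlag_process_sqrt[OF Y2] Q \<open>0 < \<gamma>\<close>]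
    by (rule exE)
  have "\<forall>\<^sub>F e in at_right 0. whp M (measure N {\<omega> \<in> space N. Q \<omega>} + \<gamma>) (\<lambda>\<omega>. \<not> P m (V1 e \<omega>) (V2 e \<omega>))"
    if "m \<ge> m0" for m
    using m0[rule_format, OF that] ev
  proof eventually_elim
    case (elim e)
    have "{\<omega> \<in> space M. P m (V1 e \<omega>) (V2 e \<omega>)} \<in> sets M"
      by (rule M2_closed_measurable[OF M2_closed_sym[OF P]]) (use elim(2) in simp_all)
    from whpI[OF this elim(1)] show ?case .
  qed
  then show ?thesis by (intro exI allI impI)
qed

lemma limsup_V_null:
  fixes P :: "nat \<Rightarrow> path \<Rightarrow> path \<Rightarrow> bool"
  assumes P: "\<And>m. M2_closed M N (P m)"
    and Q: "AE \<omega> in N. \<not> (\<exists>\<^sub>\<infinity>m. P m (Y1 \<omega>) (\<lambda>t. sqrt (Y2 \<omega> t)))" and "0 < \<gamma>"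
  shows "\<exists>m0. \<forall>m\<ge>m0. \<forall>\<^sub>F e in at_right 0. whp M \<gamma> (\<lambda>\<omega>. \<not> P m (V1 e \<omega>) (V2 e \<omega>))"
proof -
  have "AE \<omega> in N. (\<exists>\<^sub>\<infinity>m. P m (Y1 \<omega>) (\<lambda>t. sqrt (Y2 \<omega> t))) \<longrightarrow> False" using Q by simp
  from limsup_V[where P = P and Q = "\<lambda>_. False", OF P this _ \<open>0 < \<gamma>\<close>] show ?thesis by simp
qed

text \<open>Reaching height \<open>m\<close> in the window is a closed condition, and a cadlag limit
  path, being bounded there, meets it for only finitely many \<open>m\<close>. This gives tightness
  over a whole window and not only at single times.\<close>

lemma V2_tight:
  assumes "0 < \<gamma>"
  shows "\<exists>m0. \<forall>m\<ge>m0. \<forall>\<^sub>F e in at_right 0. whp M \<gamma> (\<lambda>\<omega>. \<forall>t\<ge>0. \<bar>t - q\<bar> \<le> w \<longrightarrow> V2 e \<omega> t < real m)"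
proof -
  have "AE \<omega> in N. \<not> (\<exists>\<^sub>\<infinity>m. window_inf (-1) 0 (real m) q w (\<lambda>t. sqrt (Y2 \<omega> t)) \<le> 0)"
    using AE_space
  proof eventually_elim
    case (elim \<omega>)
    obtain C where C: "\<And>t. 0 \<le> t \<Longrightarrow> t \<le> q + w + 1 \<Longrightarrow> \<bar>sqrt (Y2 \<omega> t)\<bar> \<le> C"
      using cadlag_bounded[OF cadlag_sqrt[OF cadlag_process_cadlag[OF Y2 elim]]] by blast
    show ?case
    proof (rule not_frequently_large[of "nat \<lceil>C + 1\<rceil>"], rule notI)
      fix m assume m: "nat \<lceil>C + 1\<rceil> < m" and le: "window_inf (-1) 0 (real m) q w (\<lambda>t. sqrt (Y2 \<omega> t)) \<le> 0"
      obtain t where t: "0 \<le> t" "\<bar>t - q\<bar> < w + 1" "-1 * sqrt (Y2 \<omega> t) + 0 * t + real m < 1"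
        using window_inf_le_0D[OF le, of 1] by auto
      have "C + 1 < real m" using m by linarith
      moreover have "\<bar>sqrt (Y2 \<omega> t)\<bar> \<le> C" using t by (intro C) auto
      ultimately show False using t(3) by linarith
    qed
  qed
  from limsup_V_null[OF M2_closed_window(2) this assms] obtain m0
    where m0: "\<And>m. m \<ge> m0 \<Longrightarrow> \<forall>\<^sub>F e in at_right 0. whp M \<gamma> (\<lambda>\<omega>. \<not> window_inf (-1) 0 (real m) q w (V2 e \<omega>) \<le> 0)"
    by blast
  have "\<forall>\<^sub>F e in at_right 0. whp M \<gamma> (\<lambda>\<omega>. \<forall>t\<ge>0. \<bar>t - q\<bar> \<le> w \<longrightarrow> V2 e \<omega> t < real m)" if "m \<ge> m0" for m
    using m0[OF that]
  proof eventually_elim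
    case (elim e)
    show ?case
    proof (rule whp_mono[OF elim order_refl], intro allI impI)
      fix \<omega> t assume "\<not> window_inf (-1) 0 (real m) q w (V2 e \<omega>) \<le> 0" "0 \<le> t" "\<bar>t - q\<bar> \<le> w"
      then show "V2 e \<omega> t < real m"
        using window_inf_le_0I[of t q w "-1" "V2 e \<omega>" 0 "real m"] by linarith
    qed
  qed
  then show ?thesis by blast
qed

lemma V1_tight:
  assumes "0 < \<gamma>"
  shows "\<exists>m0. \<forall>m\<ge>m0. \<forall>\<^sub>F e in at_right 0. whp M \<gamma> (\<lambda>\<omega>. \<forall>t\<ge>0. \<bar>t - q\<bar> \<le> w \<longrightarrow> \<bar>V1 e \<omega> t\<bar> < real m)"
proof -
  have "AE \<omega> in N. \<not> (\<exists>\<^sub>\<infinity>m. window_inf (-1) 0 (real m) q w (Y1 \<omega>) \<le> 0 \<or> window_inf 1 0 (real m) q w (Y1 \<omega>) \<le> 0)"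
    using AE_space
  proof eventually_elim
    case (elim \<omega>)
    obtain C where C: "\<And>t. 0 \<le> t \<Longrightarrow> t \<le> q + w + 1 \<Longrightarrow> \<bar>Y1 \<omega> t\<bar> \<le> C"
      using cadlag_bounded[OF cadlag_process_cadlag[OF Y1 elim]] by blast
    show ?case
    proof (rule not_frequently_large[of "nat \<lceil>C + 1\<rceil>"], rule notI)
      fix m assume m: "nat \<lceil>C + 1\<rceil> < m"
        and le: "window_inf (-1) 0 (real m) q w (Y1 \<omega>) \<le> 0 \<or> window_inf 1 0 (real m) q w (Y1 \<omega>) \<le> 0"
      then obtain t where t: "0 \<le> t" "\<bar>t - q\<bar> < w + 1" "-1 * Y1 \<omega> t + 0 * t + real m < 1 \<or> 1 * Y1 \<omega> t + 0 * t + real m < 1"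
      proof (elim disjE)
        assume "window_inf (-1) 0 (real m) q w (Y1 \<omega>) \<le> 0"
        then show ?thesis by (rule window_inf_le_0D[of _ _ _ _ _ _ 1]) (auto intro: that)
      next
        assume "window_inf 1 0 (real m) q w (Y1 \<omega>) \<le> 0"
        then show ?thesis by (rule window_inf_le_0D[of _ _ _ _ _ _ 1]) (auto intro: that)
      qed
      have "C + 1 < real m" using m by linarith
      moreover have "\<bar>Y1 \<omega> t\<bar> \<le> C" using t by (intro C) auto
      ultimately show False using t(3) by linarith
    qed
  qed
  from limsup_V_null[OF M2_closed_disj[OF M2_closed_window(1) M2_closed_window(1)] this assms] obtain m0
    where m0: "\<And>m. m \<ge> m0 \<Longrightarrow> \<forall>\<^sub>F e in at_right 0. whp M \<gamma>
      (\<lambda>\<omega>. \<not> (window_inf (-1) 0 (real m) q w (V1 e \<omega>) \<le> 0 \<or> window_inf 1 0 (real m) q w (V1 e \<omega>) \<le> 0))"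
    by blast
  have "\<forall>\<^sub>F e in at_right 0. whp M \<gamma> (\<lambda>\<omega>. \<forall>t\<ge>0. \<bar>t - q\<bar> \<le> w \<longrightarrow> \<bar>V1 e \<omega> t\<bar> < real m)" if "m \<ge> m0" for m
    using m0[OF that]
  proof eventually_elim
    case (elim e)
    show ?case
    proof (rule whp_mono[OF elim order_refl], intro allI impI)
      fix \<omega> t assume "\<not> (window_inf (-1) 0 (real m) q w (V1 e \<omega>) \<le> 0 \<or> window_inf 1 0 (real m) q w (V1 e \<omega>) \<le> 0)"
        "0 \<le> t" "\<bar>t - q\<bar> \<le> w"
      then show "\<bar>V1 e \<omega> t\<bar> < real m"
        using window_inf_le_0I[of t q w "-1" "V1 e \<omega>" 0 "real m"] window_inf_le_0I[of t q w 1 "V1 e \<omega>" 0 "real m"]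
        by linarith
    qed
  qed
  then show ?thesis by blast
qed

text \<open>The complement, staying at or below \<open>1/m\<close> on the open window
  \<open>(2, 4)\<close>, is the closed condition that the infimum functional is nonnegative. For
  large \<open>m\<close> it contradicts the positivity of \<open>Y2\<close> at time 3.\<close>

lemma V2_not_small:
  assumes "0 < \<gamma>"
  shows "\<exists>m0. \<forall>m\<ge>m0. \<forall>\<^sub>F e in at_right 0. whp M \<gamma> (\<lambda>\<omega>. \<exists>t. 2 < t \<and> t < 4 \<and> 1 / real m < V2 e \<omega> t)"
proof -
  have "AE \<omega> in N. \<not> (\<exists>\<^sub>\<infinity>m. 0 \<le> window_inf (-1) 0 (1 / real m) 3 1 (\<lambda>t. sqrt (Y2 \<omega> t)))"
    using Y2_pos
  proof eventually_elim
    case (elim \<omega>)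
    define u where "u = sqrt (Y2 \<omega> 3)"
    have "0 < u" using elim by (simp add: u_def)
    show ?case
    proof (rule not_frequently_large[of "nat \<lceil>1 / u\<rceil>"], rule notI)
      fix m assume m: "nat \<lceil>1 / u\<rceil> < m" and le: "0 \<le> window_inf (-1) 0 (1 / real m) 3 1 (\<lambda>t. sqrt (Y2 \<omega> t))"
      have "1 / u < real m" using m by linarith
      then have "1 / real m < u" using \<open>0 < u\<close> m by (simp add: field_simps)
      moreover have "0 \<le> min 1 (max (-1 * u + 0 * 3 + 1 / real m) (\<bar>3 - 3 :: real\<bar> - 1))"
        unfolding u_def by (rule order_trans[OF le window_inf_lower]) simp
      ultimately show False by (simp add: le_max_iff_disj)
    qed
  qed
  from limsup_V_null[OF M2_closed_window(3) this assms] obtain m0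
    where m0: "\<And>m. m \<ge> m0 \<Longrightarrow> \<forall>\<^sub>F e in at_right 0. whp M \<gamma> (\<lambda>\<omega>. \<not> 0 \<le> window_inf (-1) 0 (1 / real m) 3 1 (V2 e \<omega>))"
    by blast
  have "\<forall>\<^sub>F e in at_right 0. whp M \<gamma> (\<lambda>\<omega>. \<exists>t. 2 < t \<and> t < 4 \<and> 1 / real m < V2 e \<omega> t)" if "m \<ge> m0" for m
    using m0[OF that]
  proof eventually_elim
    case (elim e)
    show ?case
    proof (rule whp_mono[OF elim order_refl])
      fix \<omega> assume "\<not> 0 \<le> window_inf (-1) 0 (1 / real m) 3 1 (V2 e \<omega>)"
      then obtain t where "\<bar>t - 3\<bar> < 1" "-1 * V2 e \<omega> t + 0 * t + 1 / real m < 0"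
        by (rule window_inf_less_0D)
      then show "\<exists>t. 2 < t \<and> t < 4 \<and> 1 / real m < V2 e \<omega> t" by (intro exI[of _ t]) auto
    qed
  qed
  then show ?thesis by blast
qed

end

section \<open>Growth of the scaling function\<close>

text \<open>Positive probability yields an outcome. In this way bounds in probability for the
  processes give deterministic bounds for \<open>l\<close>.\<close>

lemma (in prob_space) whp_exists:
  assumes "whp M \<gamma> P" "\<gamma> < 1"
  obtains \<omega> where "\<omega> \<in> space M" "P \<omega>"
proof -
  obtain B where B: "B \<in> sets M" "prob B \<le> \<gamma>" "\<forall>\<omega>\<in>space M - B. P \<omega>"
    using assms(1) unfolding whp_def by blast
  have "space M - B \<noteq> {}"
  proof
    assume "space M - B = {}"
    then have "prob (space M) \<le> prob B" by (intro finite_measure_mono B) auto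
    then show False using B(2) assms(2) by (simp add: prob_space)
  qed
  then show ?thesis using B(3) that by blast
qed

lemma eventually_at_right_0_inverse:
  assumes "\<forall>\<^sub>F e in at_right 0. P e"
  shows "\<forall>\<^sub>F x in at_top. P (1 / x :: real)"
proof -
  have "filterlim (\<lambda>x::real. 1 / x) (at_right 0) at_top"
    by real_asymp
  with assms show ?thesis by (rule eventually_compose_filterlim)
qed

context sequential_limit
begin

lemma eventually_l_pos: "\<forall>\<^sub>F x in at_top. 0 < l x"
  using slow by (simp add: slowly_varying_def)

lemma l_ratio: "0 < a \<Longrightarrow> ((\<lambda>x. l (a * x) / l x) \<longlongrightarrow> 1) at_top"
  using slow by (simp add: slowly_varying_def)

text \<open>Local boundedness of \<open>l (\<kappa> x) / l x\<close> is read off the functional limit: the processes scaled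
  by \<open>x\<close> and by \<open>\<kappa> x\<close> are both tight and bounded away from 0, and they only differ by this
  factor and a bounded time change. This replaces the uniform convergence theorem.\<close>

lemma l_locally_bounded:
  obtains C x0 where "0 < C" "0 < x0" "\<And>x \<kappa>. x0 \<le> x \<Longrightarrow> 1 \<le> \<kappa> \<Longrightarrow> \<kappa> \<le> 2 \<Longrightarrow> l (\<kappa> * x) \<le> C * l x"
proof -
  obtain k0 where k0: "\<forall>m\<ge>k0. \<forall>\<^sub>F e in at_right 0. whp M (1/3) (\<lambda>\<omega>. \<exists>t. 2 < t \<and> t < 4 \<and> 1 / real m < V2 e \<omega> t)"
    using V2_not_small[of "1/3"] by auto
  \<comment> \<open>The window is \<open>[1, 4]\<close>, which contains \<open>t / \<kappa>\<close>
    for \<open>t\<close> in \<open>(2, 4)\<close> and \<open>\<kappa>\<close> in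
    \<open>[1, 2]\<close>. Two exceptional probabilities of \<open>1/3\<close> still leave a common
    good outcome.\<close>
  obtain k1 where k1: "\<forall>m\<ge>k1. \<forall>\<^sub>F e in at_right 0. whp M (1/3) (\<lambda>\<omega>. \<forall>t\<ge>0. \<bar>t - 5/2\<bar> \<le> 3/2 \<longrightarrow> V2 e \<omega> t < real m)"
    using V2_tight[of "1/3" "5/2" "3/2"] by auto
  define m where "m = max (max k0 k1) 1"
  have m: "m \<ge> k0" "m \<ge> k1" "m \<ge> 1" by (auto simp: m_def)
  have "\<forall>\<^sub>F e in at_right 0. whp M (1/3) (\<lambda>\<omega>. \<exists>t. 2 < t \<and> t < 4 \<and> 1 / real m < V2 e \<omega> t) \<and>
      whp M (1/3) (\<lambda>\<omega>. \<forall>t\<ge>0. \<bar>t - 5/2\<bar> \<le> 3/2 \<longrightarrow> V2 e \<omega> t < real m)"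
    using k0[rule_format, OF m(1)] k1[rule_format, OF m(2)] by eventually_elim simp
  from eventually_conj[OF eventually_at_right_0_inverse[OF this] eventually_l_pos]
  obtain x1 where x1: "\<And>x. x1 \<le> x \<Longrightarrow> whp M (1/3) (\<lambda>\<omega>. \<exists>t. 2 < t \<and> t < 4 \<and> 1 / real m < V2 (1 / x) \<omega> t)"
      "\<And>x. x1 \<le> x \<Longrightarrow> whp M (1/3) (\<lambda>\<omega>. \<forall>t\<ge>0. \<bar>t - 5/2\<bar> \<le> 3/2 \<longrightarrow> V2 (1 / x) \<omega> t < real m)"
      "\<And>x. x1 \<le> x \<Longrightarrow> 0 < l x"
    unfolding eventually_at_top_linorder by auto
  show ?thesis
  proof (rule that[of "2 * (real m)\<^sup>2" "max x1 1"])
    fix x \<kappa> :: real assume x: "max x1 1 \<le> x" and \<kappa>: "1 \<le> \<kappa>" "\<kappa> \<le> 2"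
    have "x \<le> \<kappa> * x" using x \<kappa> by (simp add: mult_le_cancel_right1)
    then have kx: "x1 \<le> \<kappa> * x" using x by linarith
    have "whp M (1/3 + 1/3) (\<lambda>\<omega>. (\<exists>t. 2 < t \<and> t < 4 \<and> 1 / real m < V2 (1 / x) \<omega> t) \<and>
        (\<forall>t\<ge>0. \<bar>t - 5/2\<bar> \<le> 3/2 \<longrightarrow> V2 (1 / (\<kappa> * x)) \<omega> t < real m))"
      using x kx by (intro M.whp_conj x1(1,2)) auto
    then obtain \<omega> t where t: "2 < t" "t < 4" "1 / real m < V2 (1 / x) \<omega> t"
        "\<And>t. 0 \<le> t \<Longrightarrow> \<bar>t - 5/2\<bar> \<le> 3/2 \<Longrightarrow> V2 (1 / (\<kappa> * x)) \<omega> t < real m"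
      by (rule M.whp_exists) auto
    have "2 / \<kappa> \<le> t / \<kappa>" "t / \<kappa> \<le> 4 / 1" "1 \<le> 2 / \<kappa>"
      using t \<kappa> by (auto simp: divide_right_mono field_simps intro: order_trans[of t 4])
    then have "\<bar>t / \<kappa> - 5/2\<bar> \<le> 3/2" unfolding abs_le_iff by linarith
    then have up: "V2 (1 / (\<kappa> * x)) \<omega> (t / \<kappa>) < real m" using t \<kappa> by (intro t(4)) auto
    \<comment> \<open>Time \<open>t\<close> at scale \<open>x\<close> and time
      \<open>t / \<kappa>\<close> at scale \<open>\<kappa> * x\<close> are the same unscaled time
      \<open>t * x\<close>, so \<open>z\<close> is a common factor of both values.\<close>
    define z where "z = x powr (- h) * sqrt (Z2 \<omega> (t * x))"
    have low: "1 / real m < l x * z"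
      using t(3) x by (simp add: V2_def z_def powr_divide powr_minus_divide field_simps)
    have "V2 (1 / (\<kappa> * x)) \<omega> (t / \<kappa>) = \<kappa> powr (- h) * l (\<kappa> * x) * z"
      using x \<kappa> by (simp add: V2_def z_def powr_divide powr_minus_divide powr_mult field_simps)
    then have up: "\<kappa> powr (- h) * l (\<kappa> * x) * z < real m" using up by simp
    have "0 < l x" "0 < l (\<kappa> * x)" using x kx x1(3) by auto
    have "0 < 1 / real m" using m by simp
    then have "0 < l x * z" using low by linarith
    then have "0 < z" using \<open>0 < l x\<close> by (simp add: zero_less_mult_iff)
    have "1/2 \<le> \<kappa> powr (- h)"
    proof -
      have "2 powr (-1) \<le> 2 powr (- h)" using h by (intro powr_mono) auto
      also have "\<dots> \<le> \<kappa> powr (- h)" using h \<kappa> by (intro powr_mono2') auto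
      finally show ?thesis by (simp add: powr_minus_divide)
    qed
    then have "1/2 * (l (\<kappa> * x) * z) \<le> \<kappa> powr (- h) * (l (\<kappa> * x) * z)"
      using \<open>0 < z\<close> \<open>0 < l (\<kappa> * x)\<close> by (intro mult_right_mono) auto
    then have "l (\<kappa> * x) * z < 2 * real m" using up by (simp add: mult_ac)
    also have "\<dots> \<le> 2 * real m * (real m * (l x * z))"
      using low m by (simp add: field_simps)
    finally have "l (\<kappa> * x) * z < 2 * (real m)\<^sup>2 * l x * z" by (simp add: power2_eq_square mult_ac)
    then show "l (\<kappa> * x) \<le> 2 * (real m)\<^sup>2 * l x" using \<open>0 < z\<close> by simp
  qed (use m in auto)
qed

text \<open>Slow variation along the factor 2 bounds each doubling by \<open>2 powr d\<close>;
  \<open>l_locally_bounded\<close> starts the induction on one dyadic block.\<close>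

lemma l_growth:
  assumes "0 < d"
  obtains C x0 where "0 < C" "0 < x0" "\<And>x. x0 \<le> x \<Longrightarrow> l x \<le> C * x powr d"
proof -
  obtain C x0 where C: "0 < C" "0 < x0" "\<And>x \<kappa>. x0 \<le> x \<Longrightarrow> 1 \<le> \<kappa> \<Longrightarrow> \<kappa> \<le> 2 \<Longrightarrow> l (\<kappa> * x) \<le> C * l x"
    by (rule l_locally_bounded) (rule that)
  have "1 < 2 powr d" using assms by (simp add: gr_one_powr)
  then have "\<forall>\<^sub>F x in at_top. l (2 * x) / l x < 2 powr d"
    by (intro order_tendstoD(2)[OF l_ratio]) auto
  then have "\<forall>\<^sub>F x in at_top. l (2 * x) / l x < 2 powr d \<and> 0 < l x"
    using eventually_l_pos by eventually_elim simp
  then obtain x1 where x1: "\<And>x. x1 \<le> x \<Longrightarrow> l (2 * x) / l x < 2 powr d \<and> 0 < l x"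
    unfolding eventually_at_top_linorder by auto
  define y where "y = max x0 x1"
  have y: "0 < y" "x0 \<le> y" "x1 \<le> y" using C by (auto simp: y_def)
  define K where "K = C * l y"
  have "0 < l y" using x1[of y] y by simp
  then have K: "0 < K" using C by (simp add: K_def)
  have "l x \<le> (K / y powr d) * x powr d" if x: "y \<le> x" for x
  proof -
    have "l x \<le> K * (x / y) powr d"
    proof (rule doubling_growth_powr[OF y(1) assms])
      fix x assume "y \<le> x"
      then have "l (2 * x) / l x < 2 powr d" "0 < l x" using x1[of x] y by auto
      then show "l (2 * x) \<le> 2 powr d * l x" by (simp add: pos_divide_less_eq)
    next
      fix x assume x: "y \<le> x" "x \<le> 2 * y"
      then have "1 \<le> x / y" "x / y \<le> 2" using y by (simp_all add: field_simps)
      then show "l x \<le> K" using C(3)[of y "x / y"] y by (simp add: K_def)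
    qed (use K x in auto)
    then show ?thesis using y x by (simp add: powr_divide)
  qed
  then show ?thesis using K y by (intro that[of "K / y powr d" y]) auto
qed

lemma A_inv_at_top: "filterlim A_inv at_top at_top"
  using A_inv by (simp add: asymptotic_inverse_def)

lemma A_A_inv: "((\<lambda>x. (A_inv x powr (1 - h) * l (A_inv x)) / x) \<longlongrightarrow> 1) at_top"
proof -
  have "(\<lambda>x. A_inv x powr (1 - h) * l (A_inv x)) \<sim>[at_top] (\<lambda>x. x)"
    using A_inv by (simp add: asymptotic_inverse_def)
  then have "((\<lambda>x. if A_inv x powr (1 - h) * l (A_inv x) = 0 \<and> x = 0 then 1 else (A_inv x powr (1 - h) * l (A_inv x)) / x) \<longlongrightarrow> 1) at_top"
    by (simp add: asymp_equiv_def)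
  then show ?thesis
    by (rule Lim_transform_eventually) (use eventually_gt_at_top[of 0] in \<open>eventually_elim; simp\<close>)
qed

lemma inverse_at_top: "filterlim (\<lambda>\<epsilon>::real. 1 / \<epsilon>) at_top (at_right 0)"
  by real_asymp

definition a :: "real \<Rightarrow> real" where
  "a \<epsilon> = A_inv (1 / \<epsilon>)"

lemma a_at_top: "filterlim a at_top (at_right 0)"
  unfolding a_def[abs_def] by (rule filterlim_compose[OF A_inv_at_top inverse_at_top])

lemma A_a: "((\<lambda>\<epsilon>. a \<epsilon> powr (1 - h) * l (a \<epsilon>) * \<epsilon>) \<longlongrightarrow> 1) (at_right 0)"
  using filterlim_compose[OF A_A_inv inverse_at_top] by (simp add: a_def)

text \<open>Since \<open>A\<close> grows at most like the power \<open>1 - h + d\<close>, its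
  inverse grows at least like the power \<open>1 / (1 - h + d)\<close>, which exceeds
  \<open>\<nu>\<close> for small \<open>d\<close>. The minimal run length is therefore negligible on
  the time scale \<open>a \<epsilon>\<close>.\<close>

lemma a_large:
  assumes "0 < K"
  shows "\<forall>\<^sub>F \<epsilon> in at_right 0. \<epsilon> powr (- \<nu>) < K * a \<epsilon>"
proof -
  \<comment> \<open>Half the available gap: \<open>(1 - h + d) * \<nu>\<close> becomes the midpoint
    of \<open>(1 - h) * \<nu>\<close> and 1.\<close>
  define d where "d = (1 / \<nu> - (1 - h)) / 2"
  have "(1 - h) * \<nu> < 1" using nu h by (simp add: field_simps)
  moreover have eq: "(1 - h + d) * \<nu> = ((1 - h) * \<nu> + 1) / 2" "2 * d = (1 - (1 - h) * \<nu>) / \<nu>"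
    using nu(1) by (simp_all add: d_def field_simps)
  ultimately have "0 < 2 * d" "(1 - h + d) * \<nu> < 1" unfolding eq using nu(1) by simp_all
  then have d: "0 < d" "(1 - h + d) * \<nu> < 1" by simp_all
  obtain C x0 where C: "0 < C" "0 < x0" "\<And>x. x0 \<le> x \<Longrightarrow> l x \<le> C * x powr d"
    using l_growth[OF d(1)] by blast
  define p where "p = (1 - h + d) * \<nu>"
  have "((\<lambda>x::real. (2 * C) powr \<nu> * x powr (p - 1)) \<longlongrightarrow> 0) at_top"
    using d(2) unfolding p_def[symmetric] by real_asymp
  then have "\<forall>\<^sub>F x::real in at_top. (2 * C) powr \<nu> * x powr (p - 1) < K"
    using assms by (rule order_tendstoD(2))
  then have "\<forall>\<^sub>F \<epsilon> in at_right 0. (2 * C) powr \<nu> * a \<epsilon> powr (p - 1) < K"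
    using a_at_top by (rule eventually_compose_filterlim)
  moreover have "\<forall>\<^sub>F \<epsilon> in at_right 0. 1/2 < a \<epsilon> powr (1 - h) * l (a \<epsilon>) * \<epsilon>"
    by (rule order_tendstoD(1)[OF A_a]) simp
  moreover have "\<forall>\<^sub>F \<epsilon> in at_right 0. x0 < a \<epsilon>"
    using a_at_top by (simp add: filterlim_at_top_dense)
  ultimately show ?thesis
    using eventually_pos
  proof eventually_elim
    case (elim \<epsilon>)
    have a: "0 < a \<epsilon>" using elim C by simp
    have "1 / \<epsilon> < 2 * (a \<epsilon> powr (1 - h) * l (a \<epsilon>))"
      using elim by (simp add: field_simps)
    also have "\<dots> \<le> 2 * (a \<epsilon> powr (1 - h) * (C * a \<epsilon> powr d))"
      using elim C(3)[of "a \<epsilon>"] by (intro mult_left_mono) auto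
    also have "\<dots> = 2 * C * a \<epsilon> powr (1 - h + d)" by (simp add: powr_add)
    finally have "(1 / \<epsilon>) powr \<nu> < (2 * C * a \<epsilon> powr (1 - h + d)) powr \<nu>"
      using elim nu by (intro powr_less_mono2) auto
    also have "\<dots> = (2 * C) powr \<nu> * a \<epsilon> powr p"
      using C by (simp add: powr_mult powr_powr p_def)
    also have "a \<epsilon> powr p = a \<epsilon> powr (p - 1) * a \<epsilon>"
      using a by (simp add: powr_diff)
    also have "(2 * C) powr \<nu> * (a \<epsilon> powr (p - 1) * a \<epsilon>) < K * a \<epsilon>"
      using elim(1) a by (simp add: mult.assoc[symmetric])
    finally show ?case using elim by (simp add: powr_minus_divide powr_divide)
  qed
qed

lemma scale_at_right:
  assumes "0 < \<kappa>" shows "filterlim (\<lambda>\<epsilon>. 1 / (\<kappa> * a \<epsilon>)) (at_right 0) (at_right 0)"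
proof -
  have "filterlim (\<lambda>x::real. 1 / (\<kappa> * x)) (at_right 0) at_top" using assms by real_asymp
  then show ?thesis by (rule filterlim_compose[OF _ a_at_top])
qed

text \<open>Regular variation of \<open>A\<close> with index \<open>1 - h\<close>, evaluated along
  \<open>a \<epsilon>\<close>.\<close>

lemma B_scale:
  assumes "0 < \<kappa>"
  shows "((\<lambda>\<epsilon>. B (1 / (\<kappa> * a \<epsilon>)) * \<epsilon>) \<longlongrightarrow> \<kappa> powr (1 - h)) (at_right 0)"
proof -
  have "((\<lambda>\<epsilon>. l (\<kappa> * a \<epsilon>) / l (a \<epsilon>)) \<longlongrightarrow> 1) (at_right 0)"
    by (rule filterlim_compose[OF l_ratio[OF assms] a_at_top])
  then have "((\<lambda>\<epsilon>. \<kappa> powr (1 - h) * (a \<epsilon> powr (1 - h) * l (a \<epsilon>) * \<epsilon>) * (l (\<kappa> * a \<epsilon>) / l (a \<epsilon>))) \<longlongrightarrow>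
      \<kappa> powr (1 - h) * 1 * 1) (at_right 0)"
    by (intro tendsto_mult tendsto_const A_a)
  moreover have "\<forall>\<^sub>F \<epsilon> in at_right 0. 0 < a \<epsilon>" using a_at_top by (simp add: filterlim_at_top_dense)
  then have "\<forall>\<^sub>F \<epsilon> in at_right 0. \<kappa> powr (1 - h) * (a \<epsilon> powr (1 - h) * l (a \<epsilon>) * \<epsilon>) * (l (\<kappa> * a \<epsilon>) / l (a \<epsilon>)) = B (1 / (\<kappa> * a \<epsilon>)) * \<epsilon>"
    using eventually_compose_filterlim[OF eventually_l_pos a_at_top]
  proof eventually_elim
    case (elim \<epsilon>)
    have "(1 / (\<kappa> * a \<epsilon>)) powr (h - 1) = (\<kappa> * a \<epsilon>) powr (1 - h)"
      using elim assms by (simp add: powr_divide powr_minus_divide[symmetric])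
    then show ?case using elim assms by (simp add: B_def powr_mult)
  qed
  ultimately show ?thesis by (simp add: Lim_transform_eventually)
qed

text \<open>The double limit is unpacked into one \<open>\<eta>\<close> fixed before \<epsilon>. On
  the good event the infimum exceeds \<open>K * \<epsilon>\<close>, and so does every single
  ratio.\<close>

lemma no_early_whp:
  assumes "0 < K" "0 < \<gamma>"
  shows "\<exists>\<eta>>0. \<forall>\<^sub>F \<epsilon> in at_right 0. whp M \<gamma>
    (\<lambda>\<omega>. \<forall>n. \<epsilon> powr (- \<nu>) \<le> real n \<longrightarrow> real n \<le> \<eta> * a \<epsilon> \<longrightarrow> K * \<epsilon> < sqrt (Z2 \<omega> (real n)) / real n)"
proof -
  define S where "S \<eta> \<epsilon> = {n::nat. \<epsilon> powr (- \<nu>) \<le> real n \<and> real n \<le> \<eta> * A_inv (1 / \<epsilon>)}" for \<eta> \<epsilon>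
  define E where "E \<eta> \<epsilon> = {\<omega> \<in> space M. (INF n\<in>S \<eta> \<epsilon>. ereal (sqrt (Z2 \<omega> (real n)) / real n)) \<le> ereal (K * \<epsilon>)}" for \<eta> \<epsilon>
  have "((\<lambda>\<eta>. Limsup (at_right 0) (\<lambda>\<epsilon>. ereal (measure M (E \<eta> \<epsilon>)))) \<longlongrightarrow> 0) (at_right 0)"
    using no_early assms(1) unfolding no_early_stopping_def E_def S_def by blast
  then have "\<forall>\<^sub>F \<eta> in at_right 0. Limsup (at_right 0) (\<lambda>\<epsilon>. ereal (measure M (E \<eta> \<epsilon>))) < ereal \<gamma>"
    by (rule order_tendstoD(2)) (use assms in simp)
  then have "\<forall>\<^sub>F \<eta> in at_right 0. Limsup (at_right 0) (\<lambda>\<epsilon>. ereal (measure M (E \<eta> \<epsilon>))) < ereal \<gamma> \<and> 0 < \<eta>"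
    using eventually_pos by eventually_elim simp
  then obtain \<eta> where \<eta>: "Limsup (at_right 0) (\<lambda>\<epsilon>. ereal (measure M (E \<eta> \<epsilon>))) < ereal \<gamma>" "0 < \<eta>"
    using eventually_happens'[of "at_right (0::real)"] by auto
  have "\<forall>\<^sub>F \<epsilon> in at_right 0. ereal (measure M (E \<eta> \<epsilon>)) < ereal \<gamma>"
    using \<eta>(1) by (rule Limsup_lessD)
  then have "\<forall>\<^sub>F \<epsilon> in at_right 0. whp M \<gamma>
    (\<lambda>\<omega>. \<forall>n. \<epsilon> powr (- \<nu>) \<le> real n \<longrightarrow> real n \<le> \<eta> * a \<epsilon> \<longrightarrow> K * \<epsilon> < sqrt (Z2 \<omega> (real n)) / real n)"
  proof eventually_elim
    case (elim \<epsilon>)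
    have "(\<lambda>\<omega>. INF n\<in>S \<eta> \<epsilon>. ereal (sqrt (Z2 \<omega> (real n)) / real n)) \<in> borel_measurable M"
      by (intro borel_measurable_INF borel_measurable_ereal borel_measurable_divide borel_measurable_const
          cadlag_process_measurable[OF cadlag_process_sqrt[OF Z2]]) auto
    then have "E \<eta> \<epsilon> \<in> sets M" unfolding E_def by measurable
    then show ?case
      unfolding E_def
    proof (rule whpI)
      show "M.prob {\<omega> \<in> space M. (INF n\<in>S \<eta> \<epsilon>. ereal (sqrt (Z2 \<omega> (real n)) / real n)) \<le> ereal (K * \<epsilon>)} \<le> \<gamma>"
        using elim by (simp add: E_def)
      fix \<omega> assume *: "\<not> (INF n\<in>S \<eta> \<epsilon>. ereal (sqrt (Z2 \<omega> (real n)) / real n)) \<le> ereal (K * \<epsilon>)"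
      show "\<forall>n. \<epsilon> powr (- \<nu>) \<le> real n \<longrightarrow> real n \<le> \<eta> * a \<epsilon> \<longrightarrow> K * \<epsilon> < sqrt (Z2 \<omega> (real n)) / real n"
      proof (intro allI impI)
        fix n :: nat assume "\<epsilon> powr (- \<nu>) \<le> real n" "real n \<le> \<eta> * a \<epsilon>"
        then have "(INF n\<in>S \<eta> \<epsilon>. ereal (sqrt (Z2 \<omega> (real n)) / real n)) \<le> ereal (sqrt (Z2 \<omega> (real n)) / real n)"
          by (intro INF_lower) (simp add: S_def a_def)
        then have "ereal (K * \<epsilon>) < ereal (sqrt (Z2 \<omega> (real n)) / real n)"
          using * by (meson not_le order.strict_trans2)
        then show "K * \<epsilon> < sqrt (Z2 \<omega> (real n)) / real n" by (simp only: less_ereal.simps(1))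
      qed
    qed
  qed
  then show ?thesis using \<eta>(2) by blast
qed

end

section \<open>Statistics at a crossing time\<close>

context sequential_limit
begin

definition F :: "real \<Rightarrow> real" where
  "F = cdf (distr N borel (limit_statistic Y1 Y2))"

lemma F_eq: "F x = measure N {\<omega> \<in> space N. limit_statistic Y1 Y2 \<omega> \<le> x}"
  unfolding F_def cdf_def by (subst measure_distr) (auto intro!: arg_cong[where f = "measure N"])

lemma F_mono: "x \<le> y \<Longrightarrow> F x \<le> F y"
  unfolding F_eq by (intro finite_measure_mono) auto

lemma F_close:
  assumes cont: "continuous_on UNIV F" and "0 < \<gamma>"
  obtains \<rho> where "0 < \<rho>" "F (x + \<rho>) < F x + \<gamma>" "F x - \<gamma> < F (x - \<rho>)"
proof -
  have "isCont F x" using cont by (simp add: continuous_on_eq_continuous_at)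
  then obtain d where d: "d > 0" "\<And>y. \<bar>y - x\<bar> < d \<Longrightarrow> \<bar>F y - F x\<bar> < \<gamma>"
    using \<open>0 < \<gamma>\<close> unfolding continuous_at_eps_delta dist_real_def by blast
  have "\<bar>F (x + d / 2) - F x\<bar> < \<gamma>" "\<bar>F (x - d / 2) - F x\<bar> < \<gamma>"
    using d(1) by (intro d(2); simp)+
  then show ?thesis using d(1) by (intro that[of "d / 2"]) linarith+
qed

lemma prob_passage_le: "measure N {\<omega> \<in> space N. 1 * Y1 \<omega> (passage 1 \<omega>) \<le> y * passage 1 \<omega>} = F y"
  unfolding F_eq
proof (rule finite_measure_eq_AE)
  show "AE \<omega> in N. (\<omega> \<in> {\<omega> \<in> space N. 1 * Y1 \<omega> (passage 1 \<omega>) \<le> y * passage 1 \<omega>}) =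
      (\<omega> \<in> {\<omega> \<in> space N. limit_statistic Y1 Y2 \<omega> \<le> y})"
    using AE_limit_statistic AE_regular
  proof eventually_elim
    case (elim \<omega>)
    then show ?case using regular_passage_pos[OF elim(2)] by (simp add: elim(1)[symmetric])
  qed
qed measurable

text \<open>The gap between \<open>z\<close> and \<open>- y\<close> converts the closed condition
  belonging to the sign -1 into the open tail above \<open>z\<close>.\<close>

lemma prob_passage_ge:
  assumes "z < - y"
  shows "measure N {\<omega> \<in> space N. (-1) * Y1 \<omega> (passage 1 \<omega>) \<le> y * passage 1 \<omega>} \<le> 1 - F z"
proof -
  have "measure N {\<omega> \<in> space N. (-1) * Y1 \<omega> (passage 1 \<omega>) \<le> y * passage 1 \<omega>} \<le>
      measure N (space N - {\<omega> \<in> space N. limit_statistic Y1 Y2 \<omega> \<le> z})"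
  proof (rule finite_measure_mono_AE)
    show "AE \<omega> in N. \<omega> \<in> {\<omega> \<in> space N. (-1) * Y1 \<omega> (passage 1 \<omega>) \<le> y * passage 1 \<omega>} \<longrightarrow>
        \<omega> \<in> space N - {\<omega> \<in> space N. limit_statistic Y1 Y2 \<omega> \<le> z}"
      using AE_limit_statistic AE_regular
    proof eventually_elim
      case (elim \<omega>)
      have pos: "0 < passage 1 \<omega>" by (rule regular_passage_pos[OF elim(2)])
      have "z < limit_statistic Y1 Y2 \<omega>" if "(-1) * Y1 \<omega> (passage 1 \<omega>) \<le> y * passage 1 \<omega>"
      proof -
        have "- y * passage 1 \<omega> \<le> limit_statistic Y1 Y2 \<omega> * passage 1 \<omega>" using that elim(1) by simp
        then have "- y \<le> limit_statistic Y1 Y2 \<omega>" using pos by (simp only: mult_le_cancel_right_pos)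
        then show ?thesis using assms by simp
      qed
      then show ?case by auto
    qed
  qed measurable
  also have "\<dots> = 1 - F z"
    unfolding F_eq by (rule prob_compl) measurable
  finally show ?thesis .
qed

text \<open>For \<open>\<sigma> = \<plusminus>1\<close>: the self-normalized statistic at time \<open>n\<close> lies above resp. below \<open>x\<close>, and
  the limiting probability of the complement.\<close>

definition beyond :: "real \<Rightarrow> real \<Rightarrow> 'a \<Rightarrow> nat \<Rightarrow> bool" where
  "beyond \<sigma> x \<omega> n \<longleftrightarrow> 0 < Z2 \<omega> (real n) \<and>
     \<sigma> * (x * sqrt (Z2 \<omega> (real n))) < \<sigma> * (Z1 \<omega> (real n) - real n * \<mu>)"

definition tail :: "real \<Rightarrow> real \<Rightarrow> real" where
  "tail \<sigma> x = (if \<sigma> = 1 then F x else 1 - F x)"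

text \<open>\<open>T\<close> behaves, up to the relative error \<open>1/m\<close>, like the first time at which
  \<open>sqrt Z2 n / n\<close> falls below \<open>1 / B e\<close>, as far as the scaled times in \<open>(3/m, m]\<close> are concerned.\<close>

definition crossing :: "real \<Rightarrow> nat \<Rightarrow> ('a \<Rightarrow> enat) \<Rightarrow> 'a \<Rightarrow> bool" where
  "crossing e m T \<omega> \<longleftrightarrow>
     (\<forall>n. T \<omega> = enat n \<longrightarrow> 3 / real m < real n * e \<and>
        (real n * e \<le> real m \<longrightarrow> B e * sqrt (Z2 \<omega> (real n)) \<le> (1 + 1 / real m) * real n)) \<and>
     (\<forall>n. 3 / real m < real n * e \<longrightarrow> real n * e < real m \<longrightarrow> enat n < T \<omega> \<longrightarrow>
        (1 - 1 / real m) * real n \<le> B e * sqrt (Z2 \<omega> (real n)))"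

text \<open>If \<open>T\<close> had not come by scaled time \<open>m\<close>, all windows before
  index \<open>m * m\<close> would be above the line. Otherwise the windows before the cell of the
  stopping point are above, and that cell satisfies the first condition of
  \<open>cell_event\<close>. As the passage event fails, the other conditions must fail at the
  stopping point, and this gives the strict inequalities.\<close>

lemma crossing_passage_event:
  assumes e: "0 < e" "e < 1 / real m" and "0 < m"
    and cross: "crossing e m T \<omega>" and not: "\<not> passage_event \<eta> \<sigma> y m (V1 e \<omega>) (V2 e \<omega>)"
  shows "\<exists>n. T \<omega> = enat n \<and> real n * e \<le> real m \<and> 3 / real m < real n * e \<and>
    B e * sqrt (Z2 \<omega> (real n)) \<le> (1 + 1 / real m) * real n \<and>
    (1 - \<eta>) * real n < B e * sqrt (Z2 \<omega> (real n)) \<and>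
    y * real n < \<sigma> * (B e * (Z1 \<omega> (real n) - real n * \<mu>))"
proof -
  have above: "(1 - 1 / real m) * (real n * e) \<le> V2 e \<omega> (real n * e)"
    if n: "3 / real m < real n * e" "real n * e < real m" "enat n < T \<omega>" for n
  proof -
    have "(1 - 1 / real m) * real n \<le> B e * sqrt (Z2 \<omega> (real n))"
      using cross n unfolding crossing_def by blast
    then have "((1 - 1 / real m) * real n) * e \<le> (B e * sqrt (Z2 \<omega> (real n))) * e"
      using e by (intro mult_right_mono) auto
    then show ?thesis unfolding V2_grid[OF e(1)] by (simp only: mult_ac)
  qed
  have "\<exists>n. T \<omega> = enat n \<and> real n * e \<le> real m"
  proof (rule ccontr)
    assume *: "\<not> (\<exists>n. T \<omega> = enat n \<and> real n * e \<le> real m)"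
    have "windows_above m (m * m) (V2 e \<omega>)"
    proof (rule windows_aboveI[OF e \<open>0 < m\<close>])
      fix n assume n: "3 / real m < real n * e" "real n * e < real (m * m) / real m"
      then have n': "real n * e < real m" using \<open>0 < m\<close> by simp
      have "enat n < T \<omega>"
      proof (cases "T \<omega>")
        case (enat k)
        then have "real n * e < real k * e" using * n' by auto
        then show ?thesis using enat e by simp
      qed simp
      then show "(1 - 1 / real m) * (real n * e) \<le> V2 e \<omega> (real n * e)" using above n n' by blast
    qed
    then show False using not by (simp add: passage_event_def)
  qed
  then obtain n where n: "T \<omega> = enat n" "real n * e \<le> real m" by blast
  have low: "3 / real m < real n * e" and up: "B e * sqrt (Z2 \<omega> (real n)) \<le> (1 + 1 / real m) * real n"
    using cross n unfolding crossing_def by blast+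
  \<comment> \<open>The last mesh point not after the stopping point; the lower bound
    \<open>3/m\<close> on the scaled time gives \<open>p \<ge> 3\<close>.\<close>
  define p where "p = nat \<lfloor>real m * (real n * e)\<rfloor>"
  have "0 \<le> real m * (real n * e)" using e by simp
  then have p: "real p \<le> real m * (real n * e)" "real m * (real n * e) < real p + 1"
    unfolding p_def by linarith+
  have m: "0 < real m" using \<open>0 < m\<close> by simp
  have q: "real p / real m \<le> real n * e" "real n * e < real p / real m + 1 / real m"
    using p m by (simp_all add: field_simps)
  have "3 < real m * (real n * e)" using low m by (simp add: field_simps)
  then have "3 < real p + 1" using p(2) by simp
  then have "3 \<le> p" by simp
  have "real m * (real n * e) \<le> real m * real m" using n(2) m by (intro mult_left_mono) auto
  then have "real p \<le> real (m * m)" using p(1) by simp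
  then have "p \<in> {3..m * m}" using \<open>3 \<le> p\<close> by (simp only: of_nat_le_iff) simp
  moreover have "windows_above m p (V2 e \<omega>)"
  proof (rule windows_aboveI[OF e \<open>0 < m\<close>])
    fix k assume k: "3 / real m < real k * e" "real k * e < real p / real m"
    then have "real k * e < real n * e" using q by simp
    then have "enat k < T \<omega>" "real k * e < real m" using n e by (simp, linarith)
    then show "(1 - 1 / real m) * (real k * e) \<le> V2 e \<omega> (real k * e)" using above k by blast
  qed
  ultimately have not_cell: "\<not> cell_event \<eta> \<sigma> y m p (V1 e \<omega>) (V2 e \<omega>)"
    using not unfolding passage_event_def by blast
  have t: "0 \<le> real n * e" "\<bar>real n * e - real p / real m\<bar> \<le> 1 / real m" using q e by auto
  have upe: "B e * e * sqrt (Z2 \<omega> (real n)) \<le> (1 + 1 / real m) * (real n * e)"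
    using mult_right_mono[OF up, of e] e by (simp add: mult_ac)
  have "window_inf 1 (- (1 + 1 / real m)) 0 (real p / real m) (1 / real m) (V2 e \<omega>) \<le> 0"
    by (rule window_inf_le_0I[OF t]) (unfold V2_grid[OF e(1)] mult_1 mult_minus_left, use upe in linarith)
  then have "\<not> window_inf 1 (- (1 - \<eta>)) 0 (real p / real m) (1 / real m) (V2 e \<omega>) \<le> 0"
      "\<not> window_inf \<sigma> (- y) 0 (real p / real m) (1 / real m) (V1 e \<omega>) \<le> 0"
    using not_cell unfolding cell_event_def by blast+
  then have "\<not> 1 * V2 e \<omega> (real n * e) + - (1 - \<eta>) * (real n * e) + 0 \<le> 0"
      "\<not> \<sigma> * V1 e \<omega> (real n * e) + - y * (real n * e) + 0 \<le> 0"
    using window_inf_le_0I[OF t] by blast+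
  then have "((1 - \<eta>) * real n) * e < (B e * sqrt (Z2 \<omega> (real n))) * e"
      "(y * real n) * e < (\<sigma> * (B e * (Z1 \<omega> (real n) - real n * \<mu>))) * e"
    unfolding V2_grid[OF e(1)] V1_grid[OF e(1)] by (simp_all add: algebra_simps)
  then have "(1 - \<eta>) * real n < B e * sqrt (Z2 \<omega> (real n))"
      "y * real n < \<sigma> * (B e * (Z1 \<omega> (real n) - real n * \<mu>))"
    using e by (simp_all only: mult_less_cancel_right_pos)
  then show ?thesis using n low up by blast
qed

context
  fixes T :: "real \<Rightarrow> 'a \<Rightarrow> enat" and e :: "real \<Rightarrow> real"
  assumes e: "filterlim e (at_right 0) (at_right 0)"
    and cross: "\<And>\<gamma>. 0 < \<gamma> \<Longrightarrow> \<exists>m0. \<forall>m\<ge>m0. \<forall>\<^sub>F \<epsilon> in at_right 0. whp M \<gamma> (crossing (e \<epsilon>) m (T \<epsilon>))"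
begin

lemma stopped_core:
  assumes "0 < \<eta>" "0 < \<gamma>"
  shows "\<exists>m0. \<forall>m\<ge>m0. \<forall>\<^sub>F \<epsilon> in at_right 0.
    whp M (measure N {\<omega> \<in> space N. \<sigma> * Y1 \<omega> (passage 1 \<omega>) \<le> y * passage 1 \<omega>} + \<gamma>)
      (\<lambda>\<omega>. \<exists>n. T \<epsilon> \<omega> = enat n \<and> real n * e \<epsilon> \<le> real m \<and> 3 / real m < real n * e \<epsilon> \<and>
        B (e \<epsilon>) * sqrt (Z2 \<omega> (real n)) \<le> (1 + 1 / real m) * real n \<and>
        (1 - \<eta>) * real n < B (e \<epsilon>) * sqrt (Z2 \<omega> (real n)) \<and>
        y * real n < \<sigma> * (B (e \<epsilon>) * (Z1 \<omega> (real n) - real n * \<mu>)))"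
    (is "\<exists>m0. \<forall>m\<ge>m0. \<forall>\<^sub>F \<epsilon> in at_right 0. whp M (?q + \<gamma>) (?P m \<epsilon>)")
proof -
  have "{\<omega> \<in> space N. \<sigma> * Y1 \<omega> (passage 1 \<omega>) \<le> y * passage 1 \<omega>} \<in> sets N" by measurable
  from limsup_V[where P = "passage_event \<eta> \<sigma> y", OF M2_closed_passage_event AE_passage_event_limit[OF assms(1)] this, of "\<gamma> / 2"] assms(2)
  obtain m1 where m1: "\<forall>m\<ge>m1. \<forall>\<^sub>F e in at_right 0. whp M (?q + \<gamma> / 2) (\<lambda>\<omega>. \<not> passage_event \<eta> \<sigma> y m (V1 e \<omega>) (V2 e \<omega>))"
    by auto
  obtain m2 where m2: "\<forall>m\<ge>m2. \<forall>\<^sub>F \<epsilon> in at_right 0. whp M (\<gamma> / 2) (crossing (e \<epsilon>) m (T \<epsilon>))"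
    using cross[of "\<gamma> / 2"] assms by auto
  have "\<forall>\<^sub>F \<epsilon> in at_right 0. whp M (?q + \<gamma>) (?P m \<epsilon>)" if m: "m \<ge> max (max m1 m2) 1" for m
  proof -
    have mm: "m1 \<le> m" "m2 \<le> m" "0 < m" using m by auto
    have "\<forall>\<^sub>F e in at_right 0. e < 1 / real m"
      using mm(3) by (intro eventually_at_rightI[of 0 "1 / real m"]) auto
    then have "\<forall>\<^sub>F e in at_right 0. whp M (?q + \<gamma> / 2) (\<lambda>\<omega>. \<not> passage_event \<eta> \<sigma> y m (V1 e \<omega>) (V2 e \<omega>)) \<and> 0 < e \<and> e < 1 / real m"
      using m1[rule_format, OF mm(1)] eventually_pos by eventually_elim simp
    from eventually_compose_filterlim[OF this e] show ?thesis
      using m2[rule_format, OF mm(2)]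
    proof eventually_elim
      case (elim \<epsilon>)
      from M.whp_conj[OF conjunct1[OF elim(1)] elim(2)] show ?case
      proof (rule whp_mono)
        fix \<omega> assume "\<not> passage_event \<eta> \<sigma> y m (V1 (e \<epsilon>) \<omega>) (V2 (e \<epsilon>) \<omega>) \<and> crossing (e \<epsilon>) m (T \<epsilon>) \<omega>"
        then show "?P m \<epsilon> \<omega>"
          using crossing_passage_event[of "e \<epsilon>" m "T \<epsilon>" \<omega> \<eta> \<sigma> y] elim(1) mm(3) by blast
      qed simp
    qed
  qed
  then show ?thesis by blast
qed

text \<open>\<open>stopped_core\<close> compares the numerator with the time, whereas the statistic
  compares it with \<open>sqrt Z2\<close>. At the stopping point \<open>B * sqrt Z2\<close> is
  within \<open>\<eta> * n\<close> of \<open>n\<close>, so the level moves by at most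
  \<open>\<bar>x\<bar> * \<eta>\<close>, which continuity of \<open>F\<close> absorbs.\<close>

lemma stopped_statistic:
  assumes F_cont: "continuous_on UNIV F" and "0 < \<gamma>" and \<sigma>: "\<sigma> = 1 \<or> \<sigma> = -1"
  shows "\<exists>m0. \<forall>m\<ge>m0. \<forall>\<^sub>F \<epsilon> in at_right 0. whp M (tail \<sigma> x + \<gamma>)
      (\<lambda>\<omega>. \<exists>n. T \<epsilon> \<omega> = enat n \<and> real n * e \<epsilon> \<le> real m \<and> 3 / real m < real n * e \<epsilon> \<and>
        real n \<le> 3 / 2 * B (e \<epsilon>) * sqrt (Z2 \<omega> (real n)) \<and> beyond \<sigma> x \<omega> n)"
proof -
  obtain \<rho> where \<rho>: "0 < \<rho>" "F (x + \<rho>) < F x + \<gamma> / 2" "F x - \<gamma> / 2 < F (x - \<rho>)"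
    using F_close[OF F_cont, of "\<gamma> / 2" x] assms by auto
  \<comment> \<open>The bound \<open>1/3\<close> yields \<open>n \<le> 3/2 * B * sqrt Z2\<close>;
    the other one keeps the shift \<open>\<bar>x\<bar> * \<eta>\<close> below \<open>\<rho>\<close>,
    with \<open>+ 1\<close> to allow \<open>x = 0\<close>.\<close>
  define \<eta> where "\<eta> = min (1/3) (\<rho> / (\<bar>x\<bar> + 1))"
  have "0 < \<rho> / (\<bar>x\<bar> + 1)" using \<rho>(1) by simp
  then have "0 < \<eta> \<and> \<eta> \<le> 1/3" unfolding \<eta>_def by linarith
  then have \<eta>: "0 < \<eta>" "\<eta> \<le> 1/3" by simp_all
  have "\<bar>x\<bar> * \<eta> \<le> \<bar>x\<bar> * (\<rho> / (\<bar>x\<bar> + 1))" by (intro mult_left_mono) (auto simp: \<eta>_def)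
  also have "\<dots> < \<rho>" using \<rho>(1) by (simp add: divide_simps)
  finally have x\<eta>: "\<bar>x\<bar> * \<eta> < \<rho>" .
  obtain k :: nat where k: "1 / \<eta> < real k" using reals_Archimedean2 by blast
  define y where "y = \<sigma> * x + \<bar>x\<bar> * \<eta>"
  have "measure N {\<omega> \<in> space N. \<sigma> * Y1 \<omega> (passage 1 \<omega>) \<le> y * passage 1 \<omega>} + \<gamma> / 2 \<le> tail \<sigma> x + \<gamma>"
    using \<sigma>
  proof
    assume \<sigma>1: "\<sigma> = 1"
    have "F y \<le> F (x + \<rho>)" using x\<eta> \<sigma>1 by (intro F_mono) (simp add: y_def)
    then show ?thesis using \<rho>(2) unfolding \<sigma>1 prob_passage_le by (simp add: tail_def)
  next
    assume \<sigma>1: "\<sigma> = -1"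
    have "measure N {\<omega> \<in> space N. (-1) * Y1 \<omega> (passage 1 \<omega>) \<le> y * passage 1 \<omega>} \<le> 1 - F (x - \<rho>)"
      using x\<eta> \<sigma>1 by (intro prob_passage_ge) (simp add: y_def)
    then show ?thesis using \<rho>(3) unfolding \<sigma>1 by (simp add: tail_def)
  qed
  note q = this
  have "0 < \<gamma> / 2" using assms by simp
  from stopped_core[OF \<eta>(1) this, of \<sigma> y] obtain m1 where m1: "\<forall>m\<ge>m1. \<forall>\<^sub>F \<epsilon> in at_right 0.
    whp M (measure N {\<omega> \<in> space N. \<sigma> * Y1 \<omega> (passage 1 \<omega>) \<le> y * passage 1 \<omega>} + \<gamma> / 2)
      (\<lambda>\<omega>. \<exists>n. T \<epsilon> \<omega> = enat n \<and> real n * e \<epsilon> \<le> real m \<and> 3 / real m < real n * e \<epsilon> \<and>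
        B (e \<epsilon>) * sqrt (Z2 \<omega> (real n)) \<le> (1 + 1 / real m) * real n \<and>
        (1 - \<eta>) * real n < B (e \<epsilon>) * sqrt (Z2 \<omega> (real n)) \<and>
        y * real n < \<sigma> * (B (e \<epsilon>) * (Z1 \<omega> (real n) - real n * \<mu>)))" by (rule exE)
  show ?thesis
  proof (intro exI[of _ "max m1 k"] allI impI)
    fix m assume "max m1 k \<le> m"
    then have m: "m1 \<le> m" "k \<le> m" by auto
    have "0 < 1 / \<eta>" using \<eta> by simp
    then have "0 < real k" using k by linarith
    have "1 / real m \<le> 1 / real k" using m \<open>0 < real k\<close> by (simp add: frac_le)
    also have "\<dots> \<le> \<eta>" using k \<eta> \<open>0 < real k\<close> by (simp add: field_simps)
    finally have m\<eta>: "1 / real m \<le> \<eta>" .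
    show "\<forall>\<^sub>F \<epsilon> in at_right 0. whp M (tail \<sigma> x + \<gamma>)
      (\<lambda>\<omega>. \<exists>n. T \<epsilon> \<omega> = enat n \<and> real n * e \<epsilon> \<le> real m \<and> 3 / real m < real n * e \<epsilon> \<and>
        real n \<le> 3 / 2 * B (e \<epsilon>) * sqrt (Z2 \<omega> (real n)) \<and> beyond \<sigma> x \<omega> n)"
      using m1[rule_format, OF m(1)]
    proof (rule eventually_mono, elim whp_mono[OF _ q] exE conjE)
      fix \<epsilon> \<omega> n assume \<omega>: "\<omega> \<in> space M" and n: "T \<epsilon> \<omega> = enat n" "real n * e \<epsilon> \<le> real m" "3 / real m < real n * e \<epsilon>"
        "B (e \<epsilon>) * sqrt (Z2 \<omega> (real n)) \<le> (1 + 1 / real m) * real n"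
        "(1 - \<eta>) * real n < B (e \<epsilon>) * sqrt (Z2 \<omega> (real n))"
        "y * real n < \<sigma> * (B (e \<epsilon>) * (Z1 \<omega> (real n) - real n * \<mu>))"
      define S where "S = B (e \<epsilon>) * sqrt (Z2 \<omega> (real n))"
      have "(1 + 1 / real m) * real n \<le> (1 + \<eta>) * real n" using m\<eta> by (intro mult_right_mono) auto
      then have S: "S \<le> (1 + \<eta>) * real n" "(1 - \<eta>) * real n < S" using n by (simp_all add: S_def)
      have "2 / 3 * real n \<le> (1 - \<eta>) * real n" using \<eta> by (intro mult_right_mono) auto
      then have S23: "2 / 3 * real n < S" using S by linarith
      then have "0 < S" by (rule order.strict_trans1[rotated]) simp
      have "0 \<le> Z2 \<omega> (real n)" using Z2_nonneg \<omega> by (simp add: nonneg_process_def)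
      then have pos: "0 < Z2 \<omega> (real n)" "0 < B (e \<epsilon>)"
        using \<open>0 < S\<close> unfolding S_def by (auto simp: zero_less_mult_iff order.order_iff_strict)
      have "\<bar>S - real n\<bar> \<le> \<eta> * real n" using S by (auto simp: abs_le_iff algebra_simps)
      then have "\<bar>\<sigma> * x\<bar> * \<bar>S - real n\<bar> \<le> \<bar>\<sigma> * x\<bar> * (\<eta> * real n)" by (intro mult_left_mono) auto
      moreover have "\<bar>\<sigma> * x\<bar> = \<bar>x\<bar>" using \<sigma> by auto
      ultimately have "\<bar>\<sigma> * x * S - \<sigma> * x * real n\<bar> \<le> \<bar>x\<bar> * \<eta> * real n"
        unfolding right_diff_distrib[symmetric] abs_mult[of "\<sigma> * x"] by (simp add: mult.assoc)
      moreover have "y * real n = \<sigma> * x * real n + \<bar>x\<bar> * \<eta> * real n" unfolding y_def by (rule distrib_right)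
      ultimately have "\<sigma> * x * S < \<sigma> * (B (e \<epsilon>) * (Z1 \<omega> (real n) - real n * \<mu>))" using n(6) by linarith
      then have "B (e \<epsilon>) * (\<sigma> * (x * sqrt (Z2 \<omega> (real n)))) < B (e \<epsilon>) * (\<sigma> * (Z1 \<omega> (real n) - real n * \<mu>))"
        unfolding S_def by (simp only: mult_ac)
      then have "beyond \<sigma> x \<omega> n" using pos unfolding beyond_def by (simp only: mult_less_cancel_left_pos)
      then show "\<exists>n. T \<epsilon> \<omega> = enat n \<and> real n * e \<epsilon> \<le> real m \<and> 3 / real m < real n * e \<epsilon> \<and>
        real n \<le> 3 / 2 * B (e \<epsilon>) * sqrt (Z2 \<omega> (real n)) \<and> beyond \<sigma> x \<omega> n"
        using n(1-3) S23 unfolding S_def by (intro exI[of _ n] conjI) simp_all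
    qed
  qed
qed

end

end

section \<open>Local procedures\<close>

lemma INF_enat_mem:
  assumes "(INF n\<in>S. enat n) = enat k" shows "k \<in> S"
proof -
  have "enat ` S \<noteq> {}" using assms by (auto simp: Inf_enat_def)
  then have "(INF n\<in>S. enat n) \<in> enat ` S" unfolding Inf_enat_def by (auto intro: LeastI)
  then show ?thesis using assms by auto
qed

lemma less_INF_enat_not_mem:
  assumes "enat n < (INF n\<in>S. enat n)" shows "n \<notin> S"
  using assms INF_lower[of n S enat] by auto

lemma sqrt_div_square_less_iff:
  assumes "0 < n"
  shows "sqrt (z / (real n)\<^sup>2) < e \<longleftrightarrow> sqrt z < e * real n"
  using assms by (simp add: real_sqrt_divide field_simps)

lemma local_length_eqD:
  assumes "local_length \<nu> z e = enat n"
  shows "e powr (- \<nu>) < real n" "sqrt (z (real n) / (real n)\<^sup>2) < e"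
  using INF_enat_mem[OF assms[unfolded local_length_def]] by auto

lemma less_local_lengthD:
  assumes "enat n < local_length \<nu> z e" "e powr (- \<nu>) < real n"
  shows "e \<le> sqrt (z (real n) / (real n)\<^sup>2)"
  using less_INF_enat_not_mem[OF assms(1)[unfolded local_length_def]] assms(2) by auto

lemma local_length_leI:
  assumes "e powr (- \<nu>) < real n" "sqrt (z (real n) / (real n)\<^sup>2) < e"
  shows "local_length \<nu> z e \<le> enat n"
  unfolding local_length_def using assms by (intro INF_lower) auto

context sequential_limit
begin

lemma eventually_a_pos: "\<forall>\<^sub>F \<epsilon> in at_right 0. 0 < a \<epsilon>"
  using a_at_top by (simp add: filterlim_at_top_dense)

lemma scale_a: "filterlim (\<lambda>\<epsilon>. 1 / a \<epsilon>) (at_right 0) (at_right 0)"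
  using scale_at_right[of 1] by simp

lemma B_a: "((\<lambda>\<epsilon>. B (1 / a \<epsilon>) * \<epsilon>) \<longlongrightarrow> 1) (at_right 0)"
  using B_scale[of 1] by simp

lemma eventually_B_a: "\<forall>\<^sub>F \<epsilon> in at_right 0. 1 / 2 < B (1 / a \<epsilon>) * \<epsilon>" "\<forall>\<^sub>F \<epsilon> in at_right 0. B (1 / a \<epsilon>) * \<epsilon> < 4 / 3"
  by (rule order_tendstoD[OF B_a]; simp)+

text \<open>\<open>m\<close> is taken so large that scaled times up to \<open>3/m\<close> fall into
  the range excluded by the no-early-stopping condition. The boundary \<open>\<epsilon>\<close>,
  multiplied by \<open>B (1 / a \<epsilon>)\<close>, is eventually within \<open>1/m\<close> of
  level 1.\<close>

lemma local_crossing: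
  assumes "0 < \<gamma>"
  shows "\<exists>m0. \<forall>m\<ge>m0. \<forall>\<^sub>F \<epsilon> in at_right 0. whp M \<gamma> (crossing (1 / a \<epsilon>) m (\<lambda>\<omega>. local_length \<nu> (Z2 \<omega>) \<epsilon>))"
proof -
  obtain \<eta> where \<eta>: "0 < \<eta>" "\<forall>\<^sub>F \<epsilon> in at_right 0. whp M \<gamma>
    (\<lambda>\<omega>. \<forall>n. \<epsilon> powr (- \<nu>) \<le> real n \<longrightarrow> real n \<le> \<eta> * a \<epsilon> \<longrightarrow> 1 * \<epsilon> < sqrt (Z2 \<omega> (real n)) / real n)"
    using no_early_whp[of 1 \<gamma>] assms by auto
  obtain k :: nat where k: "3 / \<eta> < real k" using reals_Archimedean2 by blast
  have "\<forall>\<^sub>F \<epsilon> in at_right 0. whp M \<gamma> (crossing (1 / a \<epsilon>) m (\<lambda>\<omega>. local_length \<nu> (Z2 \<omega>) \<epsilon>))" if "k \<le> m" for m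
  proof -
    have "0 < 3 / \<eta>" using \<eta> by simp
    moreover have "real k \<le> real m" using that by simp
    ultimately have m: "0 < real m" "3 / \<eta> < real m" using k by linarith+
    have m\<eta>: "3 / real m < \<eta>" using m \<eta> by (simp add: field_simps)
    have "\<forall>\<^sub>F \<epsilon> in at_right 0. 1 - 1 / real m < B (1 / a \<epsilon>) * \<epsilon>" "\<forall>\<^sub>F \<epsilon> in at_right 0. B (1 / a \<epsilon>) * \<epsilon> < 1 + 1 / real m"
      using m by (auto intro!: order_tendstoD[OF B_a])
    \<comment> \<open>After scaled time \<open>3/m\<close> the minimal length no longer delays
      stopping, so not having stopped means not being below the boundary.\<close>
    moreover have "\<forall>\<^sub>F \<epsilon> in at_right 0. \<epsilon> powr (- \<nu>) < 3 / real m * a \<epsilon>" using m by (intro a_large) simp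
    ultimately show ?thesis
      using \<eta>(2) eventually_a_pos eventually_pos
    proof eventually_elim
      case (elim \<epsilon>)
      show ?case
      proof (rule whp_mono[OF elim(4) order_refl])
        fix \<omega> assume early: "\<forall>n. \<epsilon> powr (- \<nu>) \<le> real n \<longrightarrow> real n \<le> \<eta> * a \<epsilon> \<longrightarrow> 1 * \<epsilon> < sqrt (Z2 \<omega> (real n)) / real n"
        have Bpos: "0 \<le> B (1 / a \<epsilon>)"
        proof -
          have "1 / real m \<le> 1" using m by simp
          then have "0 < B (1 / a \<epsilon>) * \<epsilon>" using elim(1) by linarith
          then show ?thesis using elim(6) by (simp add: zero_less_mult_iff)
        qed
        have pos: "0 < n" if "\<epsilon> powr (- \<nu>) < real n" for n
          using that powr_ge_zero[of \<epsilon> "- \<nu>"] by linarith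
        show "crossing (1 / a \<epsilon>) m (\<lambda>\<omega>. local_length \<nu> (Z2 \<omega>) \<epsilon>) \<omega>"
          unfolding crossing_def
        proof (intro conjI allI impI)
          fix n assume T: "local_length \<nu> (Z2 \<omega>) \<epsilon> = enat n"
          note n = local_length_eqD[OF T]
          have less: "sqrt (Z2 \<omega> (real n)) < \<epsilon> * real n" using n(2) pos[OF n(1)] by (simp only: sqrt_div_square_less_iff)
          then have "sqrt (Z2 \<omega> (real n)) / real n < \<epsilon>" using pos[OF n(1)] by (simp add: field_simps)
          then have "\<eta> * a \<epsilon> < real n" using early[rule_format, of n] n(1) by linarith
          moreover have "3 / real m * a \<epsilon> \<le> \<eta> * a \<epsilon>" using m\<eta> elim(5) by (intro mult_right_mono) auto
          ultimately show "3 / real m < real n * (1 / a \<epsilon>)" using elim(5) by (simp add: pos_less_divide_eq)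
          have "B (1 / a \<epsilon>) * sqrt (Z2 \<omega> (real n)) \<le> B (1 / a \<epsilon>) * (\<epsilon> * real n)"
            using less Bpos by (intro mult_left_mono) auto
          also have "\<dots> = (B (1 / a \<epsilon>) * \<epsilon>) * real n" by simp
          also have "\<dots> \<le> (1 + 1 / real m) * real n" using elim(2) by (intro mult_right_mono) auto
          finally show "B (1 / a \<epsilon>) * sqrt (Z2 \<omega> (real n)) \<le> (1 + 1 / real m) * real n" .
        next
          fix n assume n: "3 / real m < real n * (1 / a \<epsilon>)" "enat n < local_length \<nu> (Z2 \<omega>) \<epsilon>"
          have n': "\<epsilon> powr (- \<nu>) < real n" using n(1) elim(3,5) by (simp add: pos_less_divide_eq)
          have "\<not> sqrt (Z2 \<omega> (real n)) < \<epsilon> * real n"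
            using less_local_lengthD[OF n(2) n'] sqrt_div_square_less_iff[OF pos[OF n'], of "Z2 \<omega> (real n)" \<epsilon>] by linarith
          then have "B (1 / a \<epsilon>) * (\<epsilon> * real n) \<le> B (1 / a \<epsilon>) * sqrt (Z2 \<omega> (real n))"
            using Bpos by (intro mult_left_mono) auto
          moreover have "(1 - 1 / real m) * real n \<le> (B (1 / a \<epsilon>) * \<epsilon>) * real n"
            using elim(1) by (intro mult_right_mono) auto
          ultimately show "(1 - 1 / real m) * real n \<le> B (1 / a \<epsilon>) * sqrt (Z2 \<omega> (real n))"
            by (simp add: mult.assoc)
        qed
      qed
    qed
  qed
  then show ?thesis by blast
qed

text \<open>The duration bound is carried along because recentring at the global average multiplies
  the error of that average by \<open>n / sqrt Z2\<close>.\<close>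

lemma local_statistic_limit:
  assumes F: "continuous_on UNIV F" and "0 < \<gamma>" and \<sigma>: "\<sigma> = 1 \<or> \<sigma> = -1"
  shows "\<forall>\<^sub>F \<epsilon> in at_right 0. whp M (tail \<sigma> x + \<gamma>) (\<lambda>\<omega>. \<exists>n. local_length \<nu> (Z2 \<omega>) \<epsilon> = enat n \<and>
      real n * \<epsilon> \<le> 2 * sqrt (Z2 \<omega> (real n)) \<and> beyond \<sigma> x \<omega> n)"
proof -
  \<comment> \<open>The constant 2 is \<open>3/2\<close> from \<open>stopped_statistic\<close> times
    the bound \<open>4/3\<close> for \<open>B (1 / a \<epsilon>) * \<epsilon>\<close>, whose limit
    is 1.\<close>
  have duration: "real n * \<epsilon> \<le> 2 * sqrt z"
    if "B (1 / a \<epsilon>) * \<epsilon> < 4 / 3" "0 < \<epsilon>" "0 < z" "real n \<le> 3 / 2 * B (1 / a \<epsilon>) * sqrt z" for n \<epsilon> z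
  proof -
    have "real n * \<epsilon> \<le> 3 / 2 * B (1 / a \<epsilon>) * sqrt z * \<epsilon>" using that by (intro mult_right_mono) auto
    also have "\<dots> = 3 / 2 * (B (1 / a \<epsilon>) * \<epsilon>) * sqrt z" by simp
    also have "\<dots> \<le> 3 / 2 * (4 / 3) * sqrt z" using that by (intro mult_right_mono mult_left_mono) auto
    finally show ?thesis by simp
  qed
  obtain m where "\<forall>\<^sub>F \<epsilon> in at_right 0. whp M (tail \<sigma> x + \<gamma>)
      (\<lambda>\<omega>. \<exists>n. local_length \<nu> (Z2 \<omega>) \<epsilon> = enat n \<and> real n * (1 / a \<epsilon>) \<le> real m \<and> 3 / real m < real n * (1 / a \<epsilon>) \<and>
        real n \<le> 3 / 2 * B (1 / a \<epsilon>) * sqrt (Z2 \<omega> (real n)) \<and> beyond \<sigma> x \<omega> n)"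
    using stopped_statistic[OF scale_a local_crossing F \<open>0 < \<gamma>\<close> \<sigma>, of x] by blast
  then show ?thesis
    using eventually_B_a(2) eventually_pos
  proof eventually_elim
    case (elim \<epsilon>)
    show ?case
      by (rule whp_mono[OF elim(1) order_refl]) (use duration[OF elim(2,3)] in \<open>unfold beyond_def, blast\<close>)
  qed
qed

text \<open>At scaled times in \<open>[\<kappa>/2, \<kappa>]\<close> the ratio
  \<open>sqrt Z2 / n\<close> is at most of order \<epsilon>, far below the local boundary
  \<open>\<epsilon> powr r\<close> because \<open>r < 1\<close>. Local runs are thus negligible on
  the global time scale, and arbitrarily many of them fit in.\<close>

lemma local_length_small:
  assumes r: "0 < r" "r < 1" and "0 < \<kappa>" "0 < \<gamma>"
  shows "\<forall>\<^sub>F \<epsilon> in at_right 0. whp M \<gamma> (\<lambda>\<omega>. \<exists>n. local_length \<nu> (Z2 \<omega>) (\<epsilon> powr r) = enat n \<and> real n \<le> \<kappa> * a \<epsilon>)"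
proof -
  obtain m where "\<forall>\<^sub>F e in at_right 0. whp M \<gamma> (\<lambda>\<omega>. \<forall>t\<ge>0. \<bar>t - 3 * \<kappa> / 4\<bar> \<le> \<kappa> / 4 \<longrightarrow> V2 e \<omega> t < real m)"
    using V2_tight[OF \<open>0 < \<gamma>\<close>, of "3 * \<kappa> / 4" "\<kappa> / 4"] by blast
  then have tight: "\<forall>\<^sub>F \<epsilon> in at_right 0. whp M \<gamma> (\<lambda>\<omega>. \<forall>t\<ge>0. \<bar>t - 3 * \<kappa> / 4\<bar> \<le> \<kappa> / 4 \<longrightarrow> V2 (1 / a \<epsilon>) \<omega> t < real m)"
    using scale_a by (rule eventually_compose_filterlim)
  have "\<forall>\<^sub>F \<epsilon> in at_right 0. 2 / \<kappa> < a \<epsilon>" using a_at_top by (simp add: filterlim_at_top_dense)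
  moreover have "\<forall>\<^sub>F \<epsilon> in at_right 0. \<epsilon> powr (- \<nu>) < \<kappa> / 2 * a \<epsilon>" using \<open>0 < \<kappa>\<close> by (intro a_large) simp
  moreover have "((\<lambda>\<epsilon>::real. \<epsilon> powr (1 - r)) \<longlongrightarrow> 0) (at_right 0)" using r by real_asymp
  then have "\<forall>\<^sub>F \<epsilon> in at_right 0. \<epsilon> powr (1 - r) < \<kappa> / (4 * (real m + 1))"
    using \<open>0 < \<kappa>\<close> by (intro order_tendstoD(2)) auto
  moreover have "\<forall>\<^sub>F \<epsilon>::real in at_right 0. \<epsilon> < 1" by (intro eventually_at_rightI[of 0 1]) auto
  ultimately show ?thesis
    using tight eventually_B_a(1) eventually_a_pos eventually_pos
  proof eventually_elim
    case (elim \<epsilon>)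
    define n where "n = nat \<lfloor>\<kappa> * a \<epsilon>\<rfloor>"
    have "0 \<le> \<kappa> * a \<epsilon>" using elim \<open>0 < \<kappa>\<close> by simp
    then have n: "real n \<le> \<kappa> * a \<epsilon>" "\<kappa> * a \<epsilon> < real n + 1" unfolding n_def by linarith+
    have "2 < \<kappa> * a \<epsilon>" using elim(1) \<open>0 < \<kappa>\<close> by (simp add: field_simps)
    then have n': "\<kappa> / 2 * a \<epsilon> \<le> real n" "0 < n" using n by linarith+
    define e where "e = 1 / a \<epsilon>"
    have e: "0 < e" using elim by (simp add: e_def)
    have t: "\<kappa> / 2 \<le> real n * e" "real n * e \<le> \<kappa>"
      using n(1) n'(1) elim(7) by (simp_all add: e_def field_simps)
    have "0 < B e * \<epsilon>" using elim(6) by (simp add: e_def)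
    then have Bpos: "0 < B e" using elim(8) by (simp add: zero_less_mult_iff)
    show ?case
    proof (rule whp_mono[OF elim(5) order_refl])
      fix \<omega> assume "\<forall>t\<ge>0. \<bar>t - 3 * \<kappa> / 4\<bar> \<le> \<kappa> / 4 \<longrightarrow> V2 (1 / a \<epsilon>) \<omega> t < real m"
      moreover have "0 \<le> real n * e" "\<bar>real n * e - 3 * \<kappa> / 4\<bar> \<le> \<kappa> / 4" using t \<open>0 < \<kappa>\<close> by linarith+
      ultimately have "V2 e \<omega> (real n * e) < real m" unfolding e_def by blast
      then have S: "B e * (e * sqrt (Z2 \<omega> (real n))) < real m + 1" using V2_grid[OF e] by (simp add: mult_ac)
      have "sqrt (Z2 \<omega> (real n)) < \<epsilon> powr r * real n"
      proof (rule ccontr)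
        assume "\<not> sqrt (Z2 \<omega> (real n)) < \<epsilon> powr r * real n"
        then have "B e * (e * (\<epsilon> powr r * real n)) \<le> B e * (e * sqrt (Z2 \<omega> (real n)))"
          using Bpos e by (intro mult_left_mono) auto
        moreover have "B e * (\<epsilon> powr r * (\<kappa> / 2)) \<le> B e * (\<epsilon> powr r * (real n * e))"
          using Bpos t by (intro mult_left_mono) auto
        ultimately have "B e * (\<epsilon> powr r * (\<kappa> / 2)) < real m + 1" using S by (simp add: mult_ac)
        then have "B e * (\<epsilon> powr r * (\<kappa> / 2)) * \<epsilon> powr (1 - r) \<le> (real m + 1) * \<epsilon> powr (1 - r)"
          by (intro mult_right_mono) auto
        also have "\<dots> < (real m + 1) * (\<kappa> / (4 * (real m + 1)))" using elim(3) by (intro mult_strict_left_mono) auto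
        also have "\<dots> = \<kappa> / 4" by (simp add: field_simps)
        finally have "B e * (\<epsilon> powr r * \<epsilon> powr (1 - r)) * (\<kappa> / 2) < \<kappa> / 4" by (simp add: mult_ac)
        moreover have "\<epsilon> powr r * \<epsilon> powr (1 - r) = \<epsilon>" using elim(8) by (simp add: powr_add[symmetric])
        ultimately have "B e * \<epsilon> * (\<kappa> / 2) < \<kappa> / 4" by simp
        moreover have "1 / 2 * (\<kappa> / 2) \<le> B e * \<epsilon> * (\<kappa> / 2)" using elim(6) \<open>0 < \<kappa>\<close> by (intro mult_right_mono) (auto simp: e_def)
        ultimately show False by linarith
      qed
      moreover have "(\<epsilon> powr r) powr (- \<nu>) \<le> \<epsilon> powr (- \<nu>)"
      proof -
        have "r * \<nu> \<le> \<nu>" using r nu by simp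
        then show ?thesis using elim by (simp add: powr_powr powr_mono')
      qed
      ultimately have "local_length \<nu> (Z2 \<omega>) (\<epsilon> powr r) \<le> enat n"
        using n' elim(2) by (intro local_length_leI) (auto simp: sqrt_div_square_less_iff)
      then show "\<exists>n. local_length \<nu> (Z2 \<omega>) (\<epsilon> powr r) = enat n \<and> real n \<le> \<kappa> * a \<epsilon>"
        using n(1) by (cases "local_length \<nu> (Z2 \<omega>) (\<epsilon> powr r)") auto
    qed
  qed
qed

text \<open>Tightness over a window bounds the scaled path for all \<open>n\<close> at once. The
  restriction \<open>n \<ge> \<kappa> * a \<epsilon>\<close> turns this into an error proportional
  to \<open>n\<close>, and the bound \<open>1/2\<close> for
  \<open>B (1 / a \<epsilon>) * \<epsilon>\<close> accounts for the 2 in \<open>C\<close>.\<close>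

lemma mean_error_bound:
  assumes "0 < \<kappa>" "0 < \<gamma>"
  shows "\<exists>C>0. \<forall>\<^sub>F \<epsilon> in at_right 0. whp M \<gamma>
    (\<lambda>\<omega>. \<forall>n. \<kappa> * a \<epsilon> \<le> real n \<longrightarrow> real n \<le> K * a \<epsilon> \<longrightarrow> \<bar>Z1 \<omega> (real n) - real n * \<mu>\<bar> \<le> C * \<epsilon> * real n)"
proof -
  obtain m where "\<forall>\<^sub>F e in at_right 0. whp M \<gamma> (\<lambda>\<omega>. \<forall>t\<ge>0. \<bar>t - K / 2\<bar> \<le> K / 2 \<longrightarrow> \<bar>V1 e \<omega> t\<bar> < real m)"
    using V1_tight[OF \<open>0 < \<gamma>\<close>, of "K / 2" "K / 2"] by blast
  then have tight: "\<forall>\<^sub>F \<epsilon> in at_right 0. whp M \<gamma> (\<lambda>\<omega>. \<forall>t\<ge>0. \<bar>t - K / 2\<bar> \<le> K / 2 \<longrightarrow> \<bar>V1 (1 / a \<epsilon>) \<omega> t\<bar> < real m)"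
    using scale_a by (rule eventually_compose_filterlim)
  define C where "C = 2 * (real m + 1) / \<kappa>"
  have "\<forall>\<^sub>F \<epsilon> in at_right 0. whp M \<gamma>
    (\<lambda>\<omega>. \<forall>n. \<kappa> * a \<epsilon> \<le> real n \<longrightarrow> real n \<le> K * a \<epsilon> \<longrightarrow> \<bar>Z1 \<omega> (real n) - real n * \<mu>\<bar> \<le> C * \<epsilon> * real n)"
    using tight eventually_B_a(1) eventually_a_pos eventually_pos
  proof eventually_elim
    case (elim \<epsilon>)
    define e where "e = 1 / a \<epsilon>"
    have e: "0 < e" using elim by (simp add: e_def)
    have "0 < B e * \<epsilon>" using elim(2) by (simp add: e_def)
    then have Bpos: "0 < B e" using elim(4) by (simp add: zero_less_mult_iff)
    show ?case
    proof (rule whp_mono[OF elim(1) order_refl], intro allI impI)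
      fix \<omega> n assume *: "\<forall>t\<ge>0. \<bar>t - K / 2\<bar> \<le> K / 2 \<longrightarrow> \<bar>V1 (1 / a \<epsilon>) \<omega> t\<bar> < real m"
        and n: "\<kappa> * a \<epsilon> \<le> real n" "real n \<le> K * a \<epsilon>"
      have t: "\<kappa> \<le> real n * e" "real n * e \<le> K" using n elim(3) by (simp_all add: e_def field_simps)
      have t0: "0 \<le> real n * e" using t assms by linarith
      then have "\<bar>real n * e - K / 2\<bar> \<le> K / 2" using t by linarith
      then have "\<bar>V1 e \<omega> (real n * e)\<bar> < real m" using * t0 unfolding e_def by blast
      then have "B e * e * \<bar>Z1 \<omega> (real n) - real n * \<mu>\<bar> < real m + 1"
        using Bpos e by (simp add: V1_grid abs_mult)
      also have "\<dots> = C / 2 * \<kappa>" using assms by (simp add: C_def)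
      also have "\<dots> \<le> C / 2 * (real n * e)" using t(1) assms by (intro mult_left_mono) (auto simp: C_def)
      also have "\<dots> = C * real n * e * (1 / 2)" by simp
      also have "\<dots> \<le> C * real n * e * (B e * \<epsilon>)" using elim(2) assms e by (intro mult_left_mono) (auto simp: C_def e_def)
      finally have "(B e * e) * \<bar>Z1 \<omega> (real n) - real n * \<mu>\<bar> < (B e * e) * (C * \<epsilon> * real n)" by (simp add: mult_ac)
      then show "\<bar>Z1 \<omega> (real n) - real n * \<mu>\<bar> \<le> C * \<epsilon> * real n" using Bpos e by simp
    qed
  qed
  moreover have "0 < C" using assms by (simp add: C_def)
  ultimately show ?thesis by blast
qed

end

section \<open>Empirical quantiles of the local statistics\<close>

lemma (in prob_space) iid_frequency_tail:
  fixes X :: "nat \<Rightarrow> 'a \<Rightarrow> 'c"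
  assumes indep: "indep_vars (\<lambda>_. S) X {1..}" and A: "A \<in> sets S"
    and p: "\<And>j. 1 \<le> j \<Longrightarrow> p \<le> prob {\<omega> \<in> space M. X j \<omega> \<in> A}"
    and "q + d \<le> p" "0 < d" and b: "1 \<le> b"
  shows "{\<omega> \<in> space M. (\<Sum>j=1..b. of_bool (X j \<omega> \<in> A)) \<le> q * real b} \<in> events" (is "?E \<in> _")
    and "prob {\<omega> \<in> space M. (\<Sum>j=1..b. of_bool (X j \<omega> \<in> A)) \<le> q * real b} \<le> exp (- 2 * d\<^sup>2) ^ b"
proof -
  define I where "I = (\<lambda>j \<omega>. indicat_real A (X j \<omega>))"
  have X [measurable]: "X j \<in> M \<rightarrow>\<^sub>M S" if "1 \<le> j" for j
    using indep that unfolding indep_vars_def by auto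
  have I_ind: "indep_vars (\<lambda>_. borel) I {1..b}"
    unfolding I_def
    by (rule indep_vars_compose2[where M' = "\<lambda>_. S"], rule indep_vars_subset[OF indep])
      (use A in auto)
  interpret H: Hoeffding_ineq M "{1..b}" I "\<lambda>_. 0" "\<lambda>_. 1" "\<Sum>j=1..b. expectation (I j)"
  proof unfold_locales
    show "indep_vars (\<lambda>_. borel) I {1..b}" by (rule I_ind)
    show "AE \<omega> in M. I j \<omega> \<in> {0..1}" for j by (simp add: I_def indicator_def)
  qed simp
  have sum_eq: "(\<Sum>j=1..b. of_bool (X j \<omega> \<in> A)) = (\<Sum>j=1..b. I j \<omega>)" for \<omega>
    by (simp add: I_def indicator_def of_bool_def)
  have I_meas: "I j \<in> borel_measurable M" if "j \<in> {1..b}" for j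
    using I_ind that unfolding indep_vars_def by auto
  have "(\<lambda>\<omega>. \<Sum>j=1..b. I j \<omega>) \<in> borel_measurable M" using I_meas by (rule borel_measurable_sum)
  then show "?E \<in> events" unfolding sum_eq by measurable
  have exp: "p \<le> expectation (I j)" if "j \<in> {1..b}" for j
  proof -
    have ev: "{\<omega> \<in> space M. X j \<omega> \<in> A} \<in> events" using measurable_sets[OF X A] that by (simp add: vimage_def Int_def conj_commute)
    have "expectation (I j) = expectation (indicat_real {\<omega> \<in> space M. X j \<omega> \<in> A})"
      by (intro Bochner_Integration.integral_cong) (auto simp: I_def indicator_def)
    then show ?thesis using p[of j] ev that by simp
  qed
  have "real b * p = (\<Sum>j=1..b. p)" by simp
  also have "\<dots> \<le> (\<Sum>j=1..b. expectation (I j))" by (rule sum_mono[OF exp])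
  finally have mean: "real b * p \<le> (\<Sum>j=1..b. expectation (I j))" .
  have "real b * (q + d) \<le> real b * p" using assms by (intro mult_left_mono) auto
  then have "q * real b \<le> (\<Sum>j=1..b. expectation (I j)) - d * real b"
    using mean by (simp add: algebra_simps)
  then have "prob ?E \<le> prob {\<omega> \<in> space M. (\<Sum>j=1..b. I j \<omega>) \<le> (\<Sum>j=1..b. expectation (I j)) - d * real b}"
    unfolding sum_eq using I_meas by (intro finite_measure_mono) auto
  also have "\<dots> \<le> exp (- 2 * (d * real b)\<^sup>2 / (\<Sum>j=1..b. (1 - 0)\<^sup>2))"
    using b \<open>0 < d\<close> by (intro H.Hoeffding_ineq_le) auto
  also have "\<dots> = exp (real b * (- 2 * d\<^sup>2))"
    using b by (simp add: power2_eq_square)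
  also have "\<dots> = exp (- 2 * d\<^sup>2) ^ b" by (rule exp_of_nat_mult)
  finally show "prob ?E \<le> exp (- 2 * d\<^sup>2) ^ b" .
qed

text \<open>Hoeffding bounds decay geometrically in the sample size, so a union bound covers all
  sizes \<open>b \<ge> b0\<close> simultaneously. This prepares for a sample size that is random and
  depends on the same streams.\<close>

lemma (in prob_space) iid_frequency:
  fixes X :: "nat \<Rightarrow> 'a \<Rightarrow> 'c"
  assumes indep: "indep_vars (\<lambda>_. S) X {1..}" and A: "A \<in> sets S"
    and p: "\<And>j. 1 \<le> j \<Longrightarrow> p \<le> prob {\<omega> \<in> space M. X j \<omega> \<in> A}"
    and d: "q + d \<le> p" "0 < d" and b0: "1 \<le> b0" "exp (- 2 * d\<^sup>2) ^ b0 / (1 - exp (- 2 * d\<^sup>2)) \<le> \<gamma>"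
  shows "whp M \<gamma> (\<lambda>\<omega>. \<forall>b\<ge>b0. q * real b < (\<Sum>j=1..b. of_bool (X j \<omega> \<in> A)))"
proof -
  define E where "E i = {\<omega> \<in> space M. (\<Sum>j=1..b0 + i. of_bool (X j \<omega> \<in> A)) \<le> q * real (b0 + i)}" for i
  define x where "x = exp (- 2 * d\<^sup>2)"
  have x: "0 < x" "x < 1" using d by (auto simp: x_def)
  have E: "E i \<in> events" "prob (E i) \<le> x ^ (b0 + i)" for i
    unfolding E_def x_def using b0(1) by (intro iid_frequency_tail[OF indep A p d]; simp)+
  have sums: "(\<lambda>i. x ^ (b0 + i)) sums (x ^ b0 * (1 / (1 - x)))"
    unfolding power_add using x by (intro sums_mult geometric_sums) auto
  have summ: "summable (\<lambda>i. prob (E i))"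
    by (rule summable_comparison_test'[OF sums_summable[OF sums], of 0]) (use E in auto)
  have "prob (\<Union>i. E i) \<le> (\<Sum>i. prob (E i))"
    using E summ by (intro finite_measure_subadditive_countably) auto
  also have "\<dots> \<le> (\<Sum>i. x ^ (b0 + i))"
    by (rule suminf_le[OF E(2) summ sums_summable[OF sums]])
  also have "\<dots> = x ^ b0 / (1 - x)" using sums_unique[OF sums] by simp
  also have "\<dots> \<le> \<gamma>" using b0(2) by (simp add: x_def)
  finally have "prob (\<Union>i. E i) \<le> \<gamma>" .
  moreover have "(\<Union>i. E i) \<in> events" using E by auto
  moreover have "\<forall>b\<ge>b0. q * real b < (\<Sum>j=1..b. of_bool (X j \<omega> \<in> A))" if \<omega>: "\<omega> \<in> space M - (\<Union>i. E i)" for \<omega>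
  proof (intro allI impI)
    fix b assume "b0 \<le> b"
    then obtain i where "b = b0 + i" using le_iff_add by blast
    moreover have "\<omega> \<notin> E i" using \<omega> by blast
    ultimately show "q * real b < (\<Sum>j=1..b. of_bool (X j \<omega> \<in> A))"
      using \<omega> by (simp add: E_def not_le)
  qed
  ultimately show ?thesis unfolding whp_def by blast
qed

lemma geometric_tail_small:
  assumes "0 < d" "0 < \<gamma>"
  shows "\<exists>b0\<ge>1. exp (- 2 * d\<^sup>2) ^ b0 / (1 - exp (- 2 * d\<^sup>2)) \<le> (\<gamma>::real)"
proof -
  define x :: real where "x = exp (- 2 * d\<^sup>2)"
  have x: "0 < x" "x < 1" using assms by (auto simp: x_def)
  have "(\<lambda>b. x ^ b / (1 - x)) \<longlonglongrightarrow> 0 / (1 - x)" using x by (intro tendsto_intros LIMSEQ_power_zero) auto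
  then have "\<forall>\<^sub>F b in sequentially. x ^ b / (1 - x) < \<gamma>" using assms by (intro order_tendstoD(2)) auto
  then obtain k where "\<And>b. k \<le> b \<Longrightarrow> x ^ b / (1 - x) < \<gamma>" unfolding eventually_sequentially by blast
  then show ?thesis unfolding x_def[symmetric] by (intro exI[of _ "max 1 k"]) (simp add: less_imp_le)
qed

section \<open>Elementary properties of the procedure as a function of one realization\<close>

lemma INF_enat_eq_iff:
  "(INF n\<in>{n. P n}. enat n) = enat k \<longleftrightarrow> P k \<and> (\<forall>i<k. \<not> P i)"
proof
  assume *: "(INF n\<in>{n. P n}. enat n) = enat k"
  have "\<not> P i" if "i < k" for i
    using less_INF_enat_not_mem[of i "{n. P n}"] that unfolding * by simp
  then show "P k \<and> (\<forall>i<k. \<not> P i)" using INF_enat_mem[OF *] by simp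
next
  assume *: "P k \<and> (\<forall>i<k. \<not> P i)"
  show "(INF n\<in>{n. P n}. enat n) = enat k"
  proof (rule antisym)
    show "(INF n\<in>{n. P n}. enat n) \<le> enat k" using * by (intro INF_lower) simp
    show "enat k \<le> (INF n\<in>{n. P n}. enat n)" using * by (intro INF_greatest) (simp, meson not_less)
  qed
qed

lemma quantile_between:
  assumes mono: "\<And>x y. x \<le> y \<Longrightarrow> G x \<le> G y" and "G lo < p" "p \<le> G hi"
  shows "lo \<le> quantile G p" "quantile G p \<le> hi"
proof -
  have ge: "lo \<le> x" if "p \<le> G x" for x
    using mono[of x lo] assms(2) that by linarith
  show "lo \<le> quantile G p"
    unfolding quantile_def using assms(3) ge by (intro cInf_greatest) auto
  show "quantile G p \<le> hi"
    unfolding quantile_def using assms(3) ge by (intro cInf_lower bdd_belowI[of _ lo]) auto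
qed

lemma local_length_ge_1:
  assumes "0 < e" shows "1 \<le> local_length \<nu> z e"
  unfolding local_length_def one_enat_def
proof (rule INF_greatest)
  fix n assume "n \<in> {n. e powr (- \<nu>) < real n \<and> sqrt (z (real n) / (real n)\<^sup>2) < e}"
  then have "e powr (- \<nu>) < real n" by simp
  moreover have "0 < e powr (- \<nu>)" using assms by simp
  ultimately have "0 < n" by linarith
  then show "enat 1 \<le> enat n" by simp
qed

lemma finite_completed_set:
  assumes "0 < \<epsilon>"
  shows "finite {b::nat. (\<Sum>j=1..b. local_length \<nu> (w2 j) (\<epsilon> powr r)) \<le> enat n}"
proof (rule finite_subset)
  show "{b::nat. (\<Sum>j=1..b. local_length \<nu> (w2 j) (\<epsilon> powr r)) \<le> enat n} \<subseteq> {..n}"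
  proof safe
    fix b :: nat assume b: "(\<Sum>j=1..b. local_length \<nu> (w2 j) (\<epsilon> powr r)) \<le> enat n"
    have "of_nat b = (\<Sum>j=1..b. 1::enat)" by simp
    also have "\<dots> \<le> (\<Sum>j=1..b. local_length \<nu> (w2 j) (\<epsilon> powr r))"
      using assms by (intro sum_mono local_length_ge_1) simp
    also note b
    finally show "b \<le> n" by (simp add: of_nat_eq_enat)
  qed
qed simp

lemma completed_ge:
  assumes "0 < \<epsilon>" "(\<Sum>j=1..b. local_length \<nu> (w2 j) (\<epsilon> powr r)) \<le> enat n"
  shows "b \<le> completed \<nu> r w2 \<epsilon> n"
  unfolding completed_def using assms by (intro Max_ge finite_completed_set) auto

lemma completed_sum_le:
  assumes "0 < \<epsilon>"
  shows "(\<Sum>j=1..completed \<nu> r w2 \<epsilon> n. local_length \<nu> (w2 j) (\<epsilon> powr r)) \<le> enat n"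
proof -
  have "completed \<nu> r w2 \<epsilon> n \<in> {b. (\<Sum>j=1..b. local_length \<nu> (w2 j) (\<epsilon> powr r)) \<le> enat n}"
    unfolding completed_def using assms by (intro Max_in finite_completed_set) (auto intro!: exI[of _ 0])
  then show ?thesis by simp
qed

lemma completed_ge_of_short:
  assumes "0 < \<epsilon>" "1 \<le> b"
    and short: "\<And>j. j \<in> {1..b} \<Longrightarrow> \<exists>k. local_length \<nu> (w2 j) (\<epsilon> powr r) = enat k \<and> real k \<le> K / real b"
    and "K \<le> real n"
  shows "b \<le> completed \<nu> r w2 \<epsilon> n"
proof (rule completed_ge[OF assms(1)])
  obtain k where k: "\<And>j. j \<in> {1..b} \<Longrightarrow> local_length \<nu> (w2 j) (\<epsilon> powr r) = enat (k j) \<and> real (k j) \<le> K / real b"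
    using short by metis
  have "(\<Sum>j=1..b. local_length \<nu> (w2 j) (\<epsilon> powr r)) = (\<Sum>j=1..b. of_nat (k j))"
    using k by (intro sum.cong) (auto simp: of_nat_eq_enat)
  also have "\<dots> = of_nat (\<Sum>j=1..b. k j)" by (rule of_nat_sum[symmetric])
  also have "\<dots> = enat (\<Sum>j=1..b. k j)" by (rule of_nat_eq_enat)
  also have "real (\<Sum>j=1..b. k j) \<le> (\<Sum>j=1..b. K / real b)"
    using k by (simp only: of_nat_sum) (intro sum_mono, auto)
  then have "real (\<Sum>j=1..b. k j) \<le> real n" using assms by simp
  then have "enat (\<Sum>j=1..b. k j) \<le> enat n" by (simp only: of_nat_le_iff enat_ord_simps)
  finally show "(\<Sum>j=1..b. local_length \<nu> (w2 j) (\<epsilon> powr r)) \<le> enat n" .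
qed

lemma empirical_cdf_mono:
  "x \<le> y \<Longrightarrow> empirical_cdf \<nu> r z1 w1 w2 \<epsilon> n x \<le> empirical_cdf \<nu> r z1 w1 w2 \<epsilon> n y"
  unfolding empirical_cdf_def by (intro divide_right_mono sum_mono) auto

text \<open>Replacing the unknown mean \<open>\<mu>\<close> by the global average perturbs a local statistic by at most
  the local duration \<open>k / sqrt (w2 k)\<close> times the error of the global average.\<close>

lemma local_statistic_perturbation:
  assumes len: "local_length \<nu> (w2 j) (\<epsilon> powr r) = enat k" and "0 < w2 j (real k)"
    and dur: "real k * \<epsilon> powr r \<le> 2 * sqrt (w2 j (real k))"
    and err: "\<bar>z1 (real n) - real n * \<mu>\<bar> \<le> C * \<epsilon> * real n" and "0 < n" "0 < \<epsilon>"
    and small: "2 * C * \<epsilon> powr (1 - r) \<le> \<xi>"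
  shows "\<bar>local_statistic \<nu> r z1 w1 w2 \<epsilon> n j - (w1 j (real k) - real k * \<mu>) / sqrt (w2 j (real k))\<bar> \<le> \<xi>"
proof -
  define s where "s = sqrt (w2 j (real k))"
  have s: "0 < s" using assms by (simp add: s_def)
  have "local_statistic \<nu> r z1 w1 w2 \<epsilon> n j - (w1 j (real k) - real k * \<mu>) / s =
      - (real k / s * ((z1 (real n) - real n * \<mu>) / real n))"
    using s \<open>0 < n\<close> by (simp add: local_statistic_def Let_def len s_def[symmetric] field_simps)
  then have "\<bar>local_statistic \<nu> r z1 w1 w2 \<epsilon> n j - (w1 j (real k) - real k * \<mu>) / s\<bar> =
      real k / s * (\<bar>z1 (real n) - real n * \<mu>\<bar> / real n)"
    using s by (simp add: abs_mult)
  also have "\<dots> \<le> (2 / \<epsilon> powr r) * (C * \<epsilon>)"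
  proof (rule mult_mono)
    show "real k / s \<le> 2 / \<epsilon> powr r" using dur s \<open>0 < \<epsilon>\<close> by (simp add: s_def[symmetric] field_simps)
    show "\<bar>z1 (real n) - real n * \<mu>\<bar> / real n \<le> C * \<epsilon>" using err \<open>0 < n\<close> by (simp add: field_simps)
  qed (use s in auto)
  also have "\<dots> = 2 * C * \<epsilon> powr (1 - r)" using \<open>0 < \<epsilon>\<close> by (simp add: powr_diff)
  finally show ?thesis using small by (simp add: s_def)
qed

locale subsampling = sequential_limit N Y1 Y2 h M Z1 Z2 \<mu> \<nu> l A_inv
  for N :: "'b measure" and Y1 Y2 :: "'b process" and h :: real and M :: "'a measure"
    and Z1 Z2 :: "'a process" and \<mu> \<nu> :: real and l A_inv :: "real \<Rightarrow> real" +
  fixes L1 L2 :: "nat \<Rightarrow> 'a process" and r :: real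
  assumes streams: "independent_copies M Z1 Z2 L1 L2"
    and r: "0 < r" "r < 1"
    and F_cont: "continuous_on UNIV F"
begin

section \<open>Transfer of estimates from the global stream to the local ones\<close>

lemma streams_indep: "M.indep_vars (\<lambda>_. path_space) (\<lambda>j. joint_path (L1 j) (L2 j)) {1..}"
proof -
  have "M.indep_vars (\<lambda>_. path_space) (\<lambda>j. if j = 0 then joint_path Z1 Z2 else joint_path (L1 j) (L2 j)) {1..}"
    using streams unfolding independent_copies_def by (blast intro: M.indep_vars_subset)
  then show ?thesis by (subst M.indep_vars_cong[OF refl _ refl]) auto
qed

lemma joint_path_L_measurable: "1 \<le> j \<Longrightarrow> joint_path (L1 j) (L2 j) \<in> M \<rightarrow>\<^sub>M path_space"
  using streams_indep unfolding M.indep_vars_def by auto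

lemma joint_path_Z_measurable: "joint_path Z1 Z2 \<in> M \<rightarrow>\<^sub>M path_space"
  by (intro joint_path_measurable cadlag_process_measurable[OF Z1] cadlag_process_measurable[OF Z2])

lemma law_transfer:
  assumes A: "A \<in> sets path_space" and j: "1 \<le> j"
  shows "M.prob {\<omega> \<in> space M. joint_path (L1 j) (L2 j) \<omega> \<in> A} = M.prob {\<omega> \<in> space M. joint_path Z1 Z2 \<omega> \<in> A}"
proof -
  have "measure (joint_law M (L1 j) (L2 j)) A = measure (joint_law M Z1 Z2) A"
    using streams j unfolding independent_copies_def by simp
  then show ?thesis
    unfolding joint_law_def
    by (simp add: measure_distr[OF joint_path_L_measurable[OF j] A] measure_distr[OF joint_path_Z_measurable A]
        vimage_def Int_def conj_commute)
qed

text \<open>A set of paths rather than of outcomes, so that estimates for the global stream transfer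
  to every local one through the equality of laws.\<close>

definition stat_event :: "real \<Rightarrow> real \<Rightarrow> real \<Rightarrow> (real \<Rightarrow> real \<times> real) set" where
  "stat_event \<sigma> e x = {p \<in> space path_space. \<exists>k. local_length \<nu> (\<lambda>t. snd (p t)) e = enat k \<and> 0 < snd (p (real k)) \<and>
     real k * e \<le> 2 * sqrt (snd (p (real k))) \<and> \<sigma> * (x * sqrt (snd (p (real k)))) < \<sigma> * (fst (p (real k)) - real k * \<mu>)}"

definition short_event :: "real \<Rightarrow> real \<Rightarrow> (real \<Rightarrow> real \<times> real) set" where
  "short_event C e = {p \<in> space path_space. \<exists>k. local_length \<nu> (\<lambda>t. snd (p t)) e = enat k \<and> real k \<le> C}"

lemma path_space_component:
  "(\<lambda>p. fst (p (real k))) \<in> borel_measurable path_space" "(\<lambda>p. snd (p (real k))) \<in> borel_measurable path_space"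
proof -
  have "(\<lambda>p. p (real k)) \<in> path_space \<rightarrow>\<^sub>M (borel :: (real \<times> real) measure)"
    unfolding path_space_def by (rule measurable_component_singleton) simp
  then show "(\<lambda>p. fst (p (real k))) \<in> borel_measurable path_space" "(\<lambda>p. snd (p (real k))) \<in> borel_measurable path_space"
    by (auto intro: measurable_compose simp: borel_prod[symmetric])
qed

text \<open>Only values at integer times occur, and \<open>INF_enat_eq_iff\<close> expresses the
  local length by countably many conditions on them.\<close>

lemma path_events:
  "stat_event \<sigma> e x \<in> sets path_space" "short_event C e \<in> sets path_space"
proof -
  note [measurable] = path_space_component
  show "stat_event \<sigma> e x \<in> sets path_space" "short_event C e \<in> sets path_space"
    unfolding stat_event_def short_event_def local_length_def INF_enat_eq_iff by measurable
qed

lemma joint_path_at: "joint_path X1 X2 \<omega> (real k) = (X1 \<omega> (real k), X2 \<omega> (real k))"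
  by (simp add: joint_path_def)

lemma local_length_joint_path: "local_length \<nu> (\<lambda>t. snd (joint_path X1 X2 \<omega> t)) e = local_length \<nu> (X2 \<omega>) e"
  by (simp add: local_length_def joint_path_at)

lemma prob_ge_of_whp:
  assumes "whp M \<gamma> (\<lambda>\<omega>. \<omega> \<in> space M \<and> joint_path Z1 Z2 \<omega> \<in> A)" and A: "A \<in> sets path_space" and "1 \<le> j"
  shows "1 - \<gamma> \<le> M.prob {\<omega> \<in> space M. joint_path (L1 j) (L2 j) \<omega> \<in> A}"
proof -
  have ev: "{\<omega> \<in> space M. joint_path Z1 Z2 \<omega> \<in> A} \<in> M.events"
    using measurable_sets[OF joint_path_Z_measurable A] by (simp add: vimage_def Int_def conj_commute)
  have "M.prob {\<omega> \<in> space M. joint_path Z1 Z2 \<omega> \<notin> A} \<le> \<gamma>"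
    by (rule M.whp_imp_prob_le[OF assms(1)]) simp
  moreover have "M.prob {\<omega> \<in> space M. joint_path Z1 Z2 \<omega> \<notin> A} = 1 - M.prob {\<omega> \<in> space M. joint_path Z1 Z2 \<omega> \<in> A}"
    using M.prob_neg[OF ev] by simp
  ultimately show ?thesis using law_transfer[OF A \<open>1 \<le> j\<close>] by simp
qed

lemma rate_at_right: "filterlim (\<lambda>\<epsilon>::real. \<epsilon> powr r) (at_right 0) (at_right 0)"
  using r by real_asymp

lemma space_Z: "\<omega> \<in> space M \<Longrightarrow> joint_path Z1 Z2 \<omega> \<in> space path_space"
  using measurable_space[OF joint_path_Z_measurable] .

lemma stat_event_prob:
  assumes "0 < \<gamma>" and \<sigma>: "\<sigma> = 1 \<or> \<sigma> = -1"
  shows "\<forall>\<^sub>F \<epsilon> in at_right 0. \<forall>j\<ge>1.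
    1 - (tail \<sigma> x + \<gamma>) \<le> M.prob {\<omega> \<in> space M. joint_path (L1 j) (L2 j) \<omega> \<in> stat_event \<sigma> (\<epsilon> powr r) x}"
  using eventually_compose_filterlim[OF local_statistic_limit[OF F_cont assms, of x] rate_at_right]
proof eventually_elim
  case (elim \<epsilon>)
  show ?case
  proof (intro allI impI prob_ge_of_whp path_events)
    show "whp M (tail \<sigma> x + \<gamma>) (\<lambda>\<omega>. \<omega> \<in> space M \<and> joint_path Z1 Z2 \<omega> \<in> stat_event \<sigma> (\<epsilon> powr r) x)"
      by (rule whp_mono[OF elim order_refl])
        (auto simp: stat_event_def beyond_def local_length_joint_path joint_path_at space_Z)
  qed
qed

definition procs :: "real \<Rightarrow> 'a \<Rightarrow> nat \<Rightarrow> nat" where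
  "procs \<epsilon> \<omega> n = completed \<nu> r (\<lambda>j. L2 j \<omega>) \<epsilon> n"

definition emp_quantile :: "real \<Rightarrow> real \<Rightarrow> 'a \<Rightarrow> nat \<Rightarrow> real" where
  "emp_quantile p \<epsilon> \<omega> n =
     quantile (empirical_cdf \<nu> r (Z1 \<omega>) (\<lambda>j. L1 j \<omega>) (\<lambda>j. L2 j \<omega>) \<epsilon> n) p"

text \<open>It suffices that each of the first \<open>b\<close> runs uses at most the share
  \<open>\<kappa> * a \<epsilon> / b\<close> of the time. For fixed \<open>b\<close> this is a union
  bound over \<open>b\<close> instances of \<open>local_length_small\<close>.\<close>

lemma completed_large:
  assumes "0 < \<kappa>" "0 < \<gamma>" "1 \<le> b"
  shows "\<forall>\<^sub>F \<epsilon> in at_right 0. whp M \<gamma> (\<lambda>\<omega>. \<forall>n. \<kappa> * a \<epsilon> \<le> real n \<longrightarrow> b \<le> procs \<epsilon> \<omega> n)"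
proof -
  have "0 < \<kappa> / real b" "0 < \<gamma> / real b" using assms by auto
  from local_length_small[OF r this] show ?thesis
    using eventually_pos
  proof eventually_elim
    case (elim \<epsilon>)
    define A where "A = short_event (\<kappa> / real b * a \<epsilon>) (\<epsilon> powr r)"
    have "whp M (\<gamma> / real b) (\<lambda>\<omega>. \<exists>k. local_length \<nu> (L2 j \<omega>) (\<epsilon> powr r) = enat k \<and> real k \<le> \<kappa> / real b * a \<epsilon>)"
      if j: "1 \<le> j" for j
    proof -
      have A: "A \<in> sets path_space" unfolding A_def by (rule path_events)
      have "1 - \<gamma> / real b \<le> M.prob {\<omega> \<in> space M. joint_path (L1 j) (L2 j) \<omega> \<in> A}"
      proof (rule prob_ge_of_whp[OF _ A j])
        show "whp M (\<gamma> / real b) (\<lambda>\<omega>. \<omega> \<in> space M \<and> joint_path Z1 Z2 \<omega> \<in> A)"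
          by (rule whp_mono[OF elim(1) order_refl]) (auto simp: A_def short_event_def local_length_joint_path space_Z)
      qed
      moreover have ev: "{\<omega> \<in> space M. joint_path (L1 j) (L2 j) \<omega> \<in> A} \<in> M.events"
        using measurable_sets[OF joint_path_L_measurable[OF j] A] by (simp add: vimage_def Int_def conj_commute)
      ultimately have "M.prob {\<omega> \<in> space M. joint_path (L1 j) (L2 j) \<omega> \<notin> A} \<le> \<gamma> / real b"
        using M.prob_neg[OF ev] by simp
      moreover have "{\<omega> \<in> space M. joint_path (L1 j) (L2 j) \<omega> \<notin> A} \<in> M.events"
        using ev by (rule sets.sets_Collect_neg)
      ultimately show ?thesis
        by (intro whpI[where B = "\<lambda>\<omega>. joint_path (L1 j) (L2 j) \<omega> \<notin> A"]) (auto simp: A_def short_event_def local_length_joint_path)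
    qed
    then have "whp M (\<Sum>j\<in>{1..b}. \<gamma> / real b) (\<lambda>\<omega>. \<forall>j\<in>{1..b}. \<exists>k. local_length \<nu> (L2 j \<omega>) (\<epsilon> powr r) = enat k \<and> real k \<le> \<kappa> / real b * a \<epsilon>)"
      by (intro M.whp_all) auto
    then show ?case
    proof (rule whp_mono)
      show "(\<Sum>j\<in>{1..b}. \<gamma> / real b) \<le> \<gamma>" using assms by simp
      fix \<omega> assume *: "\<forall>j\<in>{1..b}. \<exists>k. local_length \<nu> (L2 j \<omega>) (\<epsilon> powr r) = enat k \<and> real k \<le> \<kappa> / real b * a \<epsilon>"
      show "\<forall>n. \<kappa> * a \<epsilon> \<le> real n \<longrightarrow> b \<le> procs \<epsilon> \<omega> n"
        using * unfolding procs_def by (intro allI impI completed_ge_of_short[where K = "\<kappa> * a \<epsilon>", OF elim(2) assms(3)]) auto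
    qed
  qed
qed

text \<open>The number \<open>b\<close> is fixed before \<epsilon>, from the gap of \<open>F\<close>
  around \<open>c\<close> and from \<open>\<gamma>\<close>. On the good event the bound holds for
  every \<open>n\<close> with enough completed runs and an accurate global average, so any random
  time may be inserted later.\<close>

lemma quantile_close:
  assumes unique: "\<And>\<xi>. 0 < \<xi> \<Longrightarrow> F (c - \<xi>) < p \<and> p < F (c + \<xi>)"
    and "0 < \<xi>" "0 < \<gamma>"
  shows "\<exists>b\<ge>1. \<forall>\<^sub>F \<epsilon> in at_right 0. whp M \<gamma> (\<lambda>\<omega>. \<forall>n>0. \<bar>Z1 \<omega> (real n) - real n * \<mu>\<bar> \<le> C * \<epsilon> * real n \<longrightarrow>
      b \<le> procs \<epsilon> \<omega> n \<longrightarrow>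
      \<bar>emp_quantile p \<epsilon> \<omega> n - c\<bar> \<le> \<xi>)"
proof -
  \<comment> \<open>Half of \<open>\<xi>\<close> is spent on the level, the other half on the error
    of recentring.\<close>
  define x1 where "x1 = c - \<xi> / 2"
  define x2 where "x2 = c + \<xi> / 2"
  have F12: "F x1 < p" "p < F x2" using unique[of "\<xi> / 2"] \<open>0 < \<xi>\<close> by (auto simp: x1_def x2_def)
  \<comment> \<open>Half the gap, because \<open>d\<close> is lost twice: in the probability of the
    path event and in its frequency.\<close>
  define d where "d = min (p - F x1) (F x2 - p) / 2"
  have d: "0 < d" "2 * d \<le> p - F x1" "2 * d \<le> F x2 - p" using F12 by (auto simp: d_def)
  obtain b where b: "1 \<le> b" "exp (- 2 * d\<^sup>2) ^ b / (1 - exp (- 2 * d\<^sup>2)) \<le> \<gamma> / 2"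
    using geometric_tail_small[OF d(1), of "\<gamma> / 2"] \<open>0 < \<gamma>\<close> by auto
  have "((\<lambda>\<epsilon>::real. 2 * C * \<epsilon> powr (1 - r)) \<longlongrightarrow> 0) (at_right 0)" using r by real_asymp
  then have "\<forall>\<^sub>F \<epsilon> in at_right 0. 2 * C * \<epsilon> powr (1 - r) < \<xi> / 2"
    using \<open>0 < \<xi>\<close> by (intro order_tendstoD(2)) auto
  then have "\<forall>\<^sub>F \<epsilon> in at_right 0. whp M \<gamma> (\<lambda>\<omega>. \<forall>n>0. \<bar>Z1 \<omega> (real n) - real n * \<mu>\<bar> \<le> C * \<epsilon> * real n \<longrightarrow>
      b \<le> procs \<epsilon> \<omega> n \<longrightarrow>
      \<bar>emp_quantile p \<epsilon> \<omega> n - c\<bar> \<le> \<xi>)"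
    using stat_event_prob[OF d(1) disjI1[OF refl], of x1] stat_event_prob[OF d(1) disjI2[OF refl], of x2] eventually_pos
  proof eventually_elim
    case (elim \<epsilon>)
    define A1 where "A1 = stat_event 1 (\<epsilon> powr r) x1"
    define A2 where "A2 = stat_event (-1) (\<epsilon> powr r) x2"
    have "1 - (F x1 + d) \<le> M.prob {\<omega> \<in> space M. joint_path (L1 j) (L2 j) \<omega> \<in> A1}"
      "1 - (1 - F x2 + d) \<le> M.prob {\<omega> \<in> space M. joint_path (L1 j) (L2 j) \<omega> \<in> A2}" if "1 \<le> j" for j
      using elim(2,3) that by (auto simp: A1_def A2_def tail_def)
    moreover have "A1 \<in> sets path_space" "A2 \<in> sets path_space" by (simp_all add: A1_def A2_def path_events)
    ultimately have
      "whp M (\<gamma> / 2) (\<lambda>\<omega>. \<forall>b'\<ge>b. (1 - p) * real b' < (\<Sum>j=1..b'. of_bool (joint_path (L1 j) (L2 j) \<omega> \<in> A1)))"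
      "whp M (\<gamma> / 2) (\<lambda>\<omega>. \<forall>b'\<ge>b. p * real b' < (\<Sum>j=1..b'. of_bool (joint_path (L1 j) (L2 j) \<omega> \<in> A2)))"
      using d b
      by (intro M.iid_frequency[OF streams_indep, where d = d and p = "1 - (F x1 + d)"]
           M.iid_frequency[OF streams_indep, where d = d and p = "1 - (1 - F x2 + d)"]; simp)+
    from M.whp_conj[OF this] show ?case
    proof (rule whp_mono)
      fix \<omega> assume \<omega>: "(\<forall>b'\<ge>b. (1 - p) * real b' < (\<Sum>j=1..b'. of_bool (joint_path (L1 j) (L2 j) \<omega> \<in> A1))) \<and>
        (\<forall>b'\<ge>b. p * real b' < (\<Sum>j=1..b'. of_bool (joint_path (L1 j) (L2 j) \<omega> \<in> A2)))"
      show "\<forall>n>0. \<bar>Z1 \<omega> (real n) - real n * \<mu>\<bar> \<le> C * \<epsilon> * real n \<longrightarrow>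
        b \<le> procs \<epsilon> \<omega> n \<longrightarrow>
        \<bar>emp_quantile p \<epsilon> \<omega> n - c\<bar> \<le> \<xi>"
      proof (intro allI impI)
        fix n :: nat assume n: "0 < n" "\<bar>Z1 \<omega> (real n) - real n * \<mu>\<bar> \<le> C * \<epsilon> * real n"
          "b \<le> procs \<epsilon> \<omega> n"
        define m where "m = procs \<epsilon> \<omega> n"
        define w where "w = local_statistic \<nu> r (Z1 \<omega>) (\<lambda>j. L1 j \<omega>) (\<lambda>j. L2 j \<omega>) \<epsilon> n"
        define G where "G = empirical_cdf \<nu> r (Z1 \<omega>) (\<lambda>j. L1 j \<omega>) (\<lambda>j. L2 j \<omega>) \<epsilon> n"
        have m: "b \<le> m" "0 < real m" using n(3) b(1) by (auto simp: m_def)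
        have G: "G x * real m = (\<Sum>j=1..m. of_bool (w j \<le> x))" for x
          using m(2) by (simp add: G_def empirical_cdf_def m_def[unfolded procs_def, symmetric] w_def[symmetric])
        have near: "\<exists>D s. 0 < s \<and> \<sigma> * (x * s) < \<sigma> * D \<and> \<bar>w j - D / s\<bar> \<le> \<xi> / 2"
          if "joint_path (L1 j) (L2 j) \<omega> \<in> stat_event \<sigma> (\<epsilon> powr r) x" for j \<sigma> x
        proof -
          obtain k where k: "local_length \<nu> (L2 j \<omega>) (\<epsilon> powr r) = enat k" "0 < L2 j \<omega> (real k)"
              "real k * \<epsilon> powr r \<le> 2 * sqrt (L2 j \<omega> (real k))"
              "\<sigma> * (x * sqrt (L2 j \<omega> (real k))) < \<sigma> * (L1 j \<omega> (real k) - real k * \<mu>)"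
            using \<open>joint_path (L1 j) (L2 j) \<omega> \<in> stat_event \<sigma> (\<epsilon> powr r) x\<close>
            unfolding stat_event_def mem_Collect_eq local_length_joint_path joint_path_at fst_conv snd_conv by blast
          have "\<bar>w j - (L1 j \<omega> (real k) - real k * \<mu>) / sqrt (L2 j \<omega> (real k))\<bar> \<le> \<xi> / 2"
            unfolding w_def
            by (rule local_statistic_perturbation[where ?w1.0 = "\<lambda>j. L1 j \<omega>" and ?w2.0 = "\<lambda>j. L2 j \<omega>"
                and ?z1.0 = "Z1 \<omega>" and C = C and \<epsilon> = \<epsilon> and r = r and \<nu> = \<nu>, OF k(1-3) n(2,1) elim(4)])
              (use elim(1) in simp)
          then show ?thesis using k by (intro exI[of _ "L1 j \<omega> (real k) - real k * \<mu>"] exI[of _ "sqrt (L2 j \<omega> (real k))"]) simp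
        qed
        have A1: "c - \<xi> < w j" if mem: "joint_path (L1 j) (L2 j) \<omega> \<in> A1" for j
        proof -
          obtain D s where D: "0 < s" "1 * (x1 * s) < 1 * D" "\<bar>w j - D / s\<bar> \<le> \<xi> / 2"
            using near[OF mem[unfolded A1_def]] by blast
          then have "x1 < D / s" by (simp add: pos_less_divide_eq)
          then show ?thesis using D(3) unfolding x1_def by linarith
        qed
        have A2: "w j \<le> c + \<xi>" if mem: "joint_path (L1 j) (L2 j) \<omega> \<in> A2" for j
        proof -
          obtain D s where D: "0 < s" "-1 * (x2 * s) < -1 * D" "\<bar>w j - D / s\<bar> \<le> \<xi> / 2"
            using near[OF mem[unfolded A2_def]] by blast
          then have "D / s < x2" by (simp add: pos_divide_less_eq)
          then show ?thesis using D(3) unfolding x2_def by linarith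
        qed
        have "p * real m < (\<Sum>j=1..m. of_bool (joint_path (L1 j) (L2 j) \<omega> \<in> A2))" using \<omega> m(1) by blast
        also have "\<dots> \<le> (\<Sum>j=1..m. of_bool (w j \<le> c + \<xi>))" using A2 by (intro sum_mono) auto
        also have "\<dots> = G (c + \<xi>) * real m" by (rule G[symmetric])
        finally have up: "p \<le> G (c + \<xi>)" using m(2) by simp
        \<comment> \<open>The frequent paths of \<open>A1\<close> are counted through their
          complement, because the lower bound for the quantile needs an upper bound for the
          empirical distribution function.\<close>
        have "G (c - \<xi>) * real m = (\<Sum>j=1..m. of_bool (w j \<le> c - \<xi>))" by (rule G)
        also have "\<dots> \<le> (\<Sum>j=1..m. 1 - of_bool (joint_path (L1 j) (L2 j) \<omega> \<in> A1))"
          using A1 by (intro sum_mono) (fastforce simp: not_le)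
        also have "\<dots> = real m - (\<Sum>j=1..m. of_bool (joint_path (L1 j) (L2 j) \<omega> \<in> A1))" by (simp only: sum_subtractf) simp
        also have "\<dots> < real m - (1 - p) * real m" using \<omega> m(1) by (intro diff_strict_left_mono) blast
        also have "\<dots> = p * real m" by (simp add: algebra_simps)
        finally have low: "G (c - \<xi>) < p" using m(2) by simp
        have "c - \<xi> \<le> quantile G p" "quantile G p \<le> c + \<xi>"
          by (rule quantile_between[of G, OF _ low up]; simp add: G_def empirical_cdf_mono)+
        then show "\<bar>emp_quantile p \<epsilon> \<omega> n - c\<bar> \<le> \<xi>"
          unfolding emp_quantile_def G_def[symmetric] by (simp add: abs_le_iff)
      qed
    qed simp
  qed
  then show ?thesis using b(1) by blast
qed

lemma quantile_close_window:
  assumes unique: "\<And>\<xi>. 0 < \<xi> \<Longrightarrow> F (c - \<xi>) < p \<and> p < F (c + \<xi>)"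
    and "0 < \<xi>" "0 < \<gamma>" "0 < \<kappa>"
  shows "\<forall>\<^sub>F \<epsilon> in at_right 0. whp M \<gamma> (\<lambda>\<omega>. \<forall>n. \<kappa> * a \<epsilon> \<le> real n \<longrightarrow> real n \<le> K * a \<epsilon> \<longrightarrow>
      1 \<le> procs \<epsilon> \<omega> n \<and>
      \<bar>emp_quantile p \<epsilon> \<omega> n - c\<bar> \<le> \<xi>)"
proof -
  have "0 < \<gamma> / 3" using assms by simp
  obtain C where C: "\<forall>\<^sub>F \<epsilon> in at_right 0. whp M (\<gamma> / 3)
    (\<lambda>\<omega>. \<forall>n. \<kappa> * a \<epsilon> \<le> real n \<longrightarrow> real n \<le> K * a \<epsilon> \<longrightarrow> \<bar>Z1 \<omega> (real n) - real n * \<mu>\<bar> \<le> C * \<epsilon> * real n)"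
    using mean_error_bound[OF \<open>0 < \<kappa>\<close> \<open>0 < \<gamma> / 3\<close>] by blast
  obtain b where b: "1 \<le> b" "\<forall>\<^sub>F \<epsilon> in at_right 0. whp M (\<gamma> / 3) (\<lambda>\<omega>. \<forall>n>0. \<bar>Z1 \<omega> (real n) - real n * \<mu>\<bar> \<le> C * \<epsilon> * real n \<longrightarrow>
      b \<le> procs \<epsilon> \<omega> n \<longrightarrow>
      \<bar>emp_quantile p \<epsilon> \<omega> n - c\<bar> \<le> \<xi>)"
    using quantile_close[of c p \<xi> "\<gamma> / 3" C, OF unique \<open>0 < \<xi>\<close> \<open>0 < \<gamma> / 3\<close>] by auto
  show ?thesis
    using C b(2) completed_large[OF \<open>0 < \<kappa>\<close> \<open>0 < \<gamma> / 3\<close> b(1)] eventually_a_pos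
  proof eventually_elim
    case (elim \<epsilon>)
    from M.whp_conj[OF M.whp_conj[OF elim(1,2)] elim(3)] show ?case
    proof (rule whp_mono)
      fix \<omega> assume *: "((\<forall>n. \<kappa> * a \<epsilon> \<le> real n \<longrightarrow> real n \<le> K * a \<epsilon> \<longrightarrow> \<bar>Z1 \<omega> (real n) - real n * \<mu>\<bar> \<le> C * \<epsilon> * real n) \<and>
        (\<forall>n>0. \<bar>Z1 \<omega> (real n) - real n * \<mu>\<bar> \<le> C * \<epsilon> * real n \<longrightarrow> b \<le> procs \<epsilon> \<omega> n \<longrightarrow>
          \<bar>emp_quantile p \<epsilon> \<omega> n - c\<bar> \<le> \<xi>)) \<and>
        (\<forall>n. \<kappa> * a \<epsilon> \<le> real n \<longrightarrow> b \<le> procs \<epsilon> \<omega> n)"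
      show "\<forall>n. \<kappa> * a \<epsilon> \<le> real n \<longrightarrow> real n \<le> K * a \<epsilon> \<longrightarrow> 1 \<le> procs \<epsilon> \<omega> n \<and>
        \<bar>emp_quantile p \<epsilon> \<omega> n - c\<bar> \<le> \<xi>"
      proof (intro allI impI)
        fix n assume n: "\<kappa> * a \<epsilon> \<le> real n" "real n \<le> K * a \<epsilon>"
        have "0 < \<kappa> * a \<epsilon>" using \<open>0 < \<kappa>\<close> elim(4) by simp
        then have "0 < n" using n(1) by linarith
        moreover have "b \<le> procs \<epsilon> \<omega> n" using * n by blast
        ultimately show "1 \<le> procs \<epsilon> \<omega> n \<and>
          \<bar>emp_quantile p \<epsilon> \<omega> n - c\<bar> \<le> \<xi>"
          using * n b(1) by (meson le_trans)
      qed
    qed simp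
  qed
qed

end

section \<open>Measurability of the terminal values\<close>

text \<open>If \<open>P\<close> and \<open>Q\<close> exclude each other, the two exceptional sets
  cover the space, and inclusion-exclusion gains the \<open>- 1\<close>. This joins the two
  one-sided tail bounds into an upper bound for the coverage.\<close>

lemma (in prob_space) whp_disjoint:
  assumes "whp M a P" "whp M b Q" and disj: "\<And>\<omega>. \<omega> \<in> space M \<Longrightarrow> \<not> (P \<omega> \<and> Q \<omega>)"
  shows "whp M (a + b - 1) (\<lambda>\<omega>. P \<omega> \<or> Q \<omega>)"
proof -
  obtain A where A: "A \<in> sets M" "prob A \<le> a" "\<forall>\<omega>\<in>space M - A. P \<omega>"
    using assms(1) unfolding whp_def by blast
  obtain B where B: "B \<in> sets M" "prob B \<le> b" "\<forall>\<omega>\<in>space M - B. Q \<omega>"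
    using assms(2) unfolding whp_def by blast
  have "A \<union> B = space M"
    using A(3) B(3) disj sets.sets_into_space[OF A(1)] sets.sets_into_space[OF B(1)] by blast
  then have "prob A + prob B = 1 + prob (A \<inter> B)"
    using measure_Un3[of A M B] A B by (simp add: prob_space fmeasurable_eq_sets)
  then have "prob (A \<inter> B) \<le> a + b - 1" using A(2) B(2) by linarith
  moreover have "\<forall>\<omega>\<in>space M - A \<inter> B. P \<omega> \<or> Q \<omega>" using A(3) B(3) by blast
  ultimately show ?thesis using A(1) B(1) unfolding whp_def by blast
qed

text \<open>The empirical distribution function is right continuous, so the infimum defining the
  quantile is attained. Measurability of quantiles thus reduces to that of finite sums of
  indicators. The bounds on \<open>p\<close> and \<open>b\<close> make the set nonempty and bounded
  below.\<close>

lemma quantile_le_iff: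
  fixes w :: "nat \<Rightarrow> real" and b :: nat
  defines "G \<equiv> \<lambda>x. (\<Sum>j=1..b. of_bool (w j \<le> x)) / real b"
  assumes b: "1 \<le> b" and p: "0 < p" "p \<le> 1"
  shows "quantile G p \<le> y \<longleftrightarrow> p \<le> G y"
proof
  have mono: "G x \<le> G x'" if "x \<le> x'" for x x'
    unfolding G_def by (intro divide_right_mono sum_mono) (use that in auto)
  define hi where "hi = Max (w ` {1..b})"
  define lo where "lo = Min (w ` {1..b}) - 1"
  have "w j \<le> hi" if "j \<in> {1..b}" for j using that by (auto simp: hi_def)
  then have "(\<Sum>j=1..b. of_bool (w j \<le> hi)) = (\<Sum>j=1..b. 1 :: real)" by (intro sum.cong) auto
  then have hi: "p \<le> G hi" using b p by (simp add: G_def)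
  have "lo < w j" if j: "j \<in> {1..b}" for j
  proof -
    have "Min (w ` {1..b}) \<le> w j" using j by (intro Min_le) auto
    then show ?thesis by (simp add: lo_def)
  qed
  then have "(\<Sum>j=1..b. of_bool (w j \<le> lo)) = (\<Sum>j=1..b. 0 :: real)" by (intro sum.cong) force+
  then have lo: "G lo < p" using p by (simp add: G_def)
  have bdd: "bdd_below {x. p \<le> G x}"
  proof (rule bdd_belowI[of _ lo])
    fix x assume "x \<in> {x. p \<le> G x}"
    then show "lo \<le> x" using mono[of x lo] lo by force
  qed
  show "quantile G p \<le> y" if "p \<le> G y"
    unfolding quantile_def using that bdd by (intro cInf_lower) auto
  assume le: "quantile G p \<le> y"
  have ge: "p \<le> G (y + 1 / real (Suc n))" for n
  proof -
    have "Inf {x. p \<le> G x} < y + 1 / real (Suc n)"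
      using le unfolding quantile_def by (rule order.strict_trans1) simp
    then obtain x where "p \<le> G x" "x < y + 1 / real (Suc n)"
      using hi bdd by (subst (asm) cInf_less_iff) auto
    then show ?thesis using mono[of x "y + 1 / real (Suc n)"] by linarith
  qed
  have step: "(\<lambda>n. of_bool (w j \<le> y + 1 / real (Suc n)) :: real) \<longlonglongrightarrow> of_bool (w j \<le> y)" for j
  proof (cases "w j \<le> y")
    case True
    then have "w j \<le> y + 1 / real (Suc n)" for n by (rule order_trans) simp
    then show ?thesis using True by simp
  next
    case False
    have "(\<lambda>n. y + 1 / real (Suc n)) \<longlonglongrightarrow> y + 0"
      by (intro tendsto_add tendsto_const LIMSEQ_Suc[OF lim_const_over_n])
    then have "\<forall>\<^sub>F n in sequentially. y + 1 / real (Suc n) < w j"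
      by (rule order_tendstoD(2)) (use False in simp)
    then have "\<forall>\<^sub>F n in sequentially. of_bool (w j \<le> y + 1 / real (Suc n)) = (of_bool (w j \<le> y) :: real)"
      by eventually_elim (use False in simp)
    then show ?thesis by (rule tendsto_eventually)
  qed
  have "(\<lambda>n. G (y + 1 / real (Suc n))) \<longlonglongrightarrow> G y"
    unfolding G_def using b by (intro tendsto_divide tendsto_sum step tendsto_const) auto
  then show "p \<le> G y" by (rule LIMSEQ_le_const) (use ge in blast)
qed

lemma quantile_measurable:
  assumes w: "\<And>j. 1 \<le> j \<Longrightarrow> w j \<in> borel_measurable M" and p: "0 < p" "p \<le> 1"
  shows "(\<lambda>\<omega>. quantile (\<lambda>x. (\<Sum>j=1..b. of_bool (w j \<omega> \<le> x)) / real b) p) \<in> borel_measurable M"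
proof (cases "1 \<le> b")
  case True
  show ?thesis
  proof (rule borel_measurableI_le)
    fix y
    have [measurable]: "(\<lambda>\<omega>. of_bool (w j \<omega> \<le> y) :: real) \<in> borel_measurable M" if "j \<in> {1..b}" for j
    proof -
      have [measurable]: "w j \<in> borel_measurable M" using w that by simp
      show ?thesis by measurable
    qed
    have "(\<lambda>\<omega>. (\<Sum>j=1..b. of_bool (w j \<omega> \<le> y)) / real b) \<in> borel_measurable M"
      by (intro borel_measurable_divide borel_measurable_sum borel_measurable_const) measurable
    then have "{\<omega> \<in> space M. p \<le> (\<Sum>j=1..b. of_bool (w j \<omega> \<le> y)) / real b} \<in> sets M" by measurable
    then show "{\<omega> \<in> space M. quantile (\<lambda>x. (\<Sum>j=1..b. of_bool (w j \<omega> \<le> x)) / real b) p \<le> y} \<in> sets M"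
      by (simp only: quantile_le_iff[OF True p])
  qed
qed simp

text \<open>Partial sums of the lengths are increasing, so the maximum can be tested at a single
  \<open>b\<close>.\<close>

lemma completed_ge_iff:
  assumes "0 < \<epsilon>"
  shows "b \<le> completed \<nu> r w2 \<epsilon> n \<longleftrightarrow> (\<Sum>j=1..b. local_length \<nu> (w2 j) (\<epsilon> powr r)) \<le> enat n"
proof
  assume "b \<le> completed \<nu> r w2 \<epsilon> n"
  then have "(\<Sum>j=1..b. local_length \<nu> (w2 j) (\<epsilon> powr r)) \<le> (\<Sum>j=1..completed \<nu> r w2 \<epsilon> n. local_length \<nu> (w2 j) (\<epsilon> powr r))"
    by (intro sum_mono2) auto
  also have "\<dots> \<le> enat n" by (rule completed_sum_le[OF assms])
  finally show "(\<Sum>j=1..b. local_length \<nu> (w2 j) (\<epsilon> powr r)) \<le> enat n" .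
qed (rule completed_ge[OF assms])

lemma enat_measurableI:
  fixes f :: "'a \<Rightarrow> enat"
  assumes "\<And>k. {\<omega> \<in> space M. f \<omega> = enat k} \<in> sets M"
  shows "f \<in> M \<rightarrow>\<^sub>M count_space UNIV"
proof -
  have "f -` {x} \<inter> space M \<in> sets M" for x
  proof (cases x)
    case (enat k)
    then show ?thesis using assms[of k] by (simp add: vimage_def Int_def conj_commute)
  next
    case infinity
    have "f -` {\<infinity>} \<inter> space M = space M - (\<Union>k. {\<omega> \<in> space M. f \<omega> = enat k})"
      by (auto simp: not_infinity_eq)
    also have "\<dots> \<in> sets M" using assms by auto
    finally show ?thesis using infinity by simp
  qed
  then show ?thesis by (simp add: measurable_count_space_eq2_countable)
qed

lemma enat_sum_measurable:
  fixes f :: "nat \<Rightarrow> 'a \<Rightarrow> enat"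
  assumes "finite I" "\<And>j. j \<in> I \<Longrightarrow> f j \<in> M \<rightarrow>\<^sub>M count_space UNIV"
  shows "(\<lambda>\<omega>. \<Sum>j\<in>I. f j \<omega>) \<in> M \<rightarrow>\<^sub>M count_space UNIV"
  using assms
proof (induction I rule: finite_induct)
  case (insert i I)
  have s: "(\<lambda>\<omega>. \<Sum>j\<in>I. f j \<omega>) \<in> M \<rightarrow>\<^sub>M count_space UNIV" and i: "f i \<in> M \<rightarrow>\<^sub>M count_space UNIV"
    using insert by auto
  have "(\<lambda>\<omega>. x + (\<Sum>j\<in>I. f j \<omega>)) \<in> M \<rightarrow>\<^sub>M count_space UNIV" for x
    by (rule measurable_compose[OF s]) simp
  from measurable_compose_countable[OF this i] show ?case using insert by simp
qed simp

context subsampling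
begin

lemma component_measurable:
  "(\<lambda>\<omega>. Z1 \<omega> (real n)) \<in> borel_measurable M" "(\<lambda>\<omega>. Z2 \<omega> (real n)) \<in> borel_measurable M"
  "1 \<le> j \<Longrightarrow> (\<lambda>\<omega>. L1 j \<omega> (real n)) \<in> borel_measurable M"
  "1 \<le> j \<Longrightarrow> (\<lambda>\<omega>. L2 j \<omega> (real n)) \<in> borel_measurable M"
proof -
  show "(\<lambda>\<omega>. Z1 \<omega> (real n)) \<in> borel_measurable M" "(\<lambda>\<omega>. Z2 \<omega> (real n)) \<in> borel_measurable M"
    by (simp_all add: cadlag_process_measurable[OF Z1] cadlag_process_measurable[OF Z2])
  assume j: "1 \<le> j"
  show "(\<lambda>\<omega>. L1 j \<omega> (real n)) \<in> borel_measurable M" "(\<lambda>\<omega>. L2 j \<omega> (real n)) \<in> borel_measurable M"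
    using measurable_compose[OF joint_path_L_measurable[OF j] path_space_component(1)[of n]]
      measurable_compose[OF joint_path_L_measurable[OF j] path_space_component(2)[of n]]
    by (simp_all add: joint_path_at)
qed

lemma local_length_measurable:
  assumes j: "1 \<le> j"
  shows "(\<lambda>\<omega>. local_length \<nu> (L2 j \<omega>) e) \<in> M \<rightarrow>\<^sub>M count_space UNIV"
proof (rule enat_measurableI)
  note [measurable] = component_measurable(4)[OF j]
  show "{\<omega> \<in> space M. local_length \<nu> (L2 j \<omega>) e = enat k} \<in> sets M" for k
    unfolding local_length_def INF_enat_eq_iff by measurable
qed

lemma completed_measurable:
  assumes "0 < \<epsilon>"
  shows "(\<lambda>\<omega>. completed \<nu> r (\<lambda>j. L2 j \<omega>) \<epsilon> n) \<in> M \<rightarrow>\<^sub>M count_space UNIV"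
proof -
  have ge: "{\<omega> \<in> space M. b \<le> completed \<nu> r (\<lambda>j. L2 j \<omega>) \<epsilon> n} \<in> sets M" for b
  proof -
    have "(\<lambda>\<omega>. \<Sum>j=1..b. local_length \<nu> (L2 j \<omega>) (\<epsilon> powr r)) \<in> M \<rightarrow>\<^sub>M count_space UNIV"
      by (intro enat_sum_measurable local_length_measurable) auto
    then have "{\<omega> \<in> space M. (\<Sum>j=1..b. local_length \<nu> (L2 j \<omega>) (\<epsilon> powr r)) \<le> enat n} \<in> sets M" by measurable
    then show ?thesis by (simp only: completed_ge_iff[OF assms])
  qed
  have "{\<omega> \<in> space M. completed \<nu> r (\<lambda>j. L2 j \<omega>) \<epsilon> n = b} \<in> sets M" for b
  proof -
    have "{\<omega> \<in> space M. completed \<nu> r (\<lambda>j. L2 j \<omega>) \<epsilon> n = b} =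
      {\<omega> \<in> space M. b \<le> completed \<nu> r (\<lambda>j. L2 j \<omega>) \<epsilon> n} - {\<omega> \<in> space M. Suc b \<le> completed \<nu> r (\<lambda>j. L2 j \<omega>) \<epsilon> n}"
      by auto
    then show ?thesis using ge by simp
  qed
  then show ?thesis
    by (simp add: measurable_count_space_eq2_countable vimage_def Int_def conj_commute)
qed

lemma local_statistic_measurable:
  assumes j: "1 \<le> j"
  shows "(\<lambda>\<omega>. local_statistic \<nu> r (Z1 \<omega>) (\<lambda>j. L1 j \<omega>) (\<lambda>j. L2 j \<omega>) \<epsilon> n j) \<in> borel_measurable M"
proof -
  note [measurable] = component_measurable(1,2) component_measurable(3,4)[OF j]
  have "(\<lambda>\<omega>. the_enat (local_length \<nu> (L2 j \<omega>) (\<epsilon> powr r))) \<in> M \<rightarrow>\<^sub>M count_space UNIV"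
    by (rule measurable_compose[OF local_length_measurable[OF j]]) simp
  moreover have "(\<lambda>\<omega>. (L1 j \<omega> (real k) - real k / real n * Z1 \<omega> (real n)) / sqrt (L2 j \<omega> (real k))) \<in> borel_measurable M" for k :: nat
    by measurable
  ultimately show ?thesis
    unfolding local_statistic_def Let_def
    by (rule measurable_compose_countable[rotated, where
      f = "\<lambda>k \<omega>. (L1 j \<omega> (real k) - real k / real n * Z1 \<omega> (real n)) / sqrt (L2 j \<omega> (real k))"])
qed

lemma empirical_quantile_measurable:
  assumes "0 < \<epsilon>" "0 < p" "p \<le> 1"
  shows "(\<lambda>\<omega>. quantile (empirical_cdf \<nu> r (Z1 \<omega>) (\<lambda>j. L1 j \<omega>) (\<lambda>j. L2 j \<omega>) \<epsilon> n) p) \<in> borel_measurable M"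
  unfolding empirical_cdf_def[abs_def]
  by (rule measurable_compose_countable[OF quantile_measurable[OF local_statistic_measurable assms(2,3)] completed_measurable[OF assms(1)]])

context
  fixes \<delta> c_min :: real and d :: "nat \<times> real \<times> real \<times> real \<times> real"
  assumes delta: "0 < \<delta>" "\<delta> < 1"
begin

lemma quantiles_measurable:
  assumes "0 < \<epsilon>"
  shows "(\<lambda>\<omega>. lower_quantile \<delta> \<nu> r (Z1 \<omega>) (\<lambda>j. L1 j \<omega>) (\<lambda>j. L2 j \<omega>) \<epsilon> n) \<in> borel_measurable M"
    "(\<lambda>\<omega>. upper_quantile \<delta> \<nu> r (Z1 \<omega>) (\<lambda>j. L1 j \<omega>) (\<lambda>j. L2 j \<omega>) \<epsilon> n) \<in> borel_measurable M"
  unfolding lower_quantile_def upper_quantile_def using delta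
  by (intro empirical_quantile_measurable[OF assms]; simp)+

lemma stop_time_measurable:
  assumes "0 < \<epsilon>"
  shows "(\<lambda>\<omega>. stop_time \<delta> c_min \<nu> r (Z1 \<omega>) (Z2 \<omega>) (\<lambda>j. L1 j \<omega>) (\<lambda>j. L2 j \<omega>) \<epsilon>) \<in> M \<rightarrow>\<^sub>M count_space UNIV"
proof (rule enat_measurableI)
  note [measurable] = component_measurable(1,2) quantiles_measurable[OF assms] completed_measurable[OF assms]
  show "{\<omega> \<in> space M. stop_time \<delta> c_min \<nu> r (Z1 \<omega>) (Z2 \<omega>) (\<lambda>j. L1 j \<omega>) (\<lambda>j. L2 j \<omega>) \<epsilon> = enat k} \<in> sets M" for k
    unfolding stop_time_def quantile_width_def INF_enat_eq_iff by measurable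
qed

text \<open>The event is split along the countably many values of the stopping time. The lower bound
  for the coverage passes to the complement, which requires measurability.\<close>

lemma coverage_measurable:
  assumes "0 < \<epsilon>"
  shows "{\<omega> \<in> space M. \<mu> \<in> confidence_interval
     (terminal_values \<delta> c_min \<nu> r d (Z1 \<omega>) (Z2 \<omega>) (\<lambda>j. L1 j \<omega>) (\<lambda>j. L2 j \<omega>) \<epsilon>)} \<in> sets M"
proof -
  note [measurable] = component_measurable(1,2) quantiles_measurable[OF assms]
  define f where "f T \<omega> \<longleftrightarrow> \<mu> \<in> confidence_interval (case T of
        enat n \<Rightarrow> (n, Z1 \<omega> (real n), Z2 \<omega> (real n),
                    lower_quantile \<delta> \<nu> r (Z1 \<omega>) (\<lambda>j. L1 j \<omega>) (\<lambda>j. L2 j \<omega>) \<epsilon> n, upper_quantile \<delta> \<nu> r (Z1 \<omega>) (\<lambda>j. L1 j \<omega>) (\<lambda>j. L2 j \<omega>) \<epsilon> n)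
      | \<infinity> \<Rightarrow> d)" for T \<omega>
  have "Measurable.pred M (f T)" for T
  proof (cases T)
    case (enat n)
    show ?thesis unfolding enat f_def[abs_def] confidence_interval_def by simp measurable
  next
    case infinity
    show ?thesis unfolding infinity f_def[abs_def] by simp
  qed
  from measurable_compose_countable[OF this stop_time_measurable[OF assms]]
  show ?thesis unfolding f_def terminal_values_def pred_def .
qed

end

end

section \<open>Coverage of the confidence interval\<close>

locale coverage = subsampling N Y1 Y2 h M Z1 Z2 \<mu> \<nu> l A_inv L1 L2 r
  for N :: "'b measure" and Y1 Y2 :: "'b process" and h :: real and M :: "'a measure"
    and Z1 Z2 :: "'a process" and \<mu> \<nu> :: real and l A_inv :: "real \<Rightarrow> real"
    and L1 L2 :: "nat \<Rightarrow> 'a process" and r :: real +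
  fixes \<delta> c_min c_l c_u :: real and d :: "nat \<times> real \<times> real \<times> real \<times> real"
  assumes delta: "0 < \<delta>" "\<delta> < 1"
    and c_l_unique: "\<And>\<xi>. 0 < \<xi> \<Longrightarrow> F (c_l - \<xi>) < \<delta> / 2 \<and> \<delta> / 2 < F (c_l + \<xi>)"
    and c_u_unique: "\<And>\<xi>. 0 < \<xi> \<Longrightarrow> F (c_u - \<xi>) < 1 - \<delta> / 2 \<and> 1 - \<delta> / 2 < F (c_u + \<xi>)"
    and c_min: "0 < c_min" "c_min < c_u - c_l"
begin

definition cl :: "real \<Rightarrow> 'a \<Rightarrow> nat \<Rightarrow> real" where
  "cl = emp_quantile (\<delta> / 2)"

definition cu :: "real \<Rightarrow> 'a \<Rightarrow> nat \<Rightarrow> real" where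
  "cu = emp_quantile (1 - \<delta> / 2)"

definition T :: "real \<Rightarrow> 'a \<Rightarrow> enat" where
  "T \<epsilon> \<omega> = stop_time \<delta> c_min \<nu> r (Z1 \<omega>) (Z2 \<omega>) (\<lambda>j. L1 j \<omega>) (\<lambda>j. L2 j \<omega>) \<epsilon>"

definition c_star :: real where "c_star = c_u - c_l"

text \<open>With this factor the boundary \<open>\<epsilon> / c_star\<close> becomes the level 1 for the process scaled by
  \<open>e \<epsilon>\<close>, so that only the limit \<open>W\<^sub>1\<close> at level 1 is needed.\<close>

definition scale :: real where "scale = c_star powr (1 / (1 - h))"

definition e :: "real \<Rightarrow> real" where "e \<epsilon> = 1 / (scale * a \<epsilon>)"

lemma c_star_pos: "0 < c_star" "c_min < c_star"
  using c_min by (simp_all add: c_star_def)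

lemma scale_pos: "0 < scale"
  using c_star_pos by (simp add: scale_def)

lemma e_at_right: "filterlim e (at_right 0) (at_right 0)"
  using scale_at_right[OF scale_pos] by (simp add: e_def[abs_def])

lemma B_e: "((\<lambda>\<epsilon>. B (e \<epsilon>) * \<epsilon>) \<longlongrightarrow> c_star) (at_right 0)"
proof -
  have "scale powr (1 - h) = c_star" using h c_star_pos by (simp add: scale_def powr_powr)
  then show ?thesis using B_scale[OF scale_pos] by (simp add: e_def)
qed

lemma quantiles_close:
  assumes "0 < \<xi>" "0 < \<gamma>" "0 < \<kappa>"
  shows "\<forall>\<^sub>F \<epsilon> in at_right 0. whp M \<gamma> (\<lambda>\<omega>. \<forall>n. \<kappa> * a \<epsilon> \<le> real n \<longrightarrow> real n \<le> K * a \<epsilon> \<longrightarrow>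
      1 \<le> procs \<epsilon> \<omega> n \<and> \<bar>cl \<epsilon> \<omega> n - c_l\<bar> \<le> \<xi> \<and> \<bar>cu \<epsilon> \<omega> n - c_u\<bar> \<le> \<xi>)"
proof -
  have g: "0 < \<gamma> / 2" using assms by simp
  have close: "\<forall>\<^sub>F \<epsilon> in at_right 0. whp M (\<gamma> / 2) (\<lambda>\<omega>. \<forall>n. \<kappa> * a \<epsilon> \<le> real n \<longrightarrow> real n \<le> K * a \<epsilon> \<longrightarrow>
      1 \<le> procs \<epsilon> \<omega> n \<and> \<bar>emp_quantile p \<epsilon> \<omega> n - c\<bar> \<le> \<xi>)"
    if "\<forall>\<xi>>0. F (c - \<xi>) < p \<and> p < F (c + \<xi>)" for c p
    by (rule quantile_close_window[OF _ assms(1) g assms(3)]) (use that in blast)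
  have "\<forall>\<xi>>0. F (c_l - \<xi>) < \<delta> / 2 \<and> \<delta> / 2 < F (c_l + \<xi>)"
      "\<forall>\<xi>>0. F (c_u - \<xi>) < 1 - \<delta> / 2 \<and> 1 - \<delta> / 2 < F (c_u + \<xi>)"
    using c_l_unique c_u_unique by blast+
  note close = this[THEN close]
  show ?thesis
    using close
  proof eventually_elim
    case (elim \<epsilon>)
    from M.whp_conj[OF elim] show ?case
      by (rule whp_mono) (simp_all add: cl_def cu_def)
  qed
qed

lemma T_def': "T \<epsilon> \<omega> = (INF n\<in>{n. \<epsilon> powr (- \<nu>) < real n \<and> 1 \<le> procs \<epsilon> \<omega> n \<and>
    sqrt (Z2 \<omega> (real n) / (real n)\<^sup>2) < \<epsilon> / max c_min (cu \<epsilon> \<omega> n - cl \<epsilon> \<omega> n)}. enat n)"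
  by (simp add: T_def stop_time_def quantile_width_def cl_def cu_def procs_def emp_quantile_def
      lower_quantile_def upper_quantile_def)

text \<open>The floor \<open>c_min\<close> keeps the boundary below
  \<open>\<epsilon> / c_min\<close> at all times, so the no-early-stopping condition with
  \<open>K = 1 / c_min\<close> applies where nothing is known yet about the quantiles. From time
  \<open>\<kappa> * a \<epsilon>\<close> to the end of the window the width is within
  \<open>2 * \<xi>\<close> of \<open>c_star\<close>, and the boundary scaled by
  \<open>B (e \<epsilon>)\<close> is within \<open>1/m\<close> of level 1.\<close>

lemma global_crossing:
  assumes "0 < \<gamma>"
  shows "\<exists>m0. \<forall>m\<ge>m0. \<forall>\<^sub>F \<epsilon> in at_right 0. whp M \<gamma> (crossing (e \<epsilon>) m (T \<epsilon>))"
proof -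
  have "0 < \<gamma> / 2" "0 < 1 / c_min" using assms c_min by auto
  then obtain \<eta> where \<eta>: "0 < \<eta>" "\<forall>\<^sub>F \<epsilon> in at_right 0. whp M (\<gamma> / 2)
    (\<lambda>\<omega>. \<forall>n. \<epsilon> powr (- \<nu>) \<le> real n \<longrightarrow> real n \<le> \<eta> * a \<epsilon> \<longrightarrow> 1 / c_min * \<epsilon> < sqrt (Z2 \<omega> (real n)) / real n)"
    using no_early_whp[of "1 / c_min" "\<gamma> / 2"] by blast
  obtain k :: nat where k: "3 * scale / \<eta> < real k" using reals_Archimedean2 by blast
  have "\<forall>\<^sub>F \<epsilon> in at_right 0. whp M \<gamma> (crossing (e \<epsilon>) m (T \<epsilon>))" if "max k 2 \<le> m" for m
  proof -
    have m: "3 * scale / \<eta> < real m" "2 \<le> real m" using that k by (auto simp: of_nat_le_iff[symmetric] simp del: of_nat_le_iff)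
    have m\<eta>: "3 * scale / real m < \<eta>" using m \<eta> by (simp add: field_simps)
    \<comment> \<open>The second bound makes the relative error of the width at most
      \<open>w / 2\<close> for \<open>w = 1/m\<close>; the other half of \<open>w\<close> is left
      for the convergence of \<open>B (e \<epsilon>) * \<epsilon>\<close>.\<close>
    define \<xi> where "\<xi> = min (c_star - c_min) (c_star / (2 * real m)) / 2"
    have \<xi>: "0 < \<xi>" "2 * \<xi> \<le> c_star - c_min" "2 * \<xi> \<le> c_star / (2 * real m)"
      using c_star_pos m by (auto simp: \<xi>_def)
    define w where "w = 1 / real m"
    have w: "0 < w" "w \<le> 1 / 2" using m by (simp_all add: w_def field_simps)
    have \<xi>w: "2 * \<xi> \<le> c_star * (w / 2)" using \<xi>(3) by (simp add: w_def)
    obtain v where v: "w = 2 * v" by (rule that[of "w / 2"]) simp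
    \<comment> \<open>Strict bounds on both sides of the limit \<open>c_star\<close>, so that they
      also hold eventually for \<open>B (e \<epsilon>) * \<epsilon>\<close>. They rest on
      \<open>(1 - w) * (1 + w/2) < 1 < (1 + w) * (1 - w/2)\<close>.\<close>
    have lo: "(1 - w) * (c_star + 2 * \<xi>) < c_star"
    proof -
      have "(1 - w) * (c_star + 2 * \<xi>) \<le> (1 - w) * (c_star + c_star * (w / 2))"
        using \<xi>w w by (intro mult_left_mono) auto
      also have "\<dots> = c_star * (1 - (w / 2 + w * w / 2))"
        by (simp add: v) (simp add: algebra_simps)
      also have "\<dots> < c_star * 1"
      proof (rule mult_strict_left_mono[OF _ c_star_pos(1)])
        have "0 < w * w" using w by simp
        then show "1 - (w / 2 + w * w / 2) < 1" using w by linarith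
      qed
      finally show ?thesis by simp
    qed
    have hi: "c_star < (1 + w) * (c_star - 2 * \<xi>)"
    proof -
      have "c_star * 1 < c_star * (1 + (w / 2 - w * w / 2))"
      proof (rule mult_strict_left_mono[OF _ c_star_pos(1)])
        have "w * w \<le> w * (1 / 2)" using w by (intro mult_left_mono) auto
        then show "1 < 1 + (w / 2 - w * w / 2)" using w by linarith
      qed
      also have "\<dots> = (1 + w) * (c_star - c_star * (w / 2))"
        by (simp add: v) (simp add: algebra_simps)
      also have "\<dots> \<le> (1 + w) * (c_star - 2 * \<xi>)" using \<xi>w w by (intro mult_left_mono) auto
      finally show ?thesis by simp
    qed
    \<comment> \<open>On the scale of \<open>a \<epsilon>\<close> this is the scaled time
      \<open>3/m\<close> of \<open>crossing\<close>.\<close>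
    define \<kappa> where "\<kappa> = 3 * scale / real m"
    have \<kappa>: "0 < \<kappa>" "\<kappa> < \<eta>" using scale_pos m m\<eta> by (simp_all add: \<kappa>_def)
    show ?thesis
      using \<eta>(2) quantiles_close[OF \<xi>(1) \<open>0 < \<gamma> / 2\<close> \<kappa>(1), of "scale * real m"]
        order_tendstoD(1)[OF B_e lo] order_tendstoD(2)[OF B_e hi] a_large[OF \<kappa>(1)] eventually_a_pos eventually_pos
    proof eventually_elim
      case (elim \<epsilon>)
      have "0 < (1 - w) * (c_star + 2 * \<xi>)" using w c_star_pos \<xi> by (intro mult_pos_pos) auto
      then have "0 < B (e \<epsilon>) * \<epsilon>" using elim(3) by linarith
      then have Bpos: "0 < B (e \<epsilon>)" using elim(7) by (simp add: zero_less_mult_iff)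
      have to_a: "3 / real m < real n * e \<epsilon> \<longleftrightarrow> \<kappa> * a \<epsilon> < real n" "real n * e \<epsilon> \<le> real m \<longleftrightarrow> real n \<le> scale * real m * a \<epsilon>" for n
        using elim(6) scale_pos m by (simp_all add: e_def \<kappa>_def field_simps)
      from M.whp_conj[OF elim(1,2)] show ?case
      proof (rule whp_mono)
        fix \<omega> assume *: "(\<forall>n. \<epsilon> powr (- \<nu>) \<le> real n \<longrightarrow> real n \<le> \<eta> * a \<epsilon> \<longrightarrow> 1 / c_min * \<epsilon> < sqrt (Z2 \<omega> (real n)) / real n) \<and>
          (\<forall>n. \<kappa> * a \<epsilon> \<le> real n \<longrightarrow> real n \<le> scale * real m * a \<epsilon> \<longrightarrow>
            1 \<le> procs \<epsilon> \<omega> n \<and> \<bar>cl \<epsilon> \<omega> n - c_l\<bar> \<le> \<xi> \<and> \<bar>cu \<epsilon> \<omega> n - c_u\<bar> \<le> \<xi>)"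
        define c where "c n = max c_min (cu \<epsilon> \<omega> n - cl \<epsilon> \<omega> n)" for n
        have c_ge: "c_min \<le> c n" "0 < c n" for n using c_min by (auto simp: c_def)
        have c_near: "1 \<le> procs \<epsilon> \<omega> n" "c_star - 2 * \<xi> \<le> c n" "c n \<le> c_star + 2 * \<xi>"
          if n: "\<kappa> * a \<epsilon> \<le> real n" "real n \<le> scale * real m * a \<epsilon>" for n
        proof -
          have q: "1 \<le> procs \<epsilon> \<omega> n" "\<bar>cl \<epsilon> \<omega> n - c_l\<bar> \<le> \<xi>" "\<bar>cu \<epsilon> \<omega> n - c_u\<bar> \<le> \<xi>"
            using * n by blast+
          then show "1 \<le> procs \<epsilon> \<omega> n" by simp
          show "c_star - 2 * \<xi> \<le> c n" "c n \<le> c_star + 2 * \<xi>"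
            using q(2,3) \<xi>(1,2) unfolding c_def c_star_def by linarith+
        qed
        have pos: "0 < n" if "\<epsilon> powr (- \<nu>) < real n" for n
          using that powr_ge_zero[of \<epsilon> "- \<nu>"] by linarith
        show "crossing (e \<epsilon>) m (T \<epsilon>) \<omega>"
          unfolding crossing_def
        proof (intro conjI allI impI)
          fix n assume "T \<epsilon> \<omega> = enat n"
          then have n: "\<epsilon> powr (- \<nu>) < real n" "sqrt (Z2 \<omega> (real n) / (real n)\<^sup>2) < \<epsilon> / c n"
            using INF_enat_mem unfolding T_def' c_def by blast+
          have less: "sqrt (Z2 \<omega> (real n)) < \<epsilon> / c n * real n"
            using n(2) pos[OF n(1)] by (simp only: sqrt_div_square_less_iff)
          have "sqrt (Z2 \<omega> (real n)) / real n < \<epsilon> / c n" using less pos[OF n(1)] by (simp add: pos_divide_less_eq)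
          also have "\<dots> \<le> \<epsilon> / c_min" using c_ge[of n] c_min elim(7) by (intro divide_left_mono) auto
          finally have "\<eta> * a \<epsilon> < real n"
            using *[THEN conjunct1, rule_format, of n] n(1) by (simp add: not_le[symmetric]) (meson less_imp_le not_le)
          moreover have "\<kappa> * a \<epsilon> \<le> \<eta> * a \<epsilon>" using \<kappa> elim(6) by (intro mult_right_mono) auto
          ultimately have low: "\<kappa> * a \<epsilon> < real n" by linarith
          then show "3 / real m < real n * e \<epsilon>" by (simp only: to_a)
          assume "real n * e \<epsilon> \<le> real m"
          then have near: "c_star - 2 * \<xi> \<le> c n" using low by (intro c_near) (auto simp only: to_a less_imp_le)
          have "B (e \<epsilon>) * sqrt (Z2 \<omega> (real n)) \<le> B (e \<epsilon>) * (\<epsilon> / c n * real n)"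
            using less Bpos by (intro mult_left_mono) auto
          also have "\<dots> = (B (e \<epsilon>) * \<epsilon>) / c n * real n" by simp
          also have "\<dots> \<le> (1 + w) * real n"
          proof (rule mult_right_mono)
            have "B (e \<epsilon>) * \<epsilon> \<le> (1 + w) * (c_star - 2 * \<xi>)" using elim(4) by simp
            also have "\<dots> \<le> (1 + w) * c n" using near w by (intro mult_left_mono) auto
            finally show "B (e \<epsilon>) * \<epsilon> / c n \<le> 1 + w" using c_ge(2) by (simp add: pos_divide_le_eq)
          qed simp
          finally show "B (e \<epsilon>) * sqrt (Z2 \<omega> (real n)) \<le> (1 + 1 / real m) * real n" by (simp only: w_def)
        next
          fix n assume n: "3 / real m < real n * e \<epsilon>" "real n * e \<epsilon> < real m" "enat n < T \<epsilon> \<omega>"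
          have win: "\<kappa> * a \<epsilon> \<le> real n" "real n \<le> scale * real m * a \<epsilon>"
            using n(1,2) by (simp_all only: to_a[symmetric]) (simp_all only: to_a less_imp_le)
          note near = c_near[OF win]
          have n': "\<epsilon> powr (- \<nu>) < real n" using elim(5) win(1) by linarith
          have "\<not> sqrt (Z2 \<omega> (real n) / (real n)\<^sup>2) < \<epsilon> / c n"
            using less_INF_enat_not_mem[OF n(3)[unfolded T_def']] near(1) n' unfolding c_def by blast
          then have ge: "\<epsilon> / c n * real n \<le> sqrt (Z2 \<omega> (real n))"
            using sqrt_div_square_less_iff[OF pos[OF n'], of "Z2 \<omega> (real n)" "\<epsilon> / c n"] by linarith
          have "(1 - w) * real n \<le> (B (e \<epsilon>) * \<epsilon>) / c n * real n"
          proof (rule mult_right_mono)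
            have "(1 - w) * c n \<le> (1 - w) * (c_star + 2 * \<xi>)" using near(3) w by (intro mult_left_mono) auto
            also have "\<dots> \<le> B (e \<epsilon>) * \<epsilon>" using elim(3) by simp
            finally show "1 - w \<le> B (e \<epsilon>) * \<epsilon> / c n" using c_ge(2) by (simp add: pos_le_divide_eq)
          qed simp
          also have "\<dots> = B (e \<epsilon>) * (\<epsilon> / c n * real n)" by simp
          also have "\<dots> \<le> B (e \<epsilon>) * sqrt (Z2 \<omega> (real n))" using ge Bpos by (intro mult_left_mono) auto
          finally show "(1 - 1 / real m) * real n \<le> B (e \<epsilon>) * sqrt (Z2 \<omega> (real n))" by (simp only: w_def)
        qed
      qed simp
    qed
  qed
  then show ?thesis by blast
qed

section \<open>Termination, terminal quantiles and coverage\<close>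

definition stopped_near :: "real \<Rightarrow> real \<Rightarrow> 'a \<Rightarrow> bool" where
  "stopped_near \<xi> \<epsilon> \<omega> \<longleftrightarrow> (\<exists>n. T \<epsilon> \<omega> = enat n \<and> 0 < n \<and> \<bar>cl \<epsilon> \<omega> n - c_l\<bar> \<le> \<xi> \<and> \<bar>cu \<epsilon> \<omega> n - c_u\<bar> \<le> \<xi>)"

lemma F_small: "0 < \<gamma> \<Longrightarrow> \<exists>x. F x < \<gamma>"
proof -
  assume "0 < \<gamma>"
  interpret D: real_distribution "distr N borel (limit_statistic Y1 Y2)"
    by (rule real_distribution_distr) measurable
  have "\<forall>\<^sub>F x in at_bot. F x < \<gamma>"
    unfolding F_def by (rule order_tendstoD(2)[OF D.cdf_lim_at_bot \<open>0 < \<gamma>\<close>])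
  then show ?thesis by (auto simp: eventually_at_bot_linorder)
qed

text \<open>Termination inside a window is extracted from \<open>stopped_statistic\<close> at a
  level \<open>x\<close> so low that exceeding it costs only
  \<open>tail 1 x = F x < \<gamma> / 3\<close>. On that window the quantiles are controlled for all
  \<open>n\<close>, in particular at the stopping time.\<close>

lemma stopped_near_whp:
  assumes "0 < \<xi>" "0 < \<gamma>"
  shows "\<forall>\<^sub>F \<epsilon> in at_right 0. whp M \<gamma> (stopped_near \<xi> \<epsilon>)"
proof -
  have "0 < \<gamma> / 3" using assms by simp
  obtain x where x: "F x < \<gamma> / 3" using F_small[OF \<open>0 < \<gamma> / 3\<close>] by blast
  obtain m0 where m0: "\<forall>m\<ge>m0. \<forall>\<^sub>F \<epsilon> in at_right 0. whp M (tail 1 x + \<gamma> / 3)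
      (\<lambda>\<omega>. \<exists>n. T \<epsilon> \<omega> = enat n \<and> real n * e \<epsilon> \<le> real m \<and> 3 / real m < real n * e \<epsilon> \<and>
        real n \<le> 3 / 2 * B (e \<epsilon>) * sqrt (Z2 \<omega> (real n)) \<and> beyond 1 x \<omega> n)"
    using stopped_statistic[OF e_at_right global_crossing F_cont \<open>0 < \<gamma> / 3\<close>, of 1 x] by auto
  define m where "m = max m0 1"
  have m: "m0 \<le> m" "0 < real m" by (auto simp: m_def)
  define \<kappa> where "\<kappa> = 3 * scale / real m"
  have \<kappa>: "0 < \<kappa>" using scale_pos m by (simp add: \<kappa>_def)
  show ?thesis
    using m0[rule_format, OF m(1)] quantiles_close[OF assms(1) \<open>0 < \<gamma> / 3\<close> \<kappa>, of "scale * real m"] eventually_a_pos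
  proof eventually_elim
    case (elim \<epsilon>)
    have to_a: "3 / real m < real n * e \<epsilon> \<longleftrightarrow> \<kappa> * a \<epsilon> < real n" "real n * e \<epsilon> \<le> real m \<longleftrightarrow> real n \<le> scale * real m * a \<epsilon>" for n
      using elim(3) scale_pos m by (simp_all add: e_def \<kappa>_def field_simps)
    from M.whp_conj[OF elim(1,2)] show ?case
    proof (rule whp_mono)
      show "tail 1 x + \<gamma> / 3 + \<gamma> / 3 \<le> \<gamma>" using x by (simp add: tail_def)
      fix \<omega> assume *: "(\<exists>n. T \<epsilon> \<omega> = enat n \<and> real n * e \<epsilon> \<le> real m \<and> 3 / real m < real n * e \<epsilon> \<and>
          real n \<le> 3 / 2 * B (e \<epsilon>) * sqrt (Z2 \<omega> (real n)) \<and> beyond 1 x \<omega> n) \<and>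
        (\<forall>n. \<kappa> * a \<epsilon> \<le> real n \<longrightarrow> real n \<le> scale * real m * a \<epsilon> \<longrightarrow>
          1 \<le> procs \<epsilon> \<omega> n \<and> \<bar>cl \<epsilon> \<omega> n - c_l\<bar> \<le> \<xi> \<and> \<bar>cu \<epsilon> \<omega> n - c_u\<bar> \<le> \<xi>)"
      then obtain n where n: "T \<epsilon> \<omega> = enat n" "real n \<le> scale * real m * a \<epsilon>" "\<kappa> * a \<epsilon> < real n"
        unfolding to_a by blast
      have "0 < \<kappa> * a \<epsilon>" using \<kappa> elim(3) by simp
      then have "0 < n" using n(3) by linarith
      then show "stopped_near \<xi> \<epsilon> \<omega>"
        unfolding stopped_near_def using * n less_imp_le[OF n(3)] by blast
    qed
  qed
qed

definition stopped_beyond :: "real \<Rightarrow> real \<Rightarrow> real \<Rightarrow> 'a \<Rightarrow> bool" where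
  "stopped_beyond \<sigma> x \<epsilon> \<omega> \<longleftrightarrow> (\<exists>n. T \<epsilon> \<omega> = enat n \<and> beyond \<sigma> x \<omega> n)"

lemma stopped_beyond_whp:
  assumes "0 < \<gamma>" "\<sigma> = 1 \<or> \<sigma> = -1"
  shows "\<forall>\<^sub>F \<epsilon> in at_right 0. whp M (tail \<sigma> x + \<gamma>) (stopped_beyond \<sigma> x \<epsilon>)"
proof -
  obtain m where "\<forall>\<^sub>F \<epsilon> in at_right 0. whp M (tail \<sigma> x + \<gamma>)
      (\<lambda>\<omega>. \<exists>n. T \<epsilon> \<omega> = enat n \<and> real n * e \<epsilon> \<le> real m \<and> 3 / real m < real n * e \<epsilon> \<and>
        real n \<le> 3 / 2 * B (e \<epsilon>) * sqrt (Z2 \<omega> (real n)) \<and> beyond \<sigma> x \<omega> n)"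
    using stopped_statistic[OF e_at_right global_crossing F_cont assms, of x] by blast
  then show ?thesis
  proof eventually_elim
    case (elim \<epsilon>)
    show ?case by (rule whp_mono[OF elim order_refl]) (unfold stopped_beyond_def, blast)
  qed
qed

lemmas below_whp = stopped_beyond_whp[of _ "-1", unfolded tail_def, simplified]
lemmas above_whp = stopped_beyond_whp[of _ 1, unfolded tail_def, simplified]

definition terminal :: "real \<Rightarrow> 'a \<Rightarrow> nat \<times> real \<times> real \<times> real \<times> real" where
  "terminal \<epsilon> \<omega> = terminal_values \<delta> c_min \<nu> r d (Z1 \<omega>) (Z2 \<omega>) (\<lambda>j. L1 j \<omega>) (\<lambda>j. L2 j \<omega>) \<epsilon>"

lemma terminal_eq: "T \<epsilon> \<omega> = enat n \<Longrightarrow> terminal \<epsilon> \<omega> = (n, Z1 \<omega> (real n), Z2 \<omega> (real n), cl \<epsilon> \<omega> n, cu \<epsilon> \<omega> n)"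
  by (simp add: terminal_def terminal_values_def T_def cl_def cu_def procs_def emp_quantile_def
      lower_quantile_def upper_quantile_def)

lemma quantiles_tendsto:
  "tendsto_in_probability M (\<lambda>\<epsilon> \<omega>. terminal_quantiles (terminal \<epsilon> \<omega>)) (c_l, c_u) (at_right 0)"
  unfolding tendsto_in_probability_def
proof (intro allI impI tendstoI)
  fix \<xi> \<gamma> :: real assume "0 < \<xi>" "0 < \<gamma>"
  then have "0 < \<xi> / 2" "0 < \<gamma> / 2" by auto
  from stopped_near_whp[OF this]
  show "\<forall>\<^sub>F \<epsilon> in at_right 0. dist (M.prob {\<omega> \<in> space M. \<xi> < dist (terminal_quantiles (terminal \<epsilon> \<omega>)) (c_l, c_u)}) 0 < \<gamma>"
  proof eventually_elim
    case (elim \<epsilon>)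
    have "M.prob {\<omega> \<in> space M. \<xi> < dist (terminal_quantiles (terminal \<epsilon> \<omega>)) (c_l, c_u)} \<le> \<gamma> / 2"
    proof (rule M.whp_imp_prob_le[OF elim])
      fix \<omega> assume "stopped_near (\<xi> / 2) \<epsilon> \<omega>"
      then obtain n where n: "T \<epsilon> \<omega> = enat n" "\<bar>cl \<epsilon> \<omega> n - c_l\<bar> \<le> \<xi> / 2" "\<bar>cu \<epsilon> \<omega> n - c_u\<bar> \<le> \<xi> / 2"
        unfolding stopped_near_def by blast
      have "dist (terminal_quantiles (terminal \<epsilon> \<omega>)) (c_l, c_u) \<le> \<bar>cl \<epsilon> \<omega> n - c_l\<bar> + \<bar>cu \<epsilon> \<omega> n - c_u\<bar>"
        unfolding terminal_eq[OF n(1)] terminal_quantiles_def dist_prod_def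
        by (simp add: dist_real_def) (rule sqrt_sum_squares_le_sum_abs[of "cl \<epsilon> \<omega> n - c_l" "cu \<epsilon> \<omega> n - c_u", simplified])
      then show "\<not> \<xi> < dist (terminal_quantiles (terminal \<epsilon> \<omega>)) (c_l, c_u)" using n by linarith
    qed
    then show ?case using \<open>0 < \<gamma>\<close> by (simp add: dist_real_def)
  qed
qed

lemma mem_confidence_interval:
  assumes "T \<epsilon> \<omega> = enat n" "0 < n"
  shows "\<mu> \<in> confidence_interval (terminal \<epsilon> \<omega>) \<longleftrightarrow>
    cl \<epsilon> \<omega> n * sqrt (Z2 \<omega> (real n)) \<le> Z1 \<omega> (real n) - real n * \<mu> \<and>
    Z1 \<omega> (real n) - real n * \<mu> \<le> cu \<epsilon> \<omega> n * sqrt (Z2 \<omega> (real n))"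
  using assms(2) by (auto simp: terminal_eq[OF assms(1)] confidence_interval_def real_sqrt_divide field_simps)

text \<open>The interval misses \<open>\<mu>\<close> on two disjoint events, one for each endpoint,
  once the terminal quantiles are replaced by \<open>c_l - \<xi>\<close> and
  \<open>c_u + \<xi>\<close>. Disjointness makes the lower bounds for their probabilities
  add.\<close>

lemma coverage_upper:
  assumes "0 < \<xi>" "0 < \<gamma>"
  shows "\<forall>\<^sub>F \<epsilon> in at_right 0. M.prob {\<omega> \<in> space M. \<mu> \<in> confidence_interval (terminal \<epsilon> \<omega>)} \<le> F (c_u + \<xi>) - F (c_l - \<xi>) + 3 * \<gamma>"
  using below_whp[OF assms(2), of "c_l - \<xi>"] above_whp[OF assms(2), of "c_u + \<xi>"] stopped_near_whp[OF assms]
proof eventually_elim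
  case (elim \<epsilon>)
  have "\<not> (stopped_beyond (-1) (c_l - \<xi>) \<epsilon> \<omega> \<and> stopped_beyond 1 (c_u + \<xi>) \<epsilon> \<omega>)" for \<omega>
  proof
    assume "stopped_beyond (-1) (c_l - \<xi>) \<epsilon> \<omega> \<and> stopped_beyond 1 (c_u + \<xi>) \<epsilon> \<omega>"
    then obtain n where n: "0 < Z2 \<omega> (real n)" "Z1 \<omega> (real n) - real n * \<mu> < (c_l - \<xi>) * sqrt (Z2 \<omega> (real n))"
        "(c_u + \<xi>) * sqrt (Z2 \<omega> (real n)) < Z1 \<omega> (real n) - real n * \<mu>"
      unfolding stopped_beyond_def beyond_def by auto
    have "(c_l - \<xi>) * sqrt (Z2 \<omega> (real n)) \<le> (c_u + \<xi>) * sqrt (Z2 \<omega> (real n))"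
      using c_min assms(1) n(1) by (intro mult_right_mono) auto
    then show False using n by linarith
  qed
  from M.whp_conj[OF M.whp_disjoint[OF elim(1,2) this] elim(3)]
  have "M.prob {\<omega> \<in> space M. \<mu> \<in> confidence_interval (terminal \<epsilon> \<omega>)} \<le> 1 - F (c_l - \<xi>) + \<gamma> + (F (c_u + \<xi>) + \<gamma>) - 1 + \<gamma>"
  proof (rule M.whp_imp_prob_le)
    fix \<omega> assume *: "(stopped_beyond (-1) (c_l - \<xi>) \<epsilon> \<omega> \<or> stopped_beyond 1 (c_u + \<xi>) \<epsilon> \<omega>) \<and> stopped_near \<xi> \<epsilon> \<omega>"
    then obtain n where n: "T \<epsilon> \<omega> = enat n" "0 < n" "\<bar>cl \<epsilon> \<omega> n - c_l\<bar> \<le> \<xi>" "\<bar>cu \<epsilon> \<omega> n - c_u\<bar> \<le> \<xi>"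
      unfolding stopped_near_def by blast
    have out: "0 < Z2 \<omega> (real n)" "Z1 \<omega> (real n) - real n * \<mu> < (c_l - \<xi>) * sqrt (Z2 \<omega> (real n)) \<or>
        (c_u + \<xi>) * sqrt (Z2 \<omega> (real n)) < Z1 \<omega> (real n) - real n * \<mu>"
      using * n(1) unfolding stopped_beyond_def beyond_def by auto
    have "(c_l - \<xi>) * sqrt (Z2 \<omega> (real n)) \<le> cl \<epsilon> \<omega> n * sqrt (Z2 \<omega> (real n))"
        "cu \<epsilon> \<omega> n * sqrt (Z2 \<omega> (real n)) \<le> (c_u + \<xi>) * sqrt (Z2 \<omega> (real n))"
      using n(3,4) out(1) by (auto intro!: mult_right_mono simp: abs_le_iff)
    then show "\<not> \<mu> \<in> confidence_interval (terminal \<epsilon> \<omega>)"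
      unfolding mem_confidence_interval[OF n(1,2)] using out(2) by linarith
  qed
  then show ?case by linarith
qed

text \<open>A statistic between \<open>c_l + \<xi>\<close> and \<open>c_u - \<xi>\<close> forces
  \<open>\<mu>\<close> into the interval, so a union bound for the complement suffices.\<close>

lemma coverage_lower:
  assumes "0 < \<xi>" "0 < \<gamma>"
  shows "\<forall>\<^sub>F \<epsilon> in at_right 0. F (c_u - \<xi>) - F (c_l + \<xi>) - 3 * \<gamma> \<le> M.prob {\<omega> \<in> space M. \<mu> \<in> confidence_interval (terminal \<epsilon> \<omega>)}"
  using above_whp[OF assms(2), of "c_l + \<xi>"] below_whp[OF assms(2), of "c_u - \<xi>"] stopped_near_whp[OF assms] eventually_pos
proof eventually_elim
  case (elim \<epsilon>)
  have ev: "{\<omega> \<in> space M. \<mu> \<in> confidence_interval (terminal \<epsilon> \<omega>)} \<in> M.events"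
    unfolding terminal_def by (rule coverage_measurable[OF delta elim(4)])
  from M.whp_conj[OF M.whp_conj[OF elim(1,2)] elim(3)]
  have "M.prob {\<omega> \<in> space M. \<not> \<mu> \<in> confidence_interval (terminal \<epsilon> \<omega>)} \<le> F (c_l + \<xi>) + \<gamma> + (1 - F (c_u - \<xi>) + \<gamma>) + \<gamma>"
  proof (rule M.whp_imp_prob_le)
    fix \<omega> assume *: "(stopped_beyond 1 (c_l + \<xi>) \<epsilon> \<omega> \<and> stopped_beyond (-1) (c_u - \<xi>) \<epsilon> \<omega>) \<and> stopped_near \<xi> \<epsilon> \<omega>"
    then obtain n where n: "T \<epsilon> \<omega> = enat n" "0 < n" "\<bar>cl \<epsilon> \<omega> n - c_l\<bar> \<le> \<xi>" "\<bar>cu \<epsilon> \<omega> n - c_u\<bar> \<le> \<xi>"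
      unfolding stopped_near_def by blast
    have inn: "0 < Z2 \<omega> (real n)" "(c_l + \<xi>) * sqrt (Z2 \<omega> (real n)) < Z1 \<omega> (real n) - real n * \<mu>"
        "Z1 \<omega> (real n) - real n * \<mu> < (c_u - \<xi>) * sqrt (Z2 \<omega> (real n))"
      using * n(1) unfolding stopped_beyond_def beyond_def by auto
    have "cl \<epsilon> \<omega> n * sqrt (Z2 \<omega> (real n)) \<le> (c_l + \<xi>) * sqrt (Z2 \<omega> (real n))"
        "(c_u - \<xi>) * sqrt (Z2 \<omega> (real n)) \<le> cu \<epsilon> \<omega> n * sqrt (Z2 \<omega> (real n))"
      using n(3,4) inn(1) by (auto intro!: mult_right_mono simp: abs_le_iff)
    then show "\<not> \<not> \<mu> \<in> confidence_interval (terminal \<epsilon> \<omega>)"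
      unfolding not_not mem_confidence_interval[OF n(1,2)] using inn by linarith
  qed
  then show ?case using M.prob_neg[OF ev] by simp
qed

text \<open>Continuity turns the strict inequalities on both sides of the quantile into an exact
  value.\<close>

lemma F_at_quantiles: "F c_l = \<delta> / 2" "F c_u = 1 - \<delta> / 2"
proof -
  have eq: "F c = p" if u: "\<And>\<xi>. 0 < \<xi> \<Longrightarrow> F (c - \<xi>) < p \<and> p < F (c + \<xi>)" for c p
  proof (rule ccontr)
    assume "F c \<noteq> p"
    then have "0 < \<bar>F c - p\<bar>" by simp
    from F_close[OF F_cont this, of c] obtain \<rho> where "0 < \<rho>" "F (c + \<rho>) < F c + \<bar>F c - p\<bar>" "F c - \<bar>F c - p\<bar> < F (c - \<rho>)" .
    then show False using u[of \<rho>] by linarith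
  qed
  show "F c_l = \<delta> / 2" "F c_u = 1 - \<delta> / 2" using eq c_l_unique c_u_unique by blast+
qed

lemma coverage_tendsto:
  "((\<lambda>\<epsilon>. M.prob {\<omega> \<in> space M. \<mu> \<in> confidence_interval (terminal \<epsilon> \<omega>)}) \<longlongrightarrow> 1 - \<delta>) (at_right 0)"
proof (rule tendstoI)
  fix \<gamma> :: real assume "0 < \<gamma>"
  then have g: "0 < \<gamma> / 8" by simp
  obtain \<rho>1 where \<rho>1: "0 < \<rho>1" "F (c_l + \<rho>1) < F c_l + \<gamma> / 8" "F c_l - \<gamma> / 8 < F (c_l - \<rho>1)"
    using F_close[OF F_cont g] by blast
  obtain \<rho>2 where \<rho>2: "0 < \<rho>2" "F (c_u + \<rho>2) < F c_u + \<gamma> / 8" "F c_u - \<gamma> / 8 < F (c_u - \<rho>2)"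
    using F_close[OF F_cont g] by blast
  define \<xi> where "\<xi> = min \<rho>1 \<rho>2"
  have \<xi>: "0 < \<xi>" "\<xi> \<le> \<rho>1" "\<xi> \<le> \<rho>2" using \<rho>1 \<rho>2 by (auto simp: \<xi>_def)
  have close: "F (c_l + \<xi>) < F c_l + \<gamma> / 8" "F c_l - \<gamma> / 8 < F (c_l - \<xi>)" "F (c_u + \<xi>) < F c_u + \<gamma> / 8" "F c_u - \<gamma> / 8 < F (c_u - \<xi>)"
    using F_mono[of "c_l + \<xi>" "c_l + \<rho>1"] F_mono[of "c_l - \<rho>1" "c_l - \<xi>"] F_mono[of "c_u + \<xi>" "c_u + \<rho>2"]
      F_mono[of "c_u - \<rho>2" "c_u - \<xi>"] \<xi> \<rho>1 \<rho>2 by auto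
  show "\<forall>\<^sub>F \<epsilon> in at_right 0. dist (M.prob {\<omega> \<in> space M. \<mu> \<in> confidence_interval (terminal \<epsilon> \<omega>)}) (1 - \<delta>) < \<gamma>"
    using coverage_upper[OF \<xi>(1) g] coverage_lower[OF \<xi>(1) g]
  proof eventually_elim
    case (elim \<epsilon>)
    then show ?case using close F_at_quantiles \<open>0 < \<gamma>\<close> unfolding dist_real_def by linarith
  qed
qed

end

theorem theorem3p3:
  fixes M :: "'a measure" and N :: "'b measure"
    and Z1 Z2 :: "'a \<Rightarrow> real \<Rightarrow> real"
    and L1 L2 :: "nat \<Rightarrow> 'a \<Rightarrow> real \<Rightarrow> real"
    and Y1 Y2 :: "'b \<Rightarrow> real \<Rightarrow> real"
    and \<mu> h \<nu> r \<delta> c_min c_l c_u :: real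
    and l A_inv F :: "real \<Rightarrow> real"
    and d :: "nat \<times> real \<times> real \<times> real \<times> real"
  assumes M: "prob_space M" and N: "prob_space N"
    and delta: "0 < \<delta>" "\<delta> < 1"
    and nu: "0 < \<nu>" "\<nu> < 1 / (1 - h)"
    and F_def: "F = cdf (distr N borel (limit_statistic Y1 Y2))"
    and c_l_def: "c_l = quantile F (\<delta> / 2)"
    and c_u_def: "c_u = quantile F (1 - \<delta> / 2)"
    and A_inv: "asymptotic_inverse (\<lambda>x. x powr (1 - h) * l x) A_inv"
    and global_limit: "functional_limit_condition M Z1 Z2 \<mu> h l N Y1 Y2"
    and local_limit: "\<And>j. j \<ge> 1 \<Longrightarrow> functional_limit_condition M (L1 j) (L2 j) \<mu> h l N Y1 Y2"
    and global_no_early: "no_early_stopping M Z2 \<nu> (\<lambda>\<epsilon>. A_inv (1 / \<epsilon>))"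
    and local_no_early: "\<And>j. j \<ge> 1 \<Longrightarrow> no_early_stopping M (L2 j) \<nu> (\<lambda>\<epsilon>. A_inv (1 / \<epsilon>))"
    and streams: "independent_copies M Z1 Z2 L1 L2"
    and F_cont: "continuous_on UNIV F"
    and c_l_unique: "\<And>\<xi>. \<xi> > 0 \<Longrightarrow> F (c_l - \<xi>) < \<delta> / 2 \<and> \<delta> / 2 < F (c_l + \<xi>)"
    and c_u_unique: "\<And>\<xi>. \<xi> > 0 \<Longrightarrow> F (c_u - \<xi>) < 1 - \<delta> / 2 \<and> 1 - \<delta> / 2 < F (c_u + \<xi>)"
    and r: "0 < r" "r < 1"
    and c_min: "0 < c_min" "c_min < c_u - c_l"
    and passage_pos: "AE \<omega> in N. 0 < first_passage (Y2 \<omega>) 1"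
    and passage_cont: "AE \<omega> in N. isCont (first_passage (Y2 \<omega>)) 1"
      "AE \<omega> in N. isCont (first_passage (Y2 \<omega>)) (1 / (c_u - c_l))"
  shows "tendsto_in_probability M
           (\<lambda>\<epsilon> \<omega>. terminal_quantiles
             (terminal_values \<delta> c_min \<nu> r d (Z1 \<omega>) (Z2 \<omega>) (\<lambda>j. L1 j \<omega>) (\<lambda>j. L2 j \<omega>) \<epsilon>))
           (c_l, c_u) (at_right 0) \<and>
         ((\<lambda>\<epsilon>. measure M {\<omega> \<in> space M. \<mu> \<in> confidence_interval
             (terminal_values \<delta> c_min \<nu> r d (Z1 \<omega>) (Z2 \<omega>) (\<lambda>j. L1 j \<omega>) (\<lambda>j. L2 j \<omega>) \<epsilon>)})
           \<longlongrightarrow> 1 - \<delta>) (at_right 0)"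
proof -
  note flc = global_limit[unfolded functional_limit_condition_def]
  interpret sequential_limit N Y1 Y2 h M Z1 Z2 \<mu> \<nu> l A_inv
    by (intro sequential_limit.intro limit_process.intro limit_process_axioms.intro sequential_limit_axioms.intro)
      (use M N flc nu A_inv global_no_early passage_pos passage_cont in blast)+
  have F: "sequential_limit.F N Y1 Y2 = F"
    by (simp add: F_def assms)
  interpret coverage N Y1 Y2 h M Z1 Z2 \<mu> \<nu> l A_inv L1 L2 r \<delta> c_min c_l c_u d
    by unfold_locales (use streams r delta F_cont c_l_unique c_u_unique c_min F in auto)
  show ?thesis
    using quantiles_tendsto coverage_tendsto unfolding terminal_def by blast
qed

end
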